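(* Let $G$ be a sofic group and let $D$ be a division ring. Then the group ring $D(G)$ can be embedded (as a unital subring, via an injective ring homomorphism) into an indecomposable, continuous von Neumann regular ring $R(G)$. *)

theory Defs
  imports Complex_Main "HOL-Algebra.Algebra" "HOL-Combinatorics.Permutations"
begin

definition hamming_dist :: "nat \<Rightarrow> (nat \<Rightarrow> nat) \<Rightarrow> (nat \<Rightarrow> nat) \<Rightarrow> real" where
  "hamming_dist n \<sigma> \<tau> = real (card {i\<in>{..<n}. \<sigma> i \<noteq> \<tau> i}) / real n"

definition sofic_group :: "('g, 'x) monoid_scheme \<Rightarrow> bool" where
  "sofic_group G \<longleftrightarrow>
     (\<forall>F \<epsilon>. F \<subseteq> carrier G \<and> finite F \<and> \<epsilon> > (0::real) \<longrightarrow>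
        (\<exists>n::nat. n > 0 \<and> (\<exists>\<phi> :: 'g \<Rightarrow> nat \<Rightarrow> nat.
           (\<forall>g\<in>carrier G. \<phi> g permutes {..<n}) \<and>
           (\<forall>g\<in>F. \<forall>h\<in>F. hamming_dist n (\<phi> (g \<otimes>\<^bsub>G\<^esub> h)) (\<phi> g \<circ> \<phi> h) < \<epsilon>) \<and>
           (\<forall>g\<in>F. g \<noteq> \<one>\<^bsub>G\<^esub> \<longrightarrow> hamming_dist n (\<phi> g) id > 1 - \<epsilon>))))"

definition division_ring :: "('d, 'y) ring_scheme \<Rightarrow> bool" where
  "division_ring D \<longleftrightarrow> ring D \<and> \<zero>\<^bsub>D\<^esub> \<noteq> \<one>\<^bsub>D\<^esub> \<and>
     Units D = carrier D - {\<zero>\<^bsub>D\<^esub>}"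

definition group_ring :: "'d ring \<Rightarrow> 'g monoid \<Rightarrow> ('g \<Rightarrow> 'd) ring" where
  "group_ring D G =
    \<lparr> carrier = {f. (\<forall>x. x \<notin> carrier G \<longrightarrow> f x = \<zero>\<^bsub>D\<^esub>) \<and>
                   (\<forall>x\<in>carrier G. f x \<in> carrier D) \<and>
                   finite {x\<in>carrier G. f x \<noteq> \<zero>\<^bsub>D\<^esub>}},
      monoid.mult = (\<lambda>f g x. if x \<in> carrier G
                 then finsum D (\<lambda>y. f y \<otimes>\<^bsub>D\<^esub> g (inv\<^bsub>G\<^esub> y \<otimes>\<^bsub>G\<^esub> x))
                        {y\<in>carrier G. f y \<noteq> \<zero>\<^bsub>D\<^esub>}
                 else \<zero>\<^bsub>D\<^esub>),
      one = (\<lambda>x. if x = \<one>\<^bsub>G\<^esub> then \<one>\<^bsub>D\<^esub> else \<zero>\<^bsub>D\<^esub>),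
      ring.zero = (\<lambda>x. \<zero>\<^bsub>D\<^esub>),
      ring.add = (\<lambda>f g x. f x \<oplus>\<^bsub>D\<^esub> g x) \<rparr>"

definition vn_regular :: "('a, 'b) ring_scheme \<Rightarrow> bool" where
  "vn_regular R \<longleftrightarrow>
     (\<forall>a\<in>carrier R. \<exists>x\<in>carrier R. a \<otimes>\<^bsub>R\<^esub> x \<otimes>\<^bsub>R\<^esub> a = a)"

text \<open>Indecomposable: nonzero, and the only central idempotents are 0 and 1
  (i.e. R is not a direct product of two nonzero rings).\<close>
definition indecomposable_ring :: "('a, 'b) ring_scheme \<Rightarrow> bool" where
  "indecomposable_ring R \<longleftrightarrow> \<zero>\<^bsub>R\<^esub> \<noteq> \<one>\<^bsub>R\<^esub> \<and>
     (\<forall>e\<in>carrier R. e \<otimes>\<^bsub>R\<^esub> e = e \<and> (\<forall>r\<in>carrier R. e \<otimes>\<^bsub>R\<^esub> r = r \<otimes>\<^bsub>R\<^esub> e)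
        \<longrightarrow> e = \<zero>\<^bsub>R\<^esub> \<or> e = \<one>\<^bsub>R\<^esub>)"

definition is_sup_in :: "'a set set \<Rightarrow> 'a set set \<Rightarrow> 'a set \<Rightarrow> bool" where
  "is_sup_in L S x \<longleftrightarrow> x \<in> L \<and> (\<forall>s\<in>S. s \<subseteq> x) \<and> (\<forall>y\<in>L. (\<forall>s\<in>S. s \<subseteq> y) \<longrightarrow> x \<subseteq> y)"

definition is_inf_in :: "'a set set \<Rightarrow> 'a set set \<Rightarrow> 'a set \<Rightarrow> bool" where
  "is_inf_in L S x \<longleftrightarrow> x \<in> L \<and> (\<forall>s\<in>S. x \<subseteq> s) \<and> (\<forall>y\<in>L. (\<forall>s\<in>S. y \<subseteq> s) \<longrightarrow> y \<subseteq> x)"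

definition sup_in :: "'a set set \<Rightarrow> 'a set set \<Rightarrow> 'a set" where
  "sup_in L S = (THE x. is_sup_in L S x)"

definition inf_in :: "'a set set \<Rightarrow> 'a set set \<Rightarrow> 'a set" where
  "inf_in L S = (THE x. is_inf_in L S x)"

definition complete_in :: "'a set set \<Rightarrow> bool" where
  "complete_in L \<longleftrightarrow> (\<forall>S\<subseteq>L. (\<exists>x. is_sup_in L S x) \<and> (\<exists>x. is_inf_in L S x))"

text \<open>Upper continuous lattice (Goodearl, ch. 13): complete, and
  a \<and> (\<Or> b_i) = \<Or> (a \<and> b_i) for every element a and every chain (b_i).\<close>
definition upper_continuous_in :: "'a set set \<Rightarrow> bool" where
  "upper_continuous_in L \<longleftrightarrow> complete_in L \<and>
     (\<forall>a\<in>L. \<forall>C. C \<subseteq> L \<and> C \<noteq> {} \<and> Complete_Partial_Order.chain (\<subseteq>) C \<longrightarrow>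
        inf_in L {a, sup_in L C} = sup_in L ((\<lambda>b. inf_in L {a, b}) ` C))"

definition principal_right_ideals :: "('a, 'b) ring_scheme \<Rightarrow> 'a set set" where
  "principal_right_ideals R = {{a \<otimes>\<^bsub>R\<^esub> x | x. x \<in> carrier R} | a. a \<in> carrier R}"

definition principal_left_ideals :: "('a, 'b) ring_scheme \<Rightarrow> 'a set set" where
  "principal_left_ideals R = {{x \<otimes>\<^bsub>R\<^esub> a | x. x \<in> carrier R} | a. a \<in> carrier R}"

definition continuous_ring :: "('a, 'b) ring_scheme \<Rightarrow> bool" where
  "continuous_ring R \<longleftrightarrow> vn_regular R \<and>
     upper_continuous_in (principal_right_ideals R) \<and>
     upper_continuous_in (principal_left_ideals R)"

end

theory Submission
  imports Defs
begin

text \<open>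
  Soficity gives, for every finite set of group elements and every tolerance, permutations that
  almost multiply like the group and almost have no fixed points; an element of \<open>D(G)\<close> thereby
  becomes a family of endomorphisms of the spaces \<open>D\<^sup>n\<close>. Fix an ultrafilter on the index set.
  The ultralimit \<open>N\<close> of the normalised ranks is a pseudo-rank function on the product
  of the endomorphism rings, and \<open>R(G)\<close> is the quotient by \<open>{N = 0}\<close>. In this quotient the families
  depend multiplicatively on the group ring element, and a nonzero element is not killed because
  its matrices contain, up to a permutation of the columns, an invertible diagonal block of size
  proportional to \<open>n\<close>.

  Everything else follows from inequalities that pass to ultralimits: subadditivity,
  \<open>N(ab) \<le> min (N a) (N b)\<close>, the Frobenius inequality \<open>N(ab) + N(bc) \<le> N(b) + N(abc)\<close>, and the
  existence of \<open>x\<close> with \<open>N(axb) \<ge> min (N a) (N b)\<close>. The last one makes central idempotents trivial.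
  The quotient is \<open>N\<close>-complete, so a directed family of idempotents, whose ranks are bounded,
  contains a Cauchy sequence whose limit generates the supremum; this gives upper continuity.
  All the axioms are left-right symmetric, so the left ideals are covered by the opposite ring.
\<close>

section \<open>Rank functions on regular rings\<close>

text \<open>Three points shape the development. Completeness is phrased with steps of rank at most
  \<open>(1/2) ^ k\<close>. In the product these bounds hold only for almost all indices, and the
  exceptional set depends on \<open>k\<close>; the limit therefore has to be chosen index by index,
  according to how long the bounds persist there. Next, additivity of rank on orthogonal idempotents
  is replaced by a single inequality: if \<open>e = b c\<close> then
  \<open>N ((1 - e) b) \<le> N b - N e\<close>. This is the Frobenius inequality with vanishing
  triple product, and for matrices it says that a linear map cannot enlarge a difference of
  dimensions. Finally, the ring has to live on a type built only from the types of \<open>G\<close>,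
  \<open>D\<close> and the naturals. Hence the indices are finite lists of group elements, a family
  of matrices is replaced by the set of codes of its entries, and an element of the quotient is a
  set of such sets.\<close>

locale pseudo_rank_ring = ring R for R (structure) +
  fixes N :: "'a \<Rightarrow> real"
  assumes N_zero [simp]: "N \<zero> = 0"
    and N_one: "N \<one> \<noteq> 0"
    and N_add: "\<lbrakk>x \<in> carrier R; y \<in> carrier R\<rbrakk> \<Longrightarrow> N (x \<oplus> y) \<le> N x + N y"
    and N_mult_le_left: "\<lbrakk>x \<in> carrier R; y \<in> carrier R\<rbrakk> \<Longrightarrow> N (x \<otimes> y) \<le> N x"
    and N_mult_le_right: "\<lbrakk>x \<in> carrier R; y \<in> carrier R\<rbrakk> \<Longrightarrow> N (x \<otimes> y) \<le> N y"
    and N_frobenius: "\<lbrakk>a \<in> carrier R; b \<in> carrier R; c \<in> carrier R\<rbrakk> \<Longrightarrow>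
      N (a \<otimes> b) + N (b \<otimes> c) \<le> N b + N (a \<otimes> b \<otimes> c)"
    and N_prime: "\<lbrakk>a \<in> carrier R; b \<in> carrier R\<rbrakk> \<Longrightarrow>
      \<exists>x\<in>carrier R. min (N a) (N b) \<le> N (a \<otimes> x \<otimes> b)"
    and regular: "a \<in> carrier R \<Longrightarrow> \<exists>x\<in>carrier R. a \<otimes> x \<otimes> a = a"
    and N_complete: "\<lbrakk>\<And>k. u k \<in> carrier R; \<And>k. N (u (Suc k) \<ominus> u k) \<le> (1/2) ^ k\<rbrakk> \<Longrightarrow>
      \<exists>y\<in>carrier R. (\<lambda>k. N (u k \<ominus> y)) \<longlonglongrightarrow> 0"
begin

lemma N_nonneg: "x \<in> carrier R \<Longrightarrow> 0 \<le> N x"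
  using N_mult_le_left[of x \<zero>] by simp

lemma N_le_one: "x \<in> carrier R \<Longrightarrow> N x \<le> N \<one>"
  using N_mult_le_left[of \<one> x] by simp

lemma N_uminus: assumes "x \<in> carrier R" shows "N (\<ominus> x) = N x"
proof -
  have *: "N (\<ominus> y) \<le> N y" if "y \<in> carrier R" for y
    using N_mult_le_right[of "\<ominus> \<one>" y] that by (simp add: l_minus)
  show ?thesis using *[OF assms] *[of "\<ominus> x"] assms by simp
qed

lemma diff_diff_eq_minus:
  assumes "x \<in> carrier R" "y \<in> carrier R" shows "\<ominus> (x \<ominus> y) = y \<ominus> x"
  using assms by (simp add: minus_eq minus_add a_comm)

lemma N_diff_commute:
  assumes "x \<in> carrier R" "y \<in> carrier R" shows "N (x \<ominus> y) = N (y \<ominus> x)"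
  using N_uminus[of "x \<ominus> y"] assms by (simp add: diff_diff_eq_minus)

lemma diff_split:
  assumes "x \<in> carrier R" "y \<in> carrier R" "z \<in> carrier R"
  shows "x \<ominus> z = (x \<ominus> y) \<oplus> (y \<ominus> z)"
  using assms by (simp add: minus_eq a_assoc r_neg2 l_neg r_neg1)

lemma N_triangle:
  assumes "x \<in> carrier R" "y \<in> carrier R" "z \<in> carrier R"
  shows "N (x \<ominus> z) \<le> N (x \<ominus> y) + N (y \<ominus> z)"
  using N_add[of "x \<ominus> y" "y \<ominus> z"] diff_split[OF assms] assms by simp

lemma l_distr_minus:
  "\<lbrakk>x \<in> carrier R; y \<in> carrier R; z \<in> carrier R\<rbrakk> \<Longrightarrow> (x \<ominus> y) \<otimes> z = x \<otimes> z \<ominus> y \<otimes> z"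
  by (simp add: minus_eq l_distr l_minus)

lemma r_distr_minus:
  "\<lbrakk>x \<in> carrier R; y \<in> carrier R; z \<in> carrier R\<rbrakk> \<Longrightarrow> z \<otimes> (x \<ominus> y) = z \<otimes> x \<ominus> z \<otimes> y"
  by (simp add: minus_eq r_distr r_minus)

lemma diff_self: "x \<in> carrier R \<Longrightarrow> x \<ominus> x = \<zero>"
  by (simp add: minus_eq r_neg)

lemma diff_zero: "x \<in> carrier R \<Longrightarrow> x \<ominus> \<zero> = x"
  by (simp add: minus_eq)

lemma add_diff_cancel: "\<lbrakk>x \<in> carrier R; y \<in> carrier R\<rbrakk> \<Longrightarrow> x \<oplus> (y \<ominus> x) = y"
  by (simp add: minus_eq a_lcomm[of x y] r_neg)

lemma diff_eq_zeroD: "\<lbrakk>x \<in> carrier R; y \<in> carrier R; x \<ominus> y = \<zero>\<rbrakk> \<Longrightarrow> x = y"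
  using add_diff_cancel[of y x] by simp

section \<open>Idempotents, their complements and joins\<close>

definition idems :: "'a set" where
  "idems = {e \<in> carrier R. e \<otimes> e = e}"

lemma idemsD: "e \<in> idems \<Longrightarrow> e \<otimes> e = e"
  by (simp add: idems_def)

lemma idemsI: "\<lbrakk>e \<in> carrier R; e \<otimes> e = e\<rbrakk> \<Longrightarrow> e \<in> idems"
  by (simp add: idems_def)

lemma idems_closed [simp, intro]: "e \<in> idems \<Longrightarrow> e \<in> carrier R"
  by (simp add: idems_def)

text \<open>The Frobenius inequality for \<open>\<one> \<ominus> e\<close>, \<open>b\<close>,
  \<open>c\<close>: the triple product is \<open>(\<one> \<ominus> e) \<otimes> e = \<zero>\<close>,
  so its right-hand side collapses to \<open>N b\<close>. Every estimate of how far one right ideal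
  exceeds another goes through this bound.\<close>

lemma N_complement_le:
  assumes "e \<in> idems" "b \<in> carrier R" "c \<in> carrier R" "b \<otimes> c = e"
  shows "N ((\<one> \<ominus> e) \<otimes> b) \<le> N b - N e"
proof -
  have [simp]: "e \<in> carrier R" using assms by simp
  have "(\<one> \<ominus> e) \<otimes> b \<otimes> c = (\<one> \<ominus> e) \<otimes> e"
    using assms(2,3) by (simp add: m_assoc assms(4))
  also have "\<dots> = \<zero>"
    using assms(1) by (simp add: l_distr_minus idemsD diff_self)
  finally show ?thesis
    using N_frobenius[of "\<one> \<ominus> e" b c] assms(2,3) by (simp add: assms(4))
qed

text \<open>A generator \<open>f\<close> of \<open>eR + bR\<close>, obtained by adding to
  \<open>e\<close> an idempotent orthogonal to it. The last clause is minimality: a left unit for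
  \<open>e\<close> and \<open>b\<close> is one for \<open>f\<close>. The equation
  \<open>e \<otimes> f = e\<close> is not determined by the right ideals alone; it is what makes
  \<open>f \<ominus> e\<close> small when the ranks of \<open>e\<close> and \<open>f\<close> are
  close.\<close>

lemma idem_join:
  assumes e: "e \<in> idems" and b: "b \<in> carrier R"
  obtains f where "f \<in> idems" "f \<otimes> e = e" "e \<otimes> f = e" "f \<otimes> b = b"
    "\<And>d. \<lbrakk>d \<in> carrier R; d \<otimes> e = e; d \<otimes> b = b\<rbrakk> \<Longrightarrow> d \<otimes> f = f"
proof -
  note [simp] = l_distr_minus r_distr_minus diff_self diff_zero
  have [simp]: "e \<in> carrier R" "e \<otimes> e = e" using e idemsD by auto
  have ee [simp]: "e \<otimes> (e \<otimes> x) = e \<otimes> x" if "x \<in> carrier R" for x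
    using that by (simp add: m_assoc[symmetric])
  define y where "y = (\<one> \<ominus> e) \<otimes> b"
  have [simp]: "y \<in> carrier R" using b by (simp add: y_def)
  obtain z where z [simp]: "z \<in> carrier R" and yzy: "y \<otimes> z \<otimes> y = y" using regular[of y] by auto
  \<comment> \<open>The idempotent \<open>y \<otimes> z\<close> already generates \<open>yR\<close>,
    but it only satisfies \<open>e \<otimes> (y \<otimes> z) = \<zero>\<close>; the last factor adds
    orthogonality on the other side.\<close>
  define g where "g = y \<otimes> z \<otimes> (\<one> \<ominus> e)"
  have [simp]: "g \<in> carrier R" by (simp add: g_def)
  have ey: "e \<otimes> y = \<zero>" using b by (simp add: y_def)
  have eg: "e \<otimes> g = \<zero>"
  proof -
    have "e \<otimes> g = e \<otimes> y \<otimes> z \<otimes> (\<one> \<ominus> e)"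
      unfolding g_def by (simp add: m_assoc del: l_distr_minus r_distr_minus)
    then show ?thesis using ey by simp
  qed
  have ge: "g \<otimes> e = \<zero>"
  proof -
    have "g \<otimes> e = y \<otimes> z \<otimes> ((\<one> \<ominus> e) \<otimes> e)"
      unfolding g_def by (simp add: m_assoc del: l_distr_minus r_distr_minus)
    then show ?thesis by simp
  qed
  have gb: "g \<otimes> b = y"
  proof -
    have "g \<otimes> b = y \<otimes> z \<otimes> ((\<one> \<ominus> e) \<otimes> b)"
      unfolding g_def using b by (simp add: m_assoc del: l_distr_minus r_distr_minus)
    then show ?thesis using yzy by (simp add: y_def del: l_distr_minus r_distr_minus)
  qed
  have gy: "g \<otimes> y = y"
    using b ge gb by (simp add: y_def m_assoc[symmetric])
  have gg: "g \<otimes> g = g"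
  proof -
    have "g \<otimes> g = g \<otimes> y \<otimes> (z \<otimes> (\<one> \<ominus> e))"
      by (subst (2) g_def) (simp add: m_assoc del: l_distr_minus r_distr_minus)
    also have "\<dots> = g" unfolding gy by (simp add: g_def m_assoc del: l_distr_minus r_distr_minus)
    finally show ?thesis .
  qed
  have eb: "e \<otimes> b \<oplus> y = b"
    using b by (simp add: y_def add_diff_cancel)
  show ?thesis
  proof (rule that[of "e \<oplus> g"])
    show "e \<oplus> g \<in> idems"
      by (rule idemsI) (simp_all add: l_distr r_distr eg ge gg)
    show "(e \<oplus> g) \<otimes> e = e" by (simp add: l_distr ge)
    show "e \<otimes> (e \<oplus> g) = e" by (simp add: r_distr eg)
    show "(e \<oplus> g) \<otimes> b = b" using b by (simp add: l_distr gb eb)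
    fix d assume d: "d \<in> carrier R" "d \<otimes> e = e" "d \<otimes> b = b"
    have "d \<otimes> y = y"
    proof -
      have "d \<otimes> y = d \<otimes> b \<ominus> d \<otimes> e \<otimes> b" using d(1) b by (simp add: y_def m_assoc)
      then show ?thesis using b by (simp add: y_def d(2,3))
    qed
    then have "d \<otimes> g = g" using d(1) by (simp add: g_def m_assoc[symmetric] del: l_distr_minus r_distr_minus)
    then show "d \<otimes> (e \<oplus> g) = e \<oplus> g" using d(1) by (simp add: r_distr d(2))
  qed
qed

end

section \<open>Suprema of directed families of idempotents\<close>

locale rank_ring = pseudo_rank_ring +
  assumes N_definite: "\<lbrakk>x \<in> carrier R; N x = 0\<rbrakk> \<Longrightarrow> x = \<zero>"
begin

lemma eq_zero_if_N_small:
  assumes "x \<in> carrier R" "u \<longlonglongrightarrow> 0" "\<And>k. N x \<le> u k"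
  shows "x = \<zero>"
proof -
  have "N x \<le> 0" using assms(2,3) by (intro LIMSEQ_le_const) auto
  then show ?thesis using N_nonneg[OF assms(1)] N_definite[OF assms(1)] by simp
qed

lemma eq_if_N_small:
  assumes "x \<in> carrier R" "y \<in> carrier R" "u \<longlonglongrightarrow> 0" "\<And>k. N (x \<ominus> y) \<le> u k"
  shows "x = y"
  using eq_zero_if_N_small[of "x \<ominus> y" u] diff_eq_zeroD[OF assms(1,2)] assms by simp

text \<open>Directedness concerns right ideals only, so two members of \<open>T\<close> with nearly
  equal ranks may still differ by an element of large rank. The Cauchy sequence is therefore built
  from other generators of the same right ideals, chosen with \<open>idem_join\<close> so that each
  absorbs its predecessor on both sides. The last conclusion says that the rank of the supremum is
  approached within \<open>T\<close>.\<close>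

lemma directed_idem_sup:
  assumes T: "T \<subseteq> idems" "T \<noteq> {}"
    and dir: "\<And>a b. \<lbrakk>a \<in> T; b \<in> T\<rbrakk> \<Longrightarrow> \<exists>c\<in>T. c \<otimes> a = a \<and> c \<otimes> b = b"
  obtains e where "e \<in> idems" "\<And>t. t \<in> T \<Longrightarrow> e \<otimes> t = t"
    "\<And>d. \<lbrakk>d \<in> carrier R; \<And>t. t \<in> T \<Longrightarrow> d \<otimes> t = t\<rbrakk> \<Longrightarrow> d \<otimes> e = e"
    "\<And>\<epsilon>. \<epsilon> > 0 \<Longrightarrow> \<exists>t\<in>T. N e - \<epsilon> < N t"
proof -
  have Tc: "t \<in> carrier R" if "t \<in> T" for t using that T by auto
  define s where "s = Sup (N ` T)"
  have bdd: "bdd_above (N ` T)" using N_le_one Tc by (auto intro!: bdd_aboveI)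
  have le_s: "N t \<le> s" if "t \<in> T" for t
    unfolding s_def using that bdd by (auto intro: cSup_upper)
  have approx: "\<exists>t\<in>T. s - (1/2)^k < N t" for k :: nat
    using less_cSup_iff[OF _ bdd, of "s - (1/2)^k"] T(2) by (auto simp: s_def)
  \<comment> \<open>\<open>Q e\<close> says that \<open>e\<close> generates the same right ideal as
    some member of \<open>T\<close>; it allows a change of generator without leaving the family of
    ideals.\<close>
  define Q where "Q e \<longleftrightarrow> e \<in> idems \<and> (\<exists>t\<in>T. t \<otimes> e = e \<and> e \<otimes> t = t)" for e
  have Q_le_s: "N e \<le> s" if "Q e" for e
  proof -
    from that obtain t where "t \<in> T" "t \<otimes> e = e" "e \<in> idems" by (auto simp: Q_def)
    then show ?thesis using N_mult_le_left[of t e] le_s[of t] Tc[of t] by auto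
  qed
  have step: "\<exists>f. Q f \<and> f \<otimes> e = e \<and> e \<otimes> f = e \<and> f \<otimes> b = b" if e: "Q e" and b: "b \<in> T" for e b
  proof -
    from e obtain t where t: "t \<in> T" "t \<otimes> e = e" "e \<otimes> t = t" and ei: "e \<in> idems"
      by (auto simp: Q_def)
    obtain c where c: "c \<in> T" "c \<otimes> t = t" "c \<otimes> b = b" using dir[OF t(1) b] by auto
    note [simp] = Tc[OF c(1)] Tc[OF b] Tc[OF t(1)] idems_closed[OF ei]
    have "c \<otimes> (t \<otimes> e) = t \<otimes> e" using c(2) by (simp add: m_assoc[symmetric])
    then have ce: "c \<otimes> e = e" using t(2) by simp
    obtain f where f: "f \<in> idems" "f \<otimes> e = e" "e \<otimes> f = e" "f \<otimes> c = c"
      "\<And>d. \<lbrakk>d \<in> carrier R; d \<otimes> e = e; d \<otimes> c = c\<rbrakk> \<Longrightarrow> d \<otimes> f = f"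
      using idem_join[OF ei Tc[OF c(1)]] by metis
    \<comment> \<open>\<open>c\<close> is a left unit for both \<open>e\<close> and
      \<open>c\<close>, so minimality of the join gives \<open>c \<otimes> f = f\<close>; together
      with \<open>f \<otimes> c = c\<close> this means that \<open>f\<close> and \<open>c\<close>
      generate the same right ideal.\<close>
    have "c \<otimes> c = c" using c(1) T idemsD by auto
    then have "c \<otimes> f = f" using f(5) ce by simp
    then have "Q f" using f c(1) by (auto simp: Q_def)
    moreover have "f \<otimes> b = b"
    proof -
      have "f \<otimes> (c \<otimes> b) = c \<otimes> b" using f(1,4) by (simp add: m_assoc[symmetric])
      then show ?thesis by (simp add: c(3))
    qed
    ultimately show ?thesis using f by auto
  qed
  have QT: "Q t" if "t \<in> T" for t using that T idemsD by (auto simp: Q_def)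
  have "\<exists>E. \<forall>k. (Q (E k) \<and> s - (1/2)^k < N (E k)) \<and>
      (E (Suc k) \<otimes> E k = E k \<and> E k \<otimes> E (Suc k) = E k)"
  proof (rule dependent_nat_choice)
    show "\<exists>e. Q e \<and> s - (1/2)^0 < N e" using approx[of 0] QT by auto
  next
    fix e k assume e: "Q e \<and> s - (1/2)^k < N e"
    obtain b where b: "b \<in> T" "s - (1/2)^Suc k < N b" using approx by blast
    obtain f where f: "Q f" "f \<otimes> e = e" "e \<otimes> f = e" "f \<otimes> b = b" using step e b(1) by blast
    have "N b \<le> N f" using N_mult_le_left[of f b] f b(1) Tc by (auto simp: Q_def)
    then show "\<exists>f. (Q f \<and> s - (1/2)^Suc k < N f) \<and> f \<otimes> e = e \<and> e \<otimes> f = e" using f b by fastforce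
  qed
  then obtain E where E: "\<And>k. Q (E k) \<and> s - (1/2)^k < N (E k)"
    and Es: "\<And>k. E (Suc k) \<otimes> E k = E k \<and> E k \<otimes> E (Suc k) = E k"
    by blast
  have Ei: "E k \<in> idems" for k using E[of k] by (simp add: Q_def)
  note Ec [simp] = idems_closed[OF Ei]
  have diff: "N (E (Suc k) \<ominus> E k) \<le> (1/2)^k" for k
  proof -
    \<comment> \<open>This identity is where \<open>E k \<otimes> E (Suc k) = E k\<close> is
      needed.\<close>
    have "E (Suc k) \<ominus> E k = (\<one> \<ominus> E k) \<otimes> E (Suc k)" using Es[of k] by (simp add: l_distr_minus)
    also have "N \<dots> \<le> N (E (Suc k)) - N (E k)"
      using N_complement_le[OF Ei[of k], of "E (Suc k)" "E k"] Es by simp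
    also have "\<dots> \<le> (1/2)^k" using Q_le_s[of "E (Suc k)"] E[of k] E[of "Suc k"] by simp
    finally show ?thesis .
  qed
  obtain e where e [simp]: "e \<in> carrier R" and lim: "(\<lambda>k. N (E k \<ominus> e)) \<longlonglongrightarrow> 0"
    using N_complete[of E, OF Ec diff] by blast
  have mono: "E (k + m) \<otimes> E k = E k" for k m
  proof (induct m)
    case 0 then show ?case using idemsD[OF Ei] by simp
  next
    case (Suc m)
    have "E (Suc (k + m)) \<otimes> (E (k + m) \<otimes> E k) = E (k + m) \<otimes> E k"
      using Es[of "k+m"] by (simp add: m_assoc[symmetric])
    then show ?case using Suc by simp
  qed
  have eE: "e \<otimes> E k = E k" for k
  proof (rule eq_if_N_small)
    show "(\<lambda>m. N (E (m + k) \<ominus> e)) \<longlonglongrightarrow> 0" using LIMSEQ_ignore_initial_segment[OF lim] .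
    fix m
    have "e \<otimes> E k \<ominus> E k = (e \<ominus> E (k + m)) \<otimes> E k" by (simp add: l_distr_minus mono)
    also have "N \<dots> \<le> N (e \<ominus> E (k + m))" by (simp add: N_mult_le_left)
    also have "\<dots> = N (E (m + k) \<ominus> e)" using N_diff_commute by (simp add: add.commute)
    finally show "N (e \<otimes> E k \<ominus> E k) \<le> N (E (m + k) \<ominus> e)" .
  qed auto
  have limit_unit: "d \<otimes> e = e" if d: "d \<in> carrier R" "\<And>k. d \<otimes> E k = E k" for d
  proof (rule eq_if_N_small)
    show "(\<lambda>k. N (E k \<ominus> e) + N (E k \<ominus> e)) \<longlonglongrightarrow> 0" using tendsto_add[OF lim lim] by simp
    fix k
    have "N (d \<otimes> e \<ominus> e) \<le> N (d \<otimes> e \<ominus> d \<otimes> E k) + N (E k \<ominus> e)"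
      using N_triangle[of "d \<otimes> e" "d \<otimes> E k" e] d by simp
    also have "d \<otimes> e \<ominus> d \<otimes> E k = d \<otimes> (e \<ominus> E k)" using d(1) by (simp add: r_distr_minus)
    also have "N \<dots> \<le> N (e \<ominus> E k)" using d(1) by (simp add: N_mult_le_right)
    also have "\<dots> = N (E k \<ominus> e)" using N_diff_commute by simp
    finally show "N (d \<otimes> e \<ominus> e) \<le> N (E k \<ominus> e) + N (E k \<ominus> e)" by simp
  qed (use d in auto)
  \<comment> \<open>Since \<open>e\<close> fixes every \<open>E k\<close> from the left,
    \<open>limit_unit\<close> applies to \<open>d = e\<close> and yields idempotence.\<close>
  have ei: "e \<in> idems" using limit_unit[of e] eE by (intro idemsI) auto
  show ?thesis
  proof (rule that[OF ei])
    fix t assume t: "t \<in> T"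
    note [simp] = Tc[OF t]
    have "t \<ominus> e \<otimes> t = \<zero>"
    proof (rule eq_zero_if_N_small)
      show "(\<lambda>k. N (E k \<ominus> e) + (1/2)^k) \<longlonglongrightarrow> 0"
        using tendsto_add[OF lim LIMSEQ_power_zero[of "1/2::real"]] by simp
      fix k
      \<comment> \<open>The element \<open>t\<close> need not lie below any \<open>E k\<close>. Its
        join with \<open>E k\<close> still has rank at most \<open>s\<close>, while
        \<open>N (E k)\<close> is within \<open>(1/2) ^ k\<close> of \<open>s\<close>, so the part
        of \<open>t\<close> outside \<open>E k\<close> has rank at most
        \<open>(1/2) ^ k\<close>.\<close>
      obtain f where f: "Q f" "f \<otimes> E k = E k" "E k \<otimes> f = E k" "f \<otimes> t = t" using step E t by blast
      have [simp]: "f \<in> carrier R" using f by (auto simp: Q_def)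
      have "(\<one> \<ominus> E k) \<otimes> t = (\<one> \<ominus> E k) \<otimes> f \<otimes> t" using f(4) by (simp add: m_assoc)
      then have "N ((\<one> \<ominus> E k) \<otimes> t) \<le> N ((\<one> \<ominus> E k) \<otimes> f)" by (simp add: N_mult_le_left)
      also have "\<dots> \<le> N f - N (E k)" using N_complement_le[OF Ei[of k], of f "E k"] f by simp
      also have "\<dots> \<le> (1/2)^k" using Q_le_s[OF f(1)] E[of k] by simp
      finally have 1: "N (t \<ominus> E k \<otimes> t) \<le> (1/2)^k" by (simp add: l_distr_minus)
      have "E k \<otimes> t \<ominus> e \<otimes> t = (E k \<ominus> e) \<otimes> t" by (simp add: l_distr_minus)
      then have 2: "N (E k \<otimes> t \<ominus> e \<otimes> t) \<le> N (E k \<ominus> e)" by (simp add: N_mult_le_left)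
      show "N (t \<ominus> e \<otimes> t) \<le> N (E k \<ominus> e) + (1/2)^k"
        using N_triangle[of t "E k \<otimes> t" "e \<otimes> t"] 1 2 by simp
    qed auto
    then show "e \<otimes> t = t" using diff_eq_zeroD[of t "e \<otimes> t"] by simp
  next
    fix d assume d: "d \<in> carrier R" "\<And>t. t \<in> T \<Longrightarrow> d \<otimes> t = t"
    have "d \<otimes> E k = E k" for k
    proof -
      obtain t where t: "t \<in> T" "t \<otimes> E k = E k" using E[of k] by (auto simp: Q_def)
      have "d \<otimes> (t \<otimes> E k) = t \<otimes> E k" using t(1) d Tc by (simp add: m_assoc[symmetric])
      then show ?thesis using t by simp
    qed
    then show "d \<otimes> e = e" using limit_unit d by blast
  next
    fix \<epsilon> :: real assume "\<epsilon> > 0"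
    have "eventually (\<lambda>k. N (E k \<ominus> e) < \<epsilon>) sequentially" using order_tendstoD(2)[OF lim \<open>\<epsilon> > 0\<close>] .
    then obtain k where k: "N (E k \<ominus> e) < \<epsilon>" by (auto simp: eventually_sequentially)
    have "N e \<le> N (E k) + N (e \<ominus> E k)" using N_add[of "E k" "e \<ominus> E k"] by (simp add: add_diff_cancel)
    then have *: "N e - \<epsilon> < N (E k)" using k N_diff_commute[of e "E k"] by simp
    obtain t where t: "t \<in> T" "t \<otimes> E k = E k" using E[of k] by (auto simp: Q_def)
    then have "N (E k) \<le> N t" using N_mult_le_left[of t "E k"] Tc by auto
    then show "\<exists>t\<in>T. N e - \<epsilon> < N t" using * t(1) by (intro bexI[of _ t]) auto
  qed
qed

end

section \<open>Continuity of rank-complete regular rings\<close>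

lemma is_sup_in_unique: "\<lbrakk>is_sup_in L S x; is_sup_in L S y\<rbrakk> \<Longrightarrow> x = y"
  unfolding is_sup_in_def by (meson subset_antisym)

lemma is_inf_in_unique: "\<lbrakk>is_inf_in L S x; is_inf_in L S y\<rbrakk> \<Longrightarrow> x = y"
  unfolding is_inf_in_def by (meson subset_antisym)

lemma is_sup_in_sup_in: "\<exists>x. is_sup_in L S x \<Longrightarrow> is_sup_in L S (sup_in L S)"
  unfolding sup_in_def by (rule theI') (use is_sup_in_unique in metis)

lemma is_inf_in_inf_in: "\<exists>x. is_inf_in L S x \<Longrightarrow> is_inf_in L S (inf_in L S)"
  unfolding inf_in_def by (rule theI') (use is_inf_in_unique in metis)

text \<open>An infimum is the supremum of all lower bounds.\<close>

lemma complete_inI: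
  assumes sup: "\<And>S. S \<subseteq> L \<Longrightarrow> \<exists>x. is_sup_in L S x"
  shows "complete_in L"
  unfolding complete_in_def
proof (intro allI impI conjI)
  fix S assume S: "S \<subseteq> L"
  show "\<exists>x. is_sup_in L S x" using sup[OF S] .
  obtain x where "is_sup_in L {y \<in> L. \<forall>s\<in>S. y \<subseteq> s} x" using sup[of "{y \<in> L. \<forall>s\<in>S. y \<subseteq> s}"] by auto
  then have "is_inf_in L S x" using S unfolding is_sup_in_def is_inf_in_def by blast
  then show "\<exists>x. is_inf_in L S x" by blast
qed

section \<open>The opposite ring\<close>

definition opposite_ring :: "('a, 'b) ring_scheme \<Rightarrow> ('a, 'b) ring_scheme" where
  "opposite_ring R = R\<lparr>monoid.mult := \<lambda>x y. y \<otimes>\<^bsub>R\<^esub> x\<rparr>"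

lemma opposite_ring_simps [simp]:
  "carrier (opposite_ring R) = carrier R"
  "x \<otimes>\<^bsub>opposite_ring R\<^esub> y = y \<otimes>\<^bsub>R\<^esub> x"
  "\<one>\<^bsub>opposite_ring R\<^esub> = \<one>\<^bsub>R\<^esub>"
  "\<zero>\<^bsub>opposite_ring R\<^esub> = \<zero>\<^bsub>R\<^esub>"
  "x \<oplus>\<^bsub>opposite_ring R\<^esub> y = x \<oplus>\<^bsub>R\<^esub> y"
  by (simp_all add: opposite_ring_def)

lemma principal_right_ideals_opposite_ring:
  "principal_right_ideals (opposite_ring R) = principal_left_ideals R"
  by (simp add: principal_right_ideals_def principal_left_ideals_def)

context ring
begin

lemma opposite_ring_is_ring: "ring (opposite_ring R)"
  by (rule ringI)
    (auto intro!: abelian_groupI monoid.intro simp: a_ac m_assoc l_distr r_distr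
      intro: a_inv_closed l_neg)

lemma a_inv_opposite_ring: "x \<in> carrier R \<Longrightarrow> \<ominus>\<^bsub>opposite_ring R\<^esub> x = \<ominus> x"
  by (simp add: opposite_ring_def a_inv_def m_inv_def)

lemma a_minus_opposite_ring:
  "\<lbrakk>x \<in> carrier R; y \<in> carrier R\<rbrakk> \<Longrightarrow> x \<ominus>\<^bsub>opposite_ring R\<^esub> y = x \<ominus> y"
  by (simp add: a_minus_def a_inv_opposite_ring)

end

context rank_ring
begin

section \<open>The lattice of principal right ideals\<close>

definition rideal :: "'a \<Rightarrow> 'a set" where
  "rideal a = {a \<otimes> x | x. x \<in> carrier R}"

lemma mem_rideal_idem: "e \<in> idems \<Longrightarrow> x \<in> rideal e \<longleftrightarrow> x \<in> carrier R \<and> e \<otimes> x = x"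
  unfolding rideal_def using m_assoc[of e e] idemsD[of e] by (auto; metis idems_closed)

lemma rideal_subset_iff:
  assumes "e \<in> idems" "f \<in> idems" shows "rideal e \<subseteq> rideal f \<longleftrightarrow> f \<otimes> e = e"
proof
  assume "rideal e \<subseteq> rideal f"
  moreover have "e \<in> rideal e" using assms by (simp add: mem_rideal_idem idemsD)
  ultimately have "e \<in> rideal f" by blast
  then show "f \<otimes> e = e" using assms by (simp add: mem_rideal_idem)
next
  assume fe: "f \<otimes> e = e"
  show "rideal e \<subseteq> rideal f"
  proof
    fix x assume "x \<in> rideal e"
    then have x: "x \<in> carrier R" "e \<otimes> x = x" using assms by (auto simp: mem_rideal_idem)
    have "f \<otimes> (e \<otimes> x) = e \<otimes> x" using assms x(1) fe by (simp add: m_assoc[symmetric])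
    then show "x \<in> rideal f" using x assms by (simp add: mem_rideal_idem)
  qed
qed

lemma rideal_subset_rideal:
  assumes "b \<in> rideal a" "a \<in> carrier R" shows "rideal b \<subseteq> rideal a"
  using assms unfolding rideal_def by (force simp: m_assoc)

text \<open>For a quasi-inverse \<open>x\<close> of \<open>a\<close>, the product
  \<open>a \<otimes> x\<close> is idempotent and generates the same right ideal as
  \<open>a\<close>.\<close>

lemma rideal_eq_idem:
  assumes a: "a \<in> carrier R" obtains e where "e \<in> idems" "rideal a = rideal e"
proof -
  obtain x where x: "x \<in> carrier R" "a \<otimes> x \<otimes> a = a" using regular[OF a] by auto
  have "a \<otimes> x \<otimes> (a \<otimes> x) = a \<otimes> x" using a x by (simp add: m_assoc[symmetric])
  then have e: "a \<otimes> x \<in> idems" using a x(1) by (intro idemsI) auto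
  have "a \<in> rideal (a \<otimes> x)" using mem_rideal_idem[OF e] a x by simp
  moreover have "a \<otimes> x \<in> rideal a" using x(1) by (auto simp: rideal_def)
  ultimately have "rideal a = rideal (a \<otimes> x)"
    using rideal_subset_rideal[of a "a \<otimes> x"] rideal_subset_rideal[of "a \<otimes> x" a] a x(1) by auto
  then show ?thesis using that e by blast
qed

lemma principal_right_ideals_eq: "principal_right_ideals R = rideal ` idems"
proof -
  have "principal_right_ideals R = rideal ` carrier R"
    by (auto simp: principal_right_ideals_def rideal_def)
  also have "\<dots> = rideal ` idems" using rideal_eq_idem by blast
  finally show ?thesis .
qed

text \<open>Instead of the finite sums of members of \<open>S\<close>, the family \<open>T\<close>
  collects all idempotents lying below every upper bound of \<open>S\<close>. It is directed because
  minimality in \<open>idem_join\<close> keeps a join below these bounds, it contains the generators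
  of \<open>S\<close>, and its supremum is therefore that of \<open>S\<close>.\<close>

lemma principal_right_ideals_sup:
  assumes S: "S \<subseteq> principal_right_ideals R"
  shows "\<exists>x. is_sup_in (principal_right_ideals R) S x"
proof -
  define T where "T = {t \<in> idems. \<forall>d\<in>idems. (\<forall>A\<in>S. A \<subseteq> rideal d) \<longrightarrow> d \<otimes> t = t}"
  have Ti: "T \<subseteq> idems" by (auto simp: T_def)
  have "\<zero> \<in> T" by (auto simp: T_def intro: idemsI)
  moreover have "\<exists>c\<in>T. c \<otimes> a = a \<and> c \<otimes> b = b" if a: "a \<in> T" and b: "b \<in> T" for a b
  proof -
    have ab: "a \<in> idems" "b \<in> carrier R" using a b by (auto simp: T_def)
    obtain f where f: "f \<in> idems" "f \<otimes> a = a" "a \<otimes> f = a" "f \<otimes> b = b"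
      "\<And>d. \<lbrakk>d \<in> carrier R; d \<otimes> a = a; d \<otimes> b = b\<rbrakk> \<Longrightarrow> d \<otimes> f = f"
      using idem_join[OF ab] by metis
    then have "f \<in> T" using a b unfolding T_def by blast
    then show ?thesis using f by blast
  qed
  ultimately obtain e where e: "e \<in> idems" "\<And>t. t \<in> T \<Longrightarrow> e \<otimes> t = t"
    "\<And>d. \<lbrakk>d \<in> carrier R; \<And>t. t \<in> T \<Longrightarrow> d \<otimes> t = t\<rbrakk> \<Longrightarrow> d \<otimes> e = e"
    using directed_idem_sup[OF Ti, of thesis] by blast
  have "A \<subseteq> rideal e" if AS: "A \<in> S" for A
  proof -
    obtain a where a: "a \<in> idems" "A = rideal a" using subsetD[OF S AS] by (auto simp: principal_right_ideals_eq)
    have "a \<in> T" using a AS rideal_subset_iff by (auto simp: T_def)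
    then show ?thesis using a e by (simp add: rideal_subset_iff)
  qed
  moreover have "rideal e \<subseteq> rideal d" if "d \<in> idems" "\<forall>A\<in>S. A \<subseteq> rideal d" for d
    using that e(1) e(3)[of d] by (auto simp: rideal_subset_iff T_def)
  ultimately have "is_sup_in (principal_right_ideals R) S (rideal e)"
    using e(1) by (auto simp: is_sup_in_def principal_right_ideals_eq)
  then show ?thesis by blast
qed

text \<open>A right ideal contained in another of no larger rank is all of it: the complement
  \<open>(\<one> \<ominus> z) \<otimes> g\<close> has rank at most \<open>N g - N z\<close>. This is
  how rank estimates are turned back into equalities of ideals.\<close>

lemma N_strict:
  assumes "z \<in> idems" "g \<in> idems" "g \<otimes> z = z" "N g \<le> N z" shows "z \<otimes> g = g"
proof -
  have "N ((\<one> \<ominus> z) \<otimes> g) \<le> 0" using N_complement_le[of z g z] assms by simp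
  then have "(\<one> \<ominus> z) \<otimes> g = \<zero>"
    using N_definite[of "(\<one> \<ominus> z) \<otimes> g"] N_nonneg[of "(\<one> \<ominus> z) \<otimes> g"] assms by simp
  then have "g \<ominus> z \<otimes> g = \<zero>" using assms(1,2) by (simp add: l_distr_minus)
  then show ?thesis using diff_eq_zeroD[of g "z \<otimes> g"] assms(1,2) by simp
qed

text \<open>Inside \<open>fR\<close>, intersecting with \<open>tR\<close> costs at most the
  codimension \<open>N f - N t\<close>: the right ideal of \<open>g \<otimes> p\<close> lies in both
  \<open>gR\<close> and \<open>tR\<close>, and its rank falls short of \<open>N g\<close> by no more
  than that.\<close>

lemma N_cut_down:
  assumes t: "t \<in> idems" and f: "f \<in> idems" and g: "g \<in> carrier R"
    and ft: "f \<otimes> t = t" and fg: "f \<otimes> g = g"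
  obtains p where "p \<in> carrier R" "t \<otimes> (g \<otimes> p) = g \<otimes> p" "N g \<le> N (g \<otimes> p) + (N f - N t)"
proof -
  have [simp]: "t \<in> carrier R" "f \<in> carrier R" using t f by auto
  define y where "y = (\<one> \<ominus> t) \<otimes> g"
  have [simp]: "y \<in> carrier R" using g by (simp add: y_def)
  obtain z where z: "z \<in> carrier R" "y \<otimes> z \<otimes> y = y" using regular[of y] by auto
  \<comment> \<open>\<open>y\<close> measures how far \<open>g\<close> is from lying in
    \<open>tR\<close>. Right multiplication by \<open>p\<close> projects onto the right annihilator
    of \<open>y\<close>, so \<open>(\<one> \<ominus> t) \<otimes> g \<otimes> p = \<zero>\<close>,
    and what is removed from \<open>g\<close> factors through \<open>y\<close>.\<close>
  define p where "p = \<one> \<ominus> z \<otimes> y"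
  have p: "p \<in> carrier R" using z by (simp add: p_def)
  have "y \<otimes> p = \<zero>" using z by (simp add: p_def r_distr_minus m_assoc[symmetric] diff_self)
  then have "g \<otimes> p \<ominus> t \<otimes> (g \<otimes> p) = \<zero>"
    using g p by (simp add: y_def l_distr_minus m_assoc)
  then have 1: "t \<otimes> (g \<otimes> p) = g \<otimes> p" using diff_eq_zeroD[of "g \<otimes> p" "t \<otimes> (g \<otimes> p)"] g p by simp
  have "y = (\<one> \<ominus> t) \<otimes> f \<otimes> g" using g fg by (simp add: y_def m_assoc)
  then have "N y \<le> N ((\<one> \<ominus> t) \<otimes> f)" using N_mult_le_left[of "(\<one> \<ominus> t) \<otimes> f" g] g by simp
  also have "\<dots> \<le> N f - N t" using N_complement_le[OF t, of f t] ft by simp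
  finally have Ny: "N y \<le> N f - N t" .
  have "g = g \<otimes> p \<oplus> g \<otimes> (z \<otimes> y)"
    using g z(1) by (simp add: p_def r_distr_minus a_comm[of "g \<ominus> g \<otimes> (z \<otimes> y)"] add_diff_cancel)
  then have "N g \<le> N (g \<otimes> p) + N (g \<otimes> (z \<otimes> y))"
    using N_add[of "g \<otimes> p" "g \<otimes> (z \<otimes> y)"] g z(1) p by simp
  also have "N (g \<otimes> (z \<otimes> y)) \<le> N y"
    using N_mult_le_right[of "g \<otimes> z" y] g z(1) by (simp add: m_assoc)
  finally show ?thesis using that[OF p 1] Ny by simp
qed

text \<open>Let \<open>g\<close> generate the meet of \<open>a\<close> with the supremum of the
  chain and \<open>z\<close> the supremum of the meets. The inclusion of \<open>zR\<close> in
  \<open>gR\<close> is formal. Conversely, members of the chain approach their supremum in rank, so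
  cutting \<open>g\<close> down to one of them loses arbitrarily little; hence
  \<open>N g \<le> N z\<close>, and \<open>N_strict\<close> concludes.\<close>

lemma upper_continuous_principal_right_ideals: "upper_continuous_in (principal_right_ideals R)"
proof -
  let ?L = "principal_right_ideals R"
  have compl: "complete_in ?L" using complete_inI principal_right_ideals_sup by blast
  have sup: "is_sup_in ?L S (sup_in ?L S)" if "S \<subseteq> ?L" for S
    using compl that by (intro is_sup_in_sup_in) (auto simp: complete_in_def)
  have inf: "is_inf_in ?L {a, b} (inf_in ?L {a, b})" if "a \<in> ?L" "b \<in> ?L" for a b
    using compl that by (intro is_inf_in_inf_in) (auto simp: complete_in_def)
  have "inf_in ?L {a, sup_in ?L C} = sup_in ?L ((\<lambda>b. inf_in ?L {a, b}) ` C)"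
    if a: "a \<in> ?L" and C: "C \<subseteq> ?L" "C \<noteq> {}" "Complete_Partial_Order.chain (\<subseteq>) C" for a C
  proof -
    define T where "T = {t \<in> idems. rideal t \<in> C}"
    have CT: "C = rideal ` T" using C(1) by (auto simp: T_def principal_right_ideals_eq)
    have dir: "\<exists>c\<in>T. c \<otimes> x = x \<and> c \<otimes> y = y" if x: "x \<in> T" and y: "y \<in> T" for x y
    proof -
      have "rideal x \<subseteq> rideal y \<or> rideal y \<subseteq> rideal x"
        using C(3) x y by (auto simp: T_def chain_def)
      then show ?thesis using x y by (auto simp: T_def rideal_subset_iff idemsD)
    qed
    have Ti: "T \<subseteq> idems" by (auto simp: T_def)
    have "T \<noteq> {}" using C(2) CT by blast
    then obtain f where f: "f \<in> idems" "\<And>t. t \<in> T \<Longrightarrow> f \<otimes> t = t"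
      "\<And>d. \<lbrakk>d \<in> carrier R; \<And>t. t \<in> T \<Longrightarrow> d \<otimes> t = t\<rbrakk> \<Longrightarrow> d \<otimes> f = f"
      "\<And>\<epsilon>. \<epsilon> > 0 \<Longrightarrow> \<exists>t\<in>T. N f - \<epsilon> < N t"
      using directed_idem_sup[OF Ti _ dir] by metis
    have fsup: "is_sup_in ?L C (rideal f)"
      unfolding is_sup_in_def principal_right_ideals_eq CT
    proof (intro conjI ballI impI)
      show "rideal f \<in> rideal ` idems" using f(1) by simp
    next
      fix s assume "s \<in> rideal ` T"
      then obtain t where "t \<in> T" "s = rideal t" by blast
      moreover have "t \<in> idems" using \<open>t \<in> T\<close> Ti by blast
      ultimately show "s \<subseteq> rideal f" using f(1) f(2)[of t] rideal_subset_iff by simp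
    next
      fix y assume "y \<in> rideal ` idems" "\<forall>s\<in>rideal ` T. s \<subseteq> y"
      then obtain d where "d \<in> idems" "y = rideal d" "\<And>t. t \<in> T \<Longrightarrow> d \<otimes> t = t"
        by (auto simp: T_def rideal_subset_iff)
      then show "rideal f \<subseteq> y" using f(1,3) by (auto simp: rideal_subset_iff)
    qed
    then have supC: "sup_in ?L C = rideal f" using is_sup_in_unique sup[OF C(1)] by blast
    have fL: "rideal f \<in> ?L" using f(1) by (simp add: principal_right_ideals_eq)
    let ?W = "(\<lambda>b. inf_in ?L {a, b}) ` C"
    have W: "?W \<subseteq> ?L" using inf[OF a] C(1) by (auto simp: is_inf_in_def)
    obtain g where g: "g \<in> idems" "inf_in ?L {a, rideal f} = rideal g"
      using inf[OF a fL] by (auto simp: is_inf_in_def principal_right_ideals_eq)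
    obtain z where z: "z \<in> idems" "sup_in ?L ?W = rideal z"
      using sup[OF W] by (auto simp: is_sup_in_def principal_right_ideals_eq)
    have gz: "rideal z \<subseteq> rideal g"
    proof -
      have "inf_in ?L {a, b} \<subseteq> rideal g" if b: "b \<in> C" for b
      proof -
        have "b \<subseteq> rideal f" using fsup b unfolding is_sup_in_def by blast
        moreover have bL: "b \<in> ?L" using b C(1) by blast
        ultimately have "inf_in ?L {a, b} \<subseteq> rideal f" "inf_in ?L {a, b} \<subseteq> a" "inf_in ?L {a, b} \<in> ?L"
          using inf[OF a bL] unfolding is_inf_in_def by auto
        then show ?thesis using inf[OF a fL] unfolding g(2) is_inf_in_def by auto
      qed
      then show ?thesis using sup[OF W] g z(2) by (auto simp: is_sup_in_def principal_right_ideals_eq)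
    qed
    have ga: "rideal g \<subseteq> a" and gf: "rideal g \<subseteq> rideal f"
      using inf[OF a fL] g(2) by (auto simp: is_inf_in_def)
    have "N g \<le> N z + \<epsilon>" if eps: "\<epsilon> > 0" for \<epsilon>
    proof -
      \<comment> \<open>The loss in \<open>N_cut_down\<close> is \<open>N f - N t\<close>, hence
        less than \<open>\<epsilon>\<close>, and the surviving part of \<open>g\<close> lies in a
        meet occurring in the supremum \<open>z\<close>.\<close>
      obtain t where t: "t \<in> T" "N f - \<epsilon> < N t" using f(4)[OF eps] by blast
      have ti: "t \<in> idems" using t by (simp add: T_def)
      obtain p where p: "p \<in> carrier R" "t \<otimes> (g \<otimes> p) = g \<otimes> p" "N g \<le> N (g \<otimes> p) + (N f - N t)"
        using N_cut_down[OF ti f(1) idems_closed[OF g(1)] f(2)[OF t(1)]] gf g(1) f(1)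
        by (metis rideal_subset_iff)
      have tC: "rideal t \<in> C" using t by (simp add: T_def)
      have gp: "g \<otimes> p \<in> carrier R" using g(1) p by auto
      have gpL: "rideal (g \<otimes> p) \<in> ?L" using gp by (auto simp: principal_right_ideals_def rideal_def)
      have "g \<otimes> p \<in> rideal g" using p(1) by (auto simp: rideal_def)
      then have "rideal (g \<otimes> p) \<subseteq> a" using rideal_subset_rideal[of "g \<otimes> p" g] g(1) ga by auto
      moreover have "g \<otimes> p \<in> rideal t" using p(2) gp ti by (simp add: mem_rideal_idem)
      then have "rideal (g \<otimes> p) \<subseteq> rideal t" using rideal_subset_rideal ti by auto
      ultimately have "rideal (g \<otimes> p) \<subseteq> inf_in ?L {a, rideal t}"
        using inf[OF a, of "rideal t"] tC C(1) gpL by (auto simp: is_inf_in_def)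
      also have "\<dots> \<subseteq> rideal z" using sup[OF W] tC unfolding z(2) is_sup_in_def by blast
      moreover have "g \<otimes> p \<otimes> \<one> \<in> rideal (g \<otimes> p)" unfolding rideal_def by blast
      ultimately have "g \<otimes> p \<in> rideal z" using gp by auto
      then have "z \<otimes> (g \<otimes> p) = g \<otimes> p" using z(1) by (simp add: mem_rideal_idem)
      then have "N (g \<otimes> p) \<le> N z" using N_mult_le_left[of z "g \<otimes> p"] z(1) gp by simp
      then show ?thesis using p(3) t(2) by simp
    qed
    then have "N g \<le> N z" by (rule field_le_epsilon)
    then have "z \<otimes> g = g" using N_strict[OF z(1) g(1)] gz z(1) g(1) by (simp add: rideal_subset_iff)
    then have "rideal g \<subseteq> rideal z" using z(1) g(1) by (simp add: rideal_subset_iff)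
    then show ?thesis using gz g(2) z(2) supC by simp
  qed
  then show ?thesis using compl by (auto simp: upper_continuous_in_def)
qed

lemma opposite_rank_ring: "rank_ring (opposite_ring R) N"
proof -
  interpret op: ring "opposite_ring R" by (rule opposite_ring_is_ring)
  show ?thesis
  proof
    fix a b assume "a \<in> carrier (opposite_ring R)" "b \<in> carrier (opposite_ring R)"
    then show "\<exists>x\<in>carrier (opposite_ring R). min (N a) (N b)
        \<le> N (a \<otimes>\<^bsub>opposite_ring R\<^esub> x \<otimes>\<^bsub>opposite_ring R\<^esub> b)"
      using N_prime[of b a] by (force simp: m_assoc min.commute)
  next
    fix a assume "a \<in> carrier (opposite_ring R)"
    then show "\<exists>x\<in>carrier (opposite_ring R). a \<otimes>\<^bsub>opposite_ring R\<^esub> x \<otimes>\<^bsub>opposite_ring R\<^esub> a = a"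
      using regular[of a] by (force simp: m_assoc)
  next
    fix a b c assume "a \<in> carrier (opposite_ring R)" "b \<in> carrier (opposite_ring R)"
      "c \<in> carrier (opposite_ring R)"
    then show "N (a \<otimes>\<^bsub>opposite_ring R\<^esub> b) + N (b \<otimes>\<^bsub>opposite_ring R\<^esub> c)
        \<le> N b + N (a \<otimes>\<^bsub>opposite_ring R\<^esub> b \<otimes>\<^bsub>opposite_ring R\<^esub> c)"
      using N_frobenius[of c b a] by (simp add: m_assoc)
  next
    fix u assume u: "\<And>k::nat. u k \<in> carrier (opposite_ring R)"
      and "\<And>k. N (u (Suc k) \<ominus>\<^bsub>opposite_ring R\<^esub> u k) \<le> (1/2) ^ k"
    then have "\<exists>y\<in>carrier R. (\<lambda>k. N (u k \<ominus> y)) \<longlonglongrightarrow> 0"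
      by (intro N_complete) (simp_all add: a_minus_opposite_ring)
    then show "\<exists>y\<in>carrier (opposite_ring R). (\<lambda>k. N (u k \<ominus>\<^bsub>opposite_ring R\<^esub> y)) \<longlonglongrightarrow> 0"
      using u by (simp add: a_minus_opposite_ring)
  qed (use N_one N_add N_mult_le_left N_mult_le_right N_definite in auto)
qed

lemma vn_regular: "vn_regular R"
  using regular by (simp add: vn_regular_def)

lemma continuous_ring: "continuous_ring R"
  unfolding continuous_ring_def
  using vn_regular upper_continuous_principal_right_ideals
    rank_ring.upper_continuous_principal_right_ideals[OF opposite_rank_ring]
  by (simp add: principal_right_ideals_opposite_ring)

lemma indecomposable_ring: "indecomposable_ring R"
  unfolding indecomposable_ring_def
proof (intro conjI ballI impI)
  show "\<zero> \<noteq> \<one>" using N_one N_zero by metis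
  fix e assume e: "e \<in> carrier R" and ec: "e \<otimes> e = e \<and> (\<forall>r\<in>carrier R. e \<otimes> r = r \<otimes> e)"
  have c: "\<one> \<ominus> e \<in> carrier R" using e by simp
  obtain x where x: "x \<in> carrier R" "min (N e) (N (\<one> \<ominus> e)) \<le> N (e \<otimes> x \<otimes> (\<one> \<ominus> e))"
    using N_prime[OF e c] by auto
  \<comment> \<open>Centrality moves \<open>e\<close> past \<open>x\<close>, where it meets its
    complement; the primeness witness then forces one of the two ranks to vanish.\<close>
  have "e \<otimes> x \<otimes> (\<one> \<ominus> e) = \<zero>"
  proof -
    have "e \<otimes> x \<otimes> (\<one> \<ominus> e) = x \<otimes> (e \<otimes> (\<one> \<ominus> e))" using ec x(1) e c by (simp add: m_assoc)
    also have "e \<otimes> (\<one> \<ominus> e) = \<zero>" using ec e by (simp add: r_distr_minus diff_self)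
    finally show ?thesis using x(1) by simp
  qed
  then have "min (N e) (N (\<one> \<ominus> e)) \<le> 0" using x by simp
  then have "N e = 0 \<or> N (\<one> \<ominus> e) = 0" using N_nonneg[OF e] N_nonneg[OF c] by linarith
  then show "e = \<zero> \<or> e = \<one>" using N_definite[OF e] N_definite[OF c] diff_eq_zeroD[of \<one> e] e by auto
qed

end

section \<open>Linear algebra over a division ring\<close>

locale vec_space = ring D for D (structure) +
  fixes n :: nat
  assumes nontrivial: "\<zero> \<noteq> \<one>"
    and Units_eq: "Units D = carrier D - {\<zero>}"
begin

text \<open>Vectors are functions on all naturals that vanish from \<open>n\<close> on, so the type
  does not depend on \<open>n\<close> and matrices of varying size can be components of one product
  ring.\<close>

definition vecs :: "(nat \<Rightarrow> 'a) set" where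
  "vecs = {v. (\<forall>i. v i \<in> carrier D) \<and> (\<forall>i\<ge>n. v i = \<zero>)}"

definition vzero :: "nat \<Rightarrow> 'a" where
  "vzero = (\<lambda>i. \<zero>)"

definition vadd :: "(nat \<Rightarrow> 'a) \<Rightarrow> (nat \<Rightarrow> 'a) \<Rightarrow> nat \<Rightarrow> 'a" where
  "vadd v w = (\<lambda>i. v i \<oplus> w i)"

text \<open>Scalars act on the right; matrix entries multiplying from the left then commute with
  them although \<open>D\<close> may be noncommutative.\<close>

definition vscale :: "(nat \<Rightarrow> 'a) \<Rightarrow> 'a \<Rightarrow> nat \<Rightarrow> 'a" where
  "vscale v d = (\<lambda>i. v i \<otimes> d)"

definition vminus :: "(nat \<Rightarrow> 'a) \<Rightarrow> nat \<Rightarrow> 'a" where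
  "vminus v = (\<lambda>i. \<ominus> v i)"

definition vunit :: "nat \<Rightarrow> nat \<Rightarrow> 'a" where
  "vunit j = (\<lambda>i. if i = j then \<one> else \<zero>)"

lemma vecsI: "\<lbrakk>\<And>i. v i \<in> carrier D; \<And>i. n \<le> i \<Longrightarrow> v i = \<zero>\<rbrakk> \<Longrightarrow> v \<in> vecs"
  by (simp add: vecs_def)

lemma vecs_carrier [simp]: "v \<in> vecs \<Longrightarrow> v i \<in> carrier D"
  by (simp add: vecs_def)

lemma vecs_zero [simp]: "\<lbrakk>v \<in> vecs; n \<le> i\<rbrakk> \<Longrightarrow> v i = \<zero>"
  unfolding vecs_def by blast

lemma vec_apply:
  "vadd v w i = v i \<oplus> w i" "vscale v d i = v i \<otimes> d" "vminus v i = \<ominus> v i" "vzero i = \<zero>"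
  by (simp_all add: vadd_def vscale_def vminus_def vzero_def)

lemma vec_closed [simp]:
  "vzero \<in> vecs"
  "\<lbrakk>v \<in> vecs; w \<in> vecs\<rbrakk> \<Longrightarrow> vadd v w \<in> vecs"
  "\<lbrakk>v \<in> vecs; d \<in> carrier D\<rbrakk> \<Longrightarrow> vscale v d \<in> vecs"
  "v \<in> vecs \<Longrightarrow> vminus v \<in> vecs"
  "j < n \<Longrightarrow> vunit j \<in> vecs"
  by (auto simp: vunit_def vec_apply intro!: vecsI)

lemma inverse_ex:
  assumes "x \<in> carrier D" "x \<noteq> \<zero>"
  obtains y where "y \<in> carrier D" "x \<otimes> y = \<one>" "y \<otimes> x = \<one>"
  using assms Units_eq Units_inv_closed[of x] Units_r_inv[of x] Units_l_inv[of x] by blast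

section \<open>Subspaces and dimension by pivots\<close>

definition subsp :: "(nat \<Rightarrow> 'a) set \<Rightarrow> bool" where
  "subsp W \<longleftrightarrow> W \<subseteq> vecs \<and> vzero \<in> W \<and> (\<forall>v\<in>W. \<forall>w\<in>W. vadd v w \<in> W) \<and>
     (\<forall>v\<in>W. \<forall>d\<in>carrier D. vscale v d \<in> W)"

lemma subspD:
  assumes "subsp W"
  shows "W \<subseteq> vecs" "v \<in> W \<Longrightarrow> v \<in> vecs" "vzero \<in> W" "\<lbrakk>v \<in> W; w \<in> W\<rbrakk> \<Longrightarrow> vadd v w \<in> W"
    "\<lbrakk>v \<in> W; d \<in> carrier D\<rbrakk> \<Longrightarrow> vscale v d \<in> W"
  using assms by (auto simp: subsp_def)

lemma vminus_eq_vscale: "v \<in> vecs \<Longrightarrow> vminus v = vscale v (\<ominus> \<one>)"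
  by (rule ext) (simp add: vec_apply r_minus)

lemma subsp_vminus: "\<lbrakk>subsp W; v \<in> W\<rbrakk> \<Longrightarrow> vminus v \<in> W"
  by (simp add: vminus_eq_vscale subspD)

lemma subsp_vecs: "subsp vecs"
  by (auto simp: subsp_def)

lemma subsp_vzero: "subsp {vzero}"
  by (auto simp: subsp_def) (simp_all add: fun_eq_iff vec_apply)

definition leads :: "(nat \<Rightarrow> 'a) set \<Rightarrow> nat set" where
  "leads W = {j. \<exists>v\<in>W. v j \<noteq> \<zero> \<and> (\<forall>i<j. v i = \<zero>)}"

text \<open>The number of pivot positions: with this definition the dimension formula
  \<open>vdim_adjoin\<close> needs no exchange argument.\<close>
definition vdim :: "(nat \<Rightarrow> 'a) set \<Rightarrow> nat" where
  "vdim W = card (leads W)"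

definition adjoin :: "(nat \<Rightarrow> 'a) set \<Rightarrow> (nat \<Rightarrow> 'a) \<Rightarrow> (nat \<Rightarrow> 'a) set" where
  "adjoin W v = {vadd w (vscale v d) | w d. w \<in> W \<and> d \<in> carrier D}"

lemma leads_subset: "W \<subseteq> vecs \<Longrightarrow> leads W \<subseteq> {..<n}"
proof
  fix j assume W: "W \<subseteq> vecs" and "j \<in> leads W"
  then obtain v where "v \<in> vecs" "v j \<noteq> \<zero>" by (auto simp: leads_def)
  then show "j \<in> {..<n}" using vecs_zero[of v j] by (cases "n \<le> j") auto
qed

lemma finite_leads: "W \<subseteq> vecs \<Longrightarrow> finite (leads W)"
  using leads_subset finite_subset by blast

lemma leads_mono: "U \<subseteq> W \<Longrightarrow> leads U \<subseteq> leads W"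
  by (auto simp: leads_def)

lemma vdim_le: "W \<subseteq> vecs \<Longrightarrow> vdim W \<le> n"
  unfolding vdim_def using card_mono[OF _ leads_subset] by fastforce

lemma vdim_mono: "\<lbrakk>U \<subseteq> W; W \<subseteq> vecs\<rbrakk> \<Longrightarrow> vdim U \<le> vdim W"
  unfolding vdim_def by (intro card_mono finite_leads leads_mono)

lemma vdim_vzero: "vdim {vzero} = 0"
  by (simp add: vdim_def leads_def vec_apply)

lemma leads_vunit: "vunit j \<in> W \<Longrightarrow> j \<in> leads W"
  using nontrivial unfolding leads_def by (intro CollectI bexI[of _ "vunit j"]) (auto simp: vunit_def)

text \<open>Gaussian elimination: a vector of \<open>U\<close> is matched by vectors of
  \<open>W\<close> on longer and longer initial segments. The first remaining discrepancy is the
  leading entry of a vector of \<open>U\<close>, so its position is a pivot of \<open>W\<close> and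
  can be corrected from there.\<close>

lemma subset_if_leads_subset:
  assumes W: "subsp W" and U: "subsp U" and WU: "W \<subseteq> U" and L: "leads U \<subseteq> leads W"
  shows "U \<subseteq> W"
proof
  fix u assume u: "u \<in> U"
  have "\<exists>w\<in>W. \<forall>i<k. u i = w i" for k
  proof (induct k)
    case 0 then show ?case using subspD(3)[OF W] by auto
  next
    case (Suc k)
    then obtain w where w: "w \<in> W" "\<forall>i<k. u i = w i" by auto
    define x where "x = vadd u (vminus w)"
    have vec [simp]: "u \<in> vecs" "w \<in> vecs" using u w W U subspD by auto
    have xU: "x \<in> U" using u w WU U by (auto simp: x_def subspD subsp_vminus)
    have x0: "x i = \<zero>" if "i < k" for i using w(2) that by (simp add: x_def vec_apply r_neg)
    show ?case
    proof (cases "x k = \<zero>")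
      case True
      then have "u k = w k" by (simp add: x_def vec_apply) (metis minus_equality minus_minus vec vecs_carrier a_inv_closed)
      then show ?thesis using w less_Suc_eq by auto
    next
      case False
      then have "k \<in> leads W" using L xU x0 by (auto simp: leads_def)
      then obtain y where y: "y \<in> W" "y k \<noteq> \<zero>" "\<forall>i<k. y i = \<zero>" by (auto simp: leads_def)
      have [simp]: "y \<in> vecs" using y W subspD by auto
      obtain c where c: "c \<in> carrier D" "y k \<otimes> c = \<one>" using inverse_ex[OF _ y(2)] by auto
      \<comment> \<open>This scalar solves \<open>y k \<otimes> d = x k\<close>; as \<open>y\<close>
        vanishes before \<open>k\<close>, adding its multiple repairs coordinate \<open>k\<close>
        and preserves the earlier ones.\<close>
      define d where "d = c \<otimes> x k"
      have [simp]: "x \<in> vecs" by (simp add: x_def)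
      have d: "d \<in> carrier D" "y k \<otimes> d = x k"
        using c by (simp_all add: d_def m_assoc[symmetric])
      let ?w = "vadd w (vscale y d)"
      have "?w \<in> W" using w y d W by (simp add: subspD)
      moreover have "u i = ?w i" if "i < Suc k" for i
      proof (cases "i = k")
        case True
        have "w k \<oplus> x k = u k" by (simp add: x_def vec_apply a_lcomm[of "w k"] r_neg)
        then show ?thesis using True d by (simp add: vec_apply)
      next
        case False then show ?thesis using that w y d by (simp add: vec_apply)
      qed
      ultimately show ?thesis by blast
    qed
  qed
  then obtain w where w: "w \<in> W" "\<forall>i<n. u i = w i" by blast
  then have "u i = w i" for i
    using vecs_zero[of u i] vecs_zero[of w i] u W U subspD by (cases "i < n") auto
  then show "u \<in> W" using w(1) by (metis ext)
qed

lemma adjoinI: "\<lbrakk>w \<in> W; d \<in> carrier D\<rbrakk> \<Longrightarrow> vadd w (vscale v d) \<in> adjoin W v"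
  by (auto simp: adjoin_def)

lemma subsp_adjoin:
  assumes W: "subsp W" and v: "v \<in> vecs" shows "subsp (adjoin W v)"
  unfolding subsp_def
proof (intro conjI ballI)
  show "adjoin W v \<subseteq> vecs" using subspD[OF W] v by (auto simp: adjoin_def)
  have "vzero = vadd vzero (vscale v \<zero>)" using v by (intro ext) (simp add: vec_apply)
  then show "vzero \<in> adjoin W v" using subspD(3)[OF W] adjoinI[of vzero W \<zero> v] by simp
next
  fix x y assume "x \<in> adjoin W v" "y \<in> adjoin W v"
  then obtain w d w' d' where x: "x = vadd w (vscale v d)" "w \<in> W" "d \<in> carrier D"
    and y: "y = vadd w' (vscale v d')" "w' \<in> W" "d' \<in> carrier D" by (auto simp: adjoin_def)
  have "vadd x y = vadd (vadd w w') (vscale v (d \<oplus> d'))"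
    using x y v subspD(2)[OF W] by (intro ext) (simp add: vec_apply r_distr a_ac)
  then show "vadd x y \<in> adjoin W v" using x y subspD(4)[OF W] adjoinI by auto
next
  fix x c assume "x \<in> adjoin W v" and c: "c \<in> carrier D"
  then obtain w d where x: "x = vadd w (vscale v d)" "w \<in> W" "d \<in> carrier D" by (auto simp: adjoin_def)
  have "vscale x c = vadd (vscale w c) (vscale v (d \<otimes> c))"
    using x c v subspD(2)[OF W] by (intro ext) (simp add: vec_apply l_distr m_assoc)
  then show "vscale x c \<in> adjoin W v" using x c subspD(5)[OF W] adjoinI by auto
qed

lemma adjoin_superset:
  assumes W: "subsp W" and v: "v \<in> vecs" shows "W \<subseteq> adjoin W v" "v \<in> adjoin W v"
proof -
  have "w = vadd w (vscale v \<zero>)" if "w \<in> W" for w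
    using that v subspD(2)[OF W] by (intro ext) (simp add: vec_apply)
  then show "W \<subseteq> adjoin W v" using adjoinI[of _ W \<zero> v] by force
  have "v = vadd vzero (vscale v \<one>)" using v by (intro ext) (simp add: vec_apply)
  then show "v \<in> adjoin W v" using subspD(3)[OF W] adjoinI[of vzero W \<one> v] by simp
qed

lemma adjoin_least:
  assumes "subsp U" "W \<subseteq> U" "v \<in> U" shows "adjoin W v \<subseteq> U"
  using assms by (auto simp: adjoin_def subspD)

text \<open>At least one pivot is new by \<open>subset_if_leads_subset\<close>. Two new pivots
  \<open>a < b\<close> are impossible: a vector leading at \<open>b\<close> must involve
  \<open>v\<close>, so a multiple of it can eliminate \<open>v\<close> from a vector leading at
  \<open>a\<close>, and the result lies in \<open>W\<close> and still leads at
  \<open>a\<close>.\<close>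

lemma vdim_adjoin:
  assumes W: "subsp W" and v: "v \<in> vecs" "v \<notin> W"
  shows "vdim (adjoin W v) = Suc (vdim W)"
proof -
  let ?A = "adjoin W v"
  note A = subsp_adjoin[OF W v(1)] and WA = adjoin_superset[OF W v(1)]
  have "\<not> leads ?A \<subseteq> leads W"
    using subset_if_leads_subset[OF W A WA(1)] WA(2) v(2) by auto
  then obtain j where j: "j \<in> leads ?A" "j \<notin> leads W" by auto
  have no_two: False if ab: "a \<in> leads ?A" "a \<notin> leads W" "b \<in> leads ?A" "b \<notin> leads W" "a < b" for a b
  proof -
    obtain x where x: "x \<in> ?A" "x a \<noteq> \<zero>" "\<forall>i<a. x i = \<zero>" using ab by (auto simp: leads_def)
    obtain y where y: "y \<in> ?A" "y b \<noteq> \<zero>" "\<forall>i<b. y i = \<zero>" using ab by (auto simp: leads_def)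
    obtain w d where w: "w \<in> W" "d \<in> carrier D" "x = vadd w (vscale v d)" using x by (auto simp: adjoin_def)
    obtain w' d' where w': "w' \<in> W" "d' \<in> carrier D" "y = vadd w' (vscale v d')"
      using y by (auto simp: adjoin_def)
    have [simp]: "w \<in> vecs" "w' \<in> vecs" "v \<in> vecs" using w w' v subspD(2)[OF W] by auto
    have "d' \<noteq> \<zero>"
    proof
      assume "d' = \<zero>"
      then have "y = w'" using w' by (intro ext) (simp add: vec_apply)
      then show False using y w'(1) ab(4) by (auto simp: leads_def)
    qed
    then obtain c where c: "c \<in> carrier D" "d' \<otimes> c = \<one>" using inverse_ex w'(2) by metis
    \<comment> \<open>The scalar with \<open>d' \<otimes> e = d\<close>, so that subtracting
      \<open>y\<close> times \<open>e\<close> from \<open>x\<close> cancels the contributions of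
      \<open>v\<close>.\<close>
    define e where "e = c \<otimes> d"
    have e: "e \<in> carrier D" "d' \<otimes> e = d" using c w w' by (simp_all add: e_def m_assoc[symmetric])
    let ?z = "vadd w (vminus (vscale w' e))"
    have "?z \<in> W" using w w' e W by (simp add: subspD subsp_vminus)
    moreover have "?z i = x i \<oplus> \<ominus> (y i \<otimes> e)" for i
    proof -
      have "x i \<oplus> \<ominus> (y i \<otimes> e) = w i \<oplus> v i \<otimes> d \<oplus> \<ominus> (w' i \<otimes> e \<oplus> v i \<otimes> d)"
        using w w' e by (simp add: vec_apply l_distr m_assoc)
      also have "\<dots> = w i \<oplus> \<ominus> (w' i \<otimes> e)"
        using w w' e by (simp add: minus_add a_ac r_neg1 r_neg2)
      finally show ?thesis by (simp add: vec_apply)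
    qed
    ultimately have "a \<in> leads W"
      using x y ab(5) e(1) subspD(2)[OF A x(1)] unfolding leads_def by (auto intro!: bexI[of _ ?z])
    then show False using ab by simp
  qed
  have "leads ?A = insert j (leads W)"
  proof
    show "leads ?A \<subseteq> insert j (leads W)"
    proof
      fix k assume k: "k \<in> leads ?A"
      show "k \<in> insert j (leads W)"
      proof (rule ccontr)
        assume "k \<notin> insert j (leads W)"
        then have "k \<notin> leads W" "k < j \<or> j < k" by auto
        then show False using no_two[of k j] no_two[of j k] j k by auto
      qed
    qed
    show "insert j (leads W) \<subseteq> leads ?A" using j leads_mono[OF WA(1)] by auto
  qed
  then show ?thesis using j(2) finite_leads[OF subspD(1)[OF W]] by (simp add: vdim_def)
qed

lemma adjoin_absorb: "\<lbrakk>subsp W; v \<in> W\<rbrakk> \<Longrightarrow> adjoin W v = W"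
  using adjoin_least[of W W v] adjoin_superset(1)[of W v] subspD(2)[of W v] by auto

lemma vdim_adjoin_le: "\<lbrakk>subsp W; v \<in> vecs\<rbrakk> \<Longrightarrow> vdim (adjoin W v) \<le> Suc (vdim W)"
  using vdim_adjoin[of W v] adjoin_absorb[of W v] by (cases "v \<in> W") auto

text \<open>The substitute for bases in all later dimension counts: one vector is adjoined at a
  time, and the process stops because each adjunction raises the dimension, which is bounded by
  \<open>n\<close>.\<close>

lemma subsp_chain_induct [consumes 3, case_names base step]:
  assumes "subsp W" "subsp U" "W \<subseteq> U"
    and base: "P W"
    and step: "\<And>Y v. \<lbrakk>subsp Y; W \<subseteq> Y; Y \<subseteq> U; v \<in> U; v \<notin> Y; v \<in> vecs; P Y\<rbrakk> \<Longrightarrow> P (adjoin Y v)"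
  shows "P U"
proof -
  have "P U" if "subsp Y" "W \<subseteq> Y" "Y \<subseteq> U" "P Y" for Y
    using that
  proof (induct "n - vdim Y" arbitrary: Y rule: less_induct)
    case less
    show ?case
    proof (cases "Y = U")
      case False
      then obtain v where v: "v \<in> U" "v \<notin> Y" using less.prems by auto
      have vV: "v \<in> vecs" using v subspD(2)[OF assms(2)] by auto
      have d: "vdim (adjoin Y v) = Suc (vdim Y)" using vdim_adjoin less.prems v vV by auto
      have A: "subsp (adjoin Y v)" using subsp_adjoin less.prems vV by auto
      have "Suc (vdim Y) \<le> n" using vdim_le[OF subspD(1)[OF A]] d by simp
      then have "n - vdim (adjoin Y v) < n - vdim Y" using d by simp
      then show ?thesis
        using less.hyps[of "adjoin Y v"] A adjoin_superset[OF less.prems(1) vV] less.prems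
          adjoin_least[OF assms(2) less.prems(3) v(1)] step[OF less.prems(1-3) v vV less.prems(4)] by auto
    qed (use less.prems in simp)
  qed
  then show ?thesis using assms base by auto
qed

lemma vdim_vecs: "vdim vecs = n"
proof -
  have "{..<n} \<subseteq> leads vecs" using leads_vunit by auto
  then have "leads vecs = {..<n}" using leads_subset[of vecs] by auto
  then show ?thesis by (simp add: vdim_def)
qed

text \<open>Linear maps are made total by sending everything outside \<open>vecs\<close> to \<open>vzero\<close>.\<close>
definition lin :: "((nat \<Rightarrow> 'a) \<Rightarrow> nat \<Rightarrow> 'a) set" where
  "lin = {f. (\<forall>v. f v \<in> vecs) \<and> (\<forall>v. v \<notin> vecs \<longrightarrow> f v = vzero) \<and>
     (\<forall>v\<in>vecs. \<forall>w\<in>vecs. f (vadd v w) = vadd (f v) (f w)) \<and>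
     (\<forall>v\<in>vecs. \<forall>d\<in>carrier D. f (vscale v d) = vscale (f v) d)}"

lemma linD:
  assumes "f \<in> lin"
  shows "f v \<in> vecs" "v \<notin> vecs \<Longrightarrow> f v = vzero"
    "\<lbrakk>v \<in> vecs; w \<in> vecs\<rbrakk> \<Longrightarrow> f (vadd v w) = vadd (f v) (f w)"
    "\<lbrakk>v \<in> vecs; d \<in> carrier D\<rbrakk> \<Longrightarrow> f (vscale v d) = vscale (f v) d"
  using assms by (auto simp: lin_def)

lemma lin_vzero: assumes "f \<in> lin" shows "f vzero = vzero"
proof -
  have "f (vscale vzero \<zero>) = vscale (f vzero) \<zero>" using assms by (simp add: linD)
  moreover have "vscale vzero \<zero> = vzero" "vscale (f vzero) \<zero> = vzero"
    using linD(1)[OF assms, of vzero] by (simp_all add: fun_eq_iff vec_apply)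
  ultimately show ?thesis by simp
qed

definition lone :: "(nat \<Rightarrow> 'a) \<Rightarrow> nat \<Rightarrow> 'a" where
  "lone v = (if v \<in> vecs then v else vzero)"

definition lzero :: "(nat \<Rightarrow> 'a) \<Rightarrow> nat \<Rightarrow> 'a" where
  "lzero v = vzero"

definition ladd :: "((nat \<Rightarrow> 'a) \<Rightarrow> nat \<Rightarrow> 'a) \<Rightarrow> ((nat \<Rightarrow> 'a) \<Rightarrow> nat \<Rightarrow> 'a) \<Rightarrow> (nat \<Rightarrow> 'a) \<Rightarrow> nat \<Rightarrow> 'a" where
  "ladd f g v = vadd (f v) (g v)"

definition lneg :: "((nat \<Rightarrow> 'a) \<Rightarrow> nat \<Rightarrow> 'a) \<Rightarrow> (nat \<Rightarrow> 'a) \<Rightarrow> nat \<Rightarrow> 'a" where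
  "lneg f v = vminus (f v)"

lemma lone_lin: "lone \<in> lin"
  by (auto simp: lin_def lone_def)

lemma lzero_lin: "lzero \<in> lin"
  by (simp add: lin_def lzero_def) (simp add: fun_eq_iff vec_apply)

lemma comp_lin: "\<lbrakk>f \<in> lin; g \<in> lin\<rbrakk> \<Longrightarrow> f \<circ> g \<in> lin"
  using lin_vzero[of f] by (auto simp: lin_def)

lemma ladd_lin: "\<lbrakk>f \<in> lin; g \<in> lin\<rbrakk> \<Longrightarrow> ladd f g \<in> lin"
  unfolding lin_def ladd_def by (auto intro!: ext simp: vec_apply a_ac l_distr)

lemma lneg_lin: "f \<in> lin \<Longrightarrow> lneg f \<in> lin"
  unfolding lin_def lneg_def by (auto intro!: ext simp: vec_apply minus_add l_minus)

lemma subsp_image: assumes f: "f \<in> lin" and W: "subsp W" shows "subsp (f ` W)"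
  unfolding subsp_def
proof (intro conjI ballI)
  show "f ` W \<subseteq> vecs" using f linD by auto
  show "vzero \<in> f ` W" using lin_vzero[OF f] subspD(3)[OF W] by force
next
  fix x y assume "x \<in> f ` W" "y \<in> f ` W"
  then obtain v w where "v \<in> W" "w \<in> W" "x = f v" "y = f w" by auto
  then show "vadd x y \<in> f ` W" using linD(3)[OF f, of v w] subspD[OF W] by (metis image_eqI)
next
  fix x d assume "x \<in> f ` W" "d \<in> carrier D"
  then obtain v where "v \<in> W" "x = f v" by auto
  then show "vscale x d \<in> f ` W"
    using linD(4)[OF f, of v d] subspD[OF W] \<open>d \<in> carrier D\<close> by (metis image_eqI)
qed

lemma image_adjoin:
  assumes f: "f \<in> lin" and W: "subsp W" and v: "v \<in> vecs"
  shows "f ` adjoin W v = adjoin (f ` W) (f v)"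
proof -
  have "f (vadd w (vscale v d)) = vadd (f w) (vscale (f v) d)" if "w \<in> W" "d \<in> carrier D" for w d
    using f v that subspD(2)[OF W] by (simp add: linD)
  then show ?thesis unfolding adjoin_def by (auto simp: image_iff) metis+
qed

text \<open>Along a chain from \<open>W\<close> to \<open>U\<close> each adjoined vector raises the
  dimension by exactly one and that of the image by at most one. The additive form avoids truncated
  subtraction.\<close>

lemma vdim_image_diff:
  assumes f: "f \<in> lin" and W: "subsp W" and U: "subsp U" "W \<subseteq> U"
  shows "vdim (f ` U) + vdim W \<le> vdim U + vdim (f ` W)"
  using W U
proof (induct rule: subsp_chain_induct)
  case base then show ?case by simp
next
  case (step Y v)
  have "vdim (f ` adjoin Y v) \<le> Suc (vdim (f ` Y))"
    using step f by (simp add: image_adjoin vdim_adjoin_le subsp_image linD)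
  then show ?case using step vdim_adjoin[of Y v] by simp
qed

lemma vdim_image_le: "\<lbrakk>f \<in> lin; subsp U\<rbrakk> \<Longrightarrow> vdim (f ` U) \<le> vdim U"
  using vdim_image_diff[OF _ subsp_vzero, of f U] by (simp add: lin_vzero vdim_vzero subspD)

section \<open>The rank of a linear map\<close>

definition rk :: "((nat \<Rightarrow> 'a) \<Rightarrow> nat \<Rightarrow> 'a) \<Rightarrow> nat" where
  "rk f = vdim (f ` vecs)"

lemma rk_lzero: "rk lzero = 0"
proof -
  have "lzero ` vecs = {vzero}" using vec_closed(1) unfolding lzero_def by blast
  then show ?thesis by (simp add: rk_def vdim_vzero)
qed

lemma rk_lone: "rk lone = n"
proof -
  have "lone ` vecs = vecs" by (auto simp: lone_def)
  then show ?thesis by (simp add: rk_def vdim_vecs)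
qed

lemma rk_comp_le_left: "\<lbrakk>f \<in> lin; g \<in> lin\<rbrakk> \<Longrightarrow> rk (f \<circ> g) \<le> rk f"
  unfolding rk_def using linD(1) by (intro vdim_mono) auto

lemma rk_comp_le_right: "\<lbrakk>f \<in> lin; g \<in> lin\<rbrakk> \<Longrightarrow> rk (f \<circ> g) \<le> rk g"
  unfolding rk_def using vdim_image_le[OF _ subsp_image[OF _ subsp_vecs]] by (simp only: image_comp[symmetric])

text \<open>Dimension loss under \<open>f\<close>, compared on the image of \<open>g\<close> and on
  the smaller image of \<open>g \<circ> h\<close>.\<close>

lemma rk_frobenius:
  assumes "f \<in> lin" "g \<in> lin" "h \<in> lin"
  shows "rk (f \<circ> g) + rk (g \<circ> h) \<le> rk g + rk (f \<circ> g \<circ> h)"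
proof -
  have "g ` h ` vecs \<subseteq> g ` vecs" using linD(1)[OF assms(3)] by auto
  then have "vdim (f ` g ` vecs) + vdim (g ` h ` vecs) \<le> vdim (g ` vecs) + vdim (f ` g ` h ` vecs)"
    by (intro vdim_image_diff subsp_image assms subsp_vecs)
  then show ?thesis by (simp add: rk_def image_comp o_assoc)
qed

lemma rk_ladd:
  assumes f: "f \<in> lin" and g: "g \<in> lin"
  shows "rk (ladd f g) \<le> rk f + rk g"
proof -
  \<comment> \<open>The sum of the image of \<open>f\<close> with a subspace \<open>Y\<close>. It
    grows by at most one dimension whenever a vector is adjoined to \<open>Y\<close>, and for
    \<open>Y\<close> the image of \<open>g\<close> it contains the image of the sum.\<close>
  define S where "S = (\<lambda>Y. {vadd x y | x y. x \<in> f ` vecs \<and> y \<in> Y})"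
  have F: "subsp (f ` vecs)" using subsp_image[OF f subsp_vecs] .
  then have F0: "{vzero} \<subseteq> f ` vecs" by (simp add: subspD)
  have S: "subsp (S Y)" if Y: "subsp Y" for Y
    unfolding subsp_def
  proof (intro conjI ballI)
    show "S Y \<subseteq> vecs" using linD(1)[OF f] subspD(2)[OF Y] by (auto simp: S_def)
    have "vzero = vadd vzero vzero" by (intro ext) (simp add: vec_apply)
    then show "vzero \<in> S Y" using subspD(3)[OF F] subspD(3)[OF Y] unfolding S_def by blast
  next
    fix a b assume "a \<in> S Y" "b \<in> S Y"
    then obtain x y x' y' where h: "a = vadd x y" "b = vadd x' y'" "x \<in> f ` vecs" "x' \<in> f ` vecs" "y \<in> Y" "y' \<in> Y"
      unfolding S_def by blast
    moreover have "vadd a b = vadd (vadd x x') (vadd y y')"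
      using h subspD(2)[OF F] subspD(2)[OF Y] by (intro ext) (simp add: vec_apply a_ac)
    ultimately show "vadd a b \<in> S Y" using subspD(4)[OF F] subspD(4)[OF Y] unfolding S_def by blast
  next
    fix a d assume "a \<in> S Y" and d: "d \<in> carrier D"
    then obtain x y where h: "a = vadd x y" "x \<in> f ` vecs" "y \<in> Y" unfolding S_def by blast
    moreover have "vscale a d = vadd (vscale x d) (vscale y d)"
      using h d subspD(2)[OF F] subspD(2)[OF Y] by (intro ext) (simp add: vec_apply l_distr)
    moreover have "vscale x d \<in> f ` vecs" "vscale y d \<in> Y" using h d subspD(5)[OF F] subspD(5)[OF Y] by auto
    ultimately show "vscale a d \<in> S Y" unfolding S_def by blast
  qed
  have G: "subsp (g ` vecs)" using subsp_image[OF g subsp_vecs] .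
  then have G0: "{vzero} \<subseteq> g ` vecs" by (simp add: subspD)
  have "vdim (S (g ` vecs)) \<le> rk f + vdim (g ` vecs)"
    using subsp_vzero G G0
  proof (induct rule: subsp_chain_induct)
    have "S {vzero} \<subseteq> f ` vecs"
    proof
      fix a assume "a \<in> S {vzero}"
      then obtain x where x: "x \<in> f ` vecs" "a = vadd x vzero" by (auto simp: S_def)
      then have "a = x" using subspD(2)[OF F] by (intro ext) (simp add: vec_apply)
      then show "a \<in> f ` vecs" using x by simp
    qed
    then show "vdim (S {vzero}) \<le> rk f + vdim {vzero}"
      unfolding rk_def using vdim_mono[of "S {vzero}" "f ` vecs"] subspD(1)[OF F] by simp
  next
    fix Y v assume Y: "subsp Y" "v \<notin> Y" and v: "v \<in> vecs" and IH: "vdim (S Y) \<le> rk f + vdim Y"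
    have "S (adjoin Y v) \<subseteq> adjoin (S Y) v"
    proof
      fix a assume "a \<in> S (adjoin Y v)"
      then obtain x y d where h: "a = vadd x (vadd y (vscale v d))" "x \<in> f ` vecs" "y \<in> Y" "d \<in> carrier D"
        unfolding S_def adjoin_def by blast
      moreover have "a = vadd (vadd x y) (vscale v d)"
        using h v subspD(2)[OF F] subspD(2)[OF Y(1)] by (intro ext) (simp add: vec_apply a_assoc)
      ultimately show "a \<in> adjoin (S Y) v" unfolding S_def adjoin_def by blast
    qed
    then have "vdim (S (adjoin Y v)) \<le> vdim (adjoin (S Y) v)"
      by (intro vdim_mono subspD(1)[OF subsp_adjoin[OF S[OF Y(1)] v]])
    also have "\<dots> \<le> Suc (vdim (S Y))" using vdim_adjoin_le[OF S[OF Y(1)] v] .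
    also have "\<dots> \<le> rk f + vdim (adjoin Y v)" using IH vdim_adjoin[OF Y(1) v Y(2)] by simp
    finally show "vdim (S (adjoin Y v)) \<le> rk f + vdim (adjoin Y v)" .
  qed
  moreover have "ladd f g ` vecs \<subseteq> S (g ` vecs)" by (auto simp: S_def ladd_def)
  then have "rk (ladd f g) \<le> vdim (S (g ` vecs))"
    unfolding rk_def using subspD(1)[OF S[OF G]] by (intro vdim_mono)
  ultimately show ?thesis unfolding rk_def[of g] by linarith
qed

text \<open>A subspace \<open>H\<close> that contains \<open>W\<close> and is maximal among those
  missing \<open>v\<close> is a complement of the line through \<open>v\<close>. The map sends a
  vector to \<open>u\<close> times its \<open>v\<close>-coordinate along \<open>H\<close>.\<close>

lemma lin_separate:
  assumes W: "subsp W" and v: "v \<in> vecs" "v \<notin> W" and u: "u \<in> vecs"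
  obtains h where "h \<in> lin" "\<And>w. w \<in> W \<Longrightarrow> h w = vzero" "h v = u"
proof -
  define HS where "HS = {H. subsp H \<and> W \<subseteq> H \<and> v \<notin> H}"
  have "W \<in> HS" using W v by (simp add: HS_def)
  moreover have "\<forall>H. H \<in> HS \<longrightarrow> vdim H < Suc n" using vdim_le subspD(1) by (auto simp: HS_def less_Suc_eq_le)
  ultimately obtain H where "H \<in> HS" and max: "\<And>H'. H' \<in> HS \<Longrightarrow> vdim H' \<le> vdim H"
    using ex_has_greatest_nat[of "\<lambda>H. H \<in> HS" W vdim "Suc n"] by blast
  then have H: "subsp H" "W \<subseteq> H" "v \<notin> H" by (auto simp: HS_def)
  \<comment> \<open>By maximality of \<open>H\<close>, adjoining \<open>y\<close> captures
    \<open>v\<close>; the coefficient of \<open>y\<close> in that expression is invertible, since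
    otherwise \<open>v\<close> would lie in \<open>H\<close>, and one can solve for
    \<open>y\<close>.\<close>
  have vH: "y \<in> adjoin H v" if y: "y \<in> vecs" for y
  proof (cases "y \<in> H")
    case True then show ?thesis using adjoin_superset(1)[OF H(1) v(1)] by auto
  next
    case False
    then have "vdim (adjoin H y) = Suc (vdim H)" using vdim_adjoin[OF H(1) y] by simp
    then have "adjoin H y \<notin> HS" using max[of "adjoin H y"] by auto
    then have "v \<in> adjoin H y"
      using subsp_adjoin[OF H(1) y] adjoin_superset(1)[OF H(1) y] H(2) by (auto simp: HS_def)
    then obtain w d where w: "w \<in> H" "d \<in> carrier D" "v = vadd w (vscale y d)" by (auto simp: adjoin_def)
    have wv: "w \<in> vecs" using w subspD(2)[OF H(1)] by auto
    have "d \<noteq> \<zero>"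
    proof
      assume "d = \<zero>"
      then have "v = w" using w wv y by (intro ext) (simp add: vec_apply)
      then show False using w(1) H(3) by simp
    qed
    then obtain c where c: "c \<in> carrier D" "d \<otimes> c = \<one>" using inverse_ex w(2) by metis
    have "y = vadd (vminus (vscale w c)) (vscale v c)"
    proof (rule ext)
      fix i
      have "v i \<otimes> c = w i \<otimes> c \<oplus> y i" using w c wv y by (simp add: vec_apply l_distr m_assoc)
      then show "y i = vadd (vminus (vscale w c)) (vscale v c) i" using w c wv y by (simp add: vec_apply r_neg1)
    qed
    moreover have "vminus (vscale w c) \<in> H" using w c H(1) by (simp add: subsp_vminus subspD)
    ultimately show ?thesis using c adjoinI[of _ H c v] by metis
  qed
  \<comment> \<open>Two different coefficients of \<open>v\<close> would express \<open>v\<close>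
    itself by elements of \<open>H\<close>, contrary to its choice.\<close>
  have uniq: "d = d'" if "vadd w (vscale v d) = vadd w' (vscale v d')" "w \<in> H" "w' \<in> H" "d \<in> carrier D" "d' \<in> carrier D"
    for w w' d d'
  proof (rule ccontr)
    assume "d \<noteq> d'"
    have wv [simp]: "w \<in> vecs" "w' \<in> vecs" "v \<in> vecs" using that subspD(2)[OF H(1)] v by auto
    define e where "e = d \<oplus> \<ominus> d'"
    have "e \<noteq> \<zero>" using \<open>d \<noteq> d'\<close> that(4,5) unfolding e_def
      by (metis minus_equality minus_minus a_inv_closed)
    moreover have [simp]: "e \<in> carrier D" using that by (simp add: e_def)
    ultimately obtain c where c: "c \<in> carrier D" "e \<otimes> c = \<one>" using inverse_ex by metis
    have "v = vscale (vadd w' (vminus w)) c"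
    proof (rule ext)
      fix i
      have eq: "w i \<oplus> v i \<otimes> d = w' i \<oplus> v i \<otimes> d'" using fun_cong[OF that(1), of i] by (simp add: vec_apply)
      have "v i \<otimes> e = v i \<otimes> d \<oplus> \<ominus> (v i \<otimes> d')" using that by (simp add: e_def r_distr r_minus)
      also have "v i \<otimes> d = \<ominus> w i \<oplus> (w' i \<oplus> v i \<otimes> d')" using eq that
        by (metis r_neg1 wv vecs_carrier m_closed)
      also have "\<ominus> w i \<oplus> (w' i \<oplus> v i \<otimes> d') \<oplus> \<ominus> (v i \<otimes> d') = w' i \<oplus> \<ominus> w i"
        using that(4,5) by (simp add: a_assoc r_neg r_neg2 a_comm[of "\<ominus> w i"])
      finally have "v i \<otimes> e \<otimes> c = (w' i \<oplus> \<ominus> w i) \<otimes> c" by simp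
      then show "v i = vscale (vadd w' (vminus w)) c i" using c by (simp add: vec_apply m_assoc)
    qed
    moreover have "vscale (vadd w' (vminus w)) c \<in> H"
      using that c H(1) by (simp add: subspD subsp_vminus)
    ultimately show False using H(3) by simp
  qed
  define cf where "cf y = (THE d. d \<in> carrier D \<and> (\<exists>w\<in>H. y = vadd w (vscale v d)))" for y
  have cf_eq: "cf (vadd w (vscale v d)) = d" if "w \<in> H" "d \<in> carrier D" for w d
    unfolding cf_def using that uniq by (intro the_equality) blast+
  define h where "h y = (if y \<in> vecs then vscale u (cf y) else vzero)" for y
  have h_eq: "h (vadd w (vscale v d)) = vscale u d" if "w \<in> H" "d \<in> carrier D" for w d
    using that v subspD(2)[OF H(1)] by (simp add: h_def cf_eq)
  have "h \<in> lin"
    unfolding lin_def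
  proof (intro CollectI conjI allI ballI impI)
    fix y show "h y \<in> vecs"
    proof (cases "y \<in> vecs")
      case True
      then obtain w d where "w \<in> H" "d \<in> carrier D" "y = vadd w (vscale v d)" using vH[of y] by (auto simp: adjoin_def)
      then show ?thesis using h_eq u by simp
    qed (simp add: h_def)
  next
    fix y assume "y \<notin> vecs" then show "h y = vzero" by (simp add: h_def)
  next
    fix y z assume "y \<in> vecs" "z \<in> vecs"
    then obtain w d w' d' where y: "w \<in> H" "d \<in> carrier D" "y = vadd w (vscale v d)"
      and z: "w' \<in> H" "d' \<in> carrier D" "z = vadd w' (vscale v d')" using vH[of y] vH[of z] by (auto simp: adjoin_def)
    have "vadd y z = vadd (vadd w w') (vscale v (d \<oplus> d'))"
      using y z v subspD(2)[OF H(1)] by (intro ext) (simp add: vec_apply r_distr a_ac)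
    then have "h (vadd y z) = vscale u (d \<oplus> d')" using h_eq y z subspD(4)[OF H(1)] by simp
    moreover have "h y = vscale u d" "h z = vscale u d'" using h_eq y z by simp_all
    ultimately show "h (vadd y z) = vadd (h y) (h z)"
      using y(2) z(2) u by (intro ext) (simp add: vec_apply r_distr)
  next
    fix y c assume "y \<in> vecs" and c: "c \<in> carrier D"
    then obtain w d where y: "w \<in> H" "d \<in> carrier D" "y = vadd w (vscale v d)"
      using vH[of y] by (auto simp: adjoin_def)
    have "vscale y c = vadd (vscale w c) (vscale v (d \<otimes> c))"
      using y c v subspD(2)[OF H(1)] by (intro ext) (simp add: vec_apply l_distr m_assoc)
    then have "h (vscale y c) = vscale u (d \<otimes> c)" using h_eq y c subspD(5)[OF H(1)] by simp
    moreover have "h y = vscale u d" using h_eq y by simp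
    ultimately show "h (vscale y c) = vscale (h y) c"
      using y(2) c u by (intro ext) (simp add: vec_apply m_assoc)
  qed
  moreover have "h w = vzero" if "w \<in> W" for w
  proof -
    have "w \<in> H" "w \<in> vecs" using that H(2) subspD(2)[OF W] by auto
    then have "w = vadd w (vscale v \<zero>)" using v by (intro ext) (simp add: vec_apply)
    moreover have "vscale u \<zero> = vzero" using u by (intro ext) (simp add: vec_apply)
    ultimately show ?thesis using h_eq[of w \<zero>] \<open>w \<in> H\<close> by simp
  qed
  moreover have "h v = u"
  proof -
    have "v = vadd vzero (vscale v \<one>)" using v by (intro ext) (simp add: vec_apply)
    moreover have "vscale u \<one> = u" using u by (intro ext) (simp add: vec_apply)
    ultimately show ?thesis using h_eq[of vzero \<one>] subspD(3)[OF H(1)] by simp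
  qed
  ultimately show ?thesis using that by blast
qed

text \<open>Add to \<open>g\<close> a map that kills \<open>W\<close> and sends \<open>v\<close> to
  the error \<open>u - g v\<close>. This allows linear maps to be constructed one vector at a time
  along \<open>subsp_chain_induct\<close>.\<close>

lemma lin_redefine:
  assumes g: "g \<in> lin" and W: "subsp W" and v: "v \<in> vecs" "v \<notin> W" and u: "u \<in> vecs"
  obtains g' where "g' \<in> lin" "\<And>w. w \<in> W \<Longrightarrow> g' w = g w" "g' v = u"
proof -
  have "vadd u (vminus (g v)) \<in> vecs" using u linD(1)[OF g] by simp
  then obtain h where h: "h \<in> lin" "\<And>w. w \<in> W \<Longrightarrow> h w = vzero" "h v = vadd u (vminus (g v))"
    using lin_separate[OF W v] by metis
  show ?thesis
  proof (rule that[of "ladd g h"])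
    show "ladd g h \<in> lin" using ladd_lin g h by simp
    show "ladd g h w = g w" if "w \<in> W" for w
      using h(2)[OF that] linD(1)[OF g, of w] by (intro ext) (simp add: vec_apply ladd_def)
    show "ladd g h v = u"
      using h(3) linD(1)[OF g, of v] u by (intro ext) (simp add: vec_apply ladd_def a_lcomm[of "g v _"] r_neg)
  qed
qed

text \<open>A section of \<open>f\<close> over its image is built vector by vector: for each new
  \<open>v\<close> in the image, \<open>g\<close> is redefined at \<open>v\<close> to be some
  preimage.\<close>

lemma lin_regular:
  assumes f: "f \<in> lin" shows "\<exists>g\<in>lin. f \<circ> g \<circ> f = f"
proof -
  have F: "subsp (f ` vecs)" using subsp_image[OF f subsp_vecs] .
  then have F0: "{vzero} \<subseteq> f ` vecs" by (simp add: subspD)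
  have "\<exists>g\<in>lin. \<forall>w\<in>f ` vecs. f (g w) = w"
    using subsp_vzero F F0
  proof (induct rule: subsp_chain_induct)
    show "\<exists>g\<in>lin. \<forall>w\<in>{vzero}. f (g w) = w" using lzero_lin lin_vzero[OF f] by (intro bexI[of _ lzero]) (auto simp: lzero_def)
  next
    fix Y v assume Y: "subsp Y" and v: "v \<in> f ` vecs" "v \<notin> Y" "v \<in> vecs"
      and "\<exists>g\<in>lin. \<forall>w\<in>Y. f (g w) = w"
    then obtain g where g: "g \<in> lin" "\<forall>w\<in>Y. f (g w) = w" by auto
    obtain u where u: "u \<in> vecs" "v = f u" using v by auto
    obtain g' where g': "g' \<in> lin" "\<And>w. w \<in> Y \<Longrightarrow> g' w = g w" "g' v = u"
      using lin_redefine[OF g(1) Y v(3,2) u(1)] by metis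
    have "f (g' (vadd w (vscale v d))) = vadd w (vscale v d)" if "w \<in> Y" "d \<in> carrier D" for w d
      using that g g' u v(3) subspD(2)[OF Y] f by (simp add: linD)
    then show "\<exists>g\<in>lin. \<forall>w\<in>adjoin Y v. f (g w) = w" using g'(1) by (auto simp: adjoin_def)
  qed
  then obtain g where g: "g \<in> lin" "\<forall>w\<in>f ` vecs. f (g w) = w" by auto
  have "f (g (f v)) = f v" for v
    using g(2) linD(2)[OF f, of v] lin_vzero[OF f] lin_vzero[OF g(1)] by (cases "v \<in> vecs") auto
  then show ?thesis using g(1) by (intro bexI[of _ g]) auto
qed

text \<open>The map \<open>g\<close> is built along a chain exhausting the image of
  \<open>h\<close>. As long as the image under \<open>f \<circ> g\<close> is smaller than that of
  \<open>f\<close>, the next vector is sent where it enlarges it; once \<open>rk f\<close> is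
  reached, \<open>g\<close> is left as it is.\<close>

lemma lin_prime:
  assumes f: "f \<in> lin" and h: "h \<in> lin"
  shows "\<exists>g\<in>lin. min (rk f) (rk h) \<le> rk (f \<circ> g \<circ> h)"
proof -
  have U: "subsp (h ` vecs)" using subsp_image[OF h subsp_vecs] .
  then have U0: "{vzero} \<subseteq> h ` vecs" by (simp add: subspD)
  have "\<exists>g\<in>lin. min (rk f) (vdim (h ` vecs)) \<le> vdim (f ` g ` h ` vecs)"
    using subsp_vzero U U0
  proof (induct rule: subsp_chain_induct)
    show "\<exists>g\<in>lin. min (rk f) (vdim {vzero}) \<le> vdim (f ` g ` {vzero})" using lzero_lin by (auto simp: vdim_vzero)
  next
    fix Y v assume Y: "subsp Y" and v: "v \<notin> Y" "v \<in> vecs"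
      and "\<exists>g\<in>lin. min (rk f) (vdim Y) \<le> vdim (f ` g ` Y)"
    then obtain g where g: "g \<in> lin" "min (rk f) (vdim Y) \<le> vdim (f ` g ` Y)" by auto
    have gY: "g ` Y \<subseteq> vecs" using linD(1)[OF g(1)] by auto
    show "\<exists>g\<in>lin. min (rk f) (vdim (adjoin Y v)) \<le> vdim (f ` g ` adjoin Y v)"
    proof (cases "rk f \<le> vdim (f ` g ` Y)")
      case True
      have "vdim (f ` g ` Y) \<le> vdim (f ` g ` adjoin Y v)"
        using adjoin_superset(1)[OF Y v(2)] linD(1)[OF f] by (intro vdim_mono) auto
      then show ?thesis using g(1) True by (intro bexI[of _ g]) auto
    next
      case False
      have "\<exists>u\<in>vecs. f u \<notin> f ` g ` Y"
      proof (rule ccontr)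
        assume "\<not> ?thesis"
        then have "f ` vecs = f ` g ` Y" using gY by auto
        then show False using False by (simp add: rk_def)
      qed
      then obtain u where u: "u \<in> vecs" "f u \<notin> f ` g ` Y" by auto
      obtain g' where g': "g' \<in> lin" "\<And>w. w \<in> Y \<Longrightarrow> g' w = g w" "g' v = u"
        using lin_redefine[OF g(1) Y v(2,1) u(1)] by metis
      have "f ` g' ` adjoin Y v = adjoin (f ` g' ` Y) (f (g' v))"
        using image_adjoin[OF g'(1) Y v(2)] image_adjoin[OF f subsp_image[OF g'(1) Y] linD(1)[OF g'(1)]] by simp
      also have "g' ` Y = g ` Y" using g'(2) by auto
      finally have "vdim (f ` g' ` adjoin Y v) = Suc (vdim (f ` g ` Y))"
        using vdim_adjoin[OF subsp_image[OF f subsp_image[OF g(1) Y]], of "f u"] u g'(3) linD(1)[OF f] by simp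
      then have "min (rk f) (vdim (adjoin Y v)) \<le> vdim (f ` g' ` adjoin Y v)"
        using g(2) vdim_adjoin[OF Y v(2,1)] by simp
      then show ?thesis using g'(1) by blast
    qed
  qed
  then show ?thesis by (simp add: rk_def image_comp o_assoc)
qed

lemma rk_le_card:
  assumes "\<And>v k. \<lbrakk>v \<in> vecs; k \<notin> B\<rbrakk> \<Longrightarrow> f v k = \<zero>" "finite B"
  shows "rk f \<le> card B"
  unfolding rk_def vdim_def using assms by (intro card_mono) (auto simp: leads_def)

text \<open>If \<open>f\<close> attains all unit patterns on the coordinates in \<open>Y\<close>,
  then projecting its image to these coordinates yields the unit vectors themselves, each of which
  contributes a pivot.\<close>

lemma card_le_rk:
  assumes f: "f \<in> lin" and Y: "Y \<subseteq> {..<n}"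
    and onto: "\<And>k. k \<in> Y \<Longrightarrow> \<exists>v\<in>vecs. \<forall>i\<in>Y. f v i = vunit k i"
  shows "card Y \<le> rk f"
proof -
  define p where "p v = (if v \<in> vecs then (\<lambda>i. if i \<in> Y then v i else \<zero>) else vzero)" for v
  have p: "p \<in> lin" unfolding lin_def by (auto simp: p_def fun_eq_iff vec_apply intro!: vecsI)
  have "Y \<subseteq> leads (p ` f ` vecs)"
  proof
    fix k assume k: "k \<in> Y"
    then obtain v where v: "v \<in> vecs" "\<forall>i\<in>Y. f v i = vunit k i" using onto by blast
    have "p (f v) = vunit k" using v k linD(1)[OF f] by (auto simp: p_def fun_eq_iff vec_apply vunit_def)
    then have "vunit k \<in> p ` f ` vecs" using v(1) by (metis image_eqI)
    then show "k \<in> leads (p ` f ` vecs)" by (rule leads_vunit)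
  qed
  then have "card Y \<le> vdim (p ` f ` vecs)"
    unfolding vdim_def using linD(1)[OF p] by (intro card_mono finite_leads) auto
  also have "\<dots> \<le> rk f" unfolding rk_def using vdim_image_le[OF p subsp_image[OF f subsp_vecs]] .
  finally show ?thesis .
qed

text \<open>The vectors on which both maps agree form a subspace having all positions below
  \<open>n\<close> as pivots, hence the whole space; no expansion in coordinates is needed.\<close>

lemma lin_eqI:
  assumes f: "f \<in> lin" and g: "g \<in> lin" and eq: "\<And>j. j < n \<Longrightarrow> f (vunit j) = g (vunit j)"
  shows "f = g"
proof -
  let ?K = "{v \<in> vecs. f v = g v}"
  have K: "subsp ?K" using f g by (auto simp: subsp_def linD lin_vzero)
  have "{..<n} \<subseteq> leads ?K"
    using eq by (auto intro!: leads_vunit)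
  then have "vecs \<subseteq> ?K"
    using subset_if_leads_subset[OF K subsp_vecs] leads_subset[of vecs] by auto
  then have "f v = g v" for v using linD(2)[OF f, of v] linD(2)[OF g, of v] by (cases "v \<in> vecs") auto
  then show ?thesis by auto
qed

section \<open>The endomorphism ring with its normalised rank\<close>

definition lin_ring :: "((nat \<Rightarrow> 'a) \<Rightarrow> nat \<Rightarrow> 'a) ring" where
  "lin_ring = \<lparr>carrier = lin, monoid.mult = (\<circ>), one = lone, ring.zero = lzero, ring.add = ladd\<rparr>"

lemma lin_ring_simps [simp]:
  "carrier lin_ring = lin" "f \<otimes>\<^bsub>lin_ring\<^esub> g = f \<circ> g" "\<one>\<^bsub>lin_ring\<^esub> = lone"
  "\<zero>\<^bsub>lin_ring\<^esub> = lzero" "f \<oplus>\<^bsub>lin_ring\<^esub> g = ladd f g"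
  by (simp_all add: lin_ring_def)

lemma ring_lin_ring: "ring lin_ring"
proof (rule ringI)
  note [simp] = linD ladd_def lzero_def lneg_def
  show "abelian_group lin_ring"
  proof (rule abelian_groupI)
    fix f assume f: "f \<in> carrier lin_ring"
    have "ladd (lneg f) f = lzero"
      using f by (auto simp: fun_eq_iff vec_apply l_neg)
    then show "\<exists>g\<in>carrier lin_ring. g \<oplus>\<^bsub>lin_ring\<^esub> f = \<zero>\<^bsub>lin_ring\<^esub>"
      using f lneg_lin by auto
  qed (auto simp: fun_eq_iff vec_apply a_ac ladd_lin lzero_lin simp del: lzero_def ladd_def | auto simp: fun_eq_iff vec_apply a_ac)+
  show "monoid lin_ring"
    by (rule monoidI) (auto simp: comp_lin lone_lin fun_eq_iff vec_apply lone_def lin_vzero)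
  fix f g h assume "f \<in> carrier lin_ring" "g \<in> carrier lin_ring" "h \<in> carrier lin_ring"
  then show "(f \<oplus>\<^bsub>lin_ring\<^esub> g) \<otimes>\<^bsub>lin_ring\<^esub> h = f \<otimes>\<^bsub>lin_ring\<^esub> h \<oplus>\<^bsub>lin_ring\<^esub> g \<otimes>\<^bsub>lin_ring\<^esub> h"
    "h \<otimes>\<^bsub>lin_ring\<^esub> (f \<oplus>\<^bsub>lin_ring\<^esub> g) = h \<otimes>\<^bsub>lin_ring\<^esub> f \<oplus>\<^bsub>lin_ring\<^esub> h \<otimes>\<^bsub>lin_ring\<^esub> g"
    by (auto simp: fun_eq_iff vec_apply)
qed

lemma rk_eq_zeroD:
  assumes f: "f \<in> lin" and "rk f = 0" shows "f = lzero"
proof -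
  have F: "subsp (f ` vecs)" using subsp_image[OF f subsp_vecs] .
  have "leads (f ` vecs) = {}"
    using assms(2) finite_leads[OF subspD(1)[OF F]] by (simp add: rk_def vdim_def)
  then have "f ` vecs \<subseteq> {vzero}"
    using subset_if_leads_subset[OF subsp_vzero F] subspD(3)[OF F] by simp
  then have "f v = vzero" for v using linD(2)[OF f, of v] by (cases "v \<in> vecs") auto
  then show ?thesis by (intro ext) (simp add: lzero_def)
qed

lemma lin_ring_minus:
  assumes "f \<in> lin" "g \<in> lin" shows "(f \<ominus>\<^bsub>lin_ring\<^esub> g) v k = f v k \<ominus> g v k"
proof -
  interpret L: ring lin_ring by (rule ring_lin_ring)
  have "ladd (lneg g) g = lzero"
    using linD(1)[OF assms(2)] by (simp add: fun_eq_iff vec_apply ladd_def lneg_def lzero_def l_neg)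
  then have "\<ominus>\<^bsub>lin_ring\<^esub> g = lneg g" using assms lneg_lin by (intro L.minus_equality) auto
  then show ?thesis by (simp add: a_minus_def ladd_def lneg_def vec_apply)
qed

text \<open>The bridge from counting to rank: pivots of the image of the difference occur only at
  coordinates where the two maps can disagree.\<close>

lemma rk_diff_le_card:
  assumes f: "f \<in> lin" and g: "g \<in> lin" and "finite B"
    and eq: "\<And>v k. \<lbrakk>v \<in> vecs; k < n; k \<notin> B\<rbrakk> \<Longrightarrow> f v k = g v k"
  shows "rk (f \<ominus>\<^bsub>lin_ring\<^esub> g) \<le> card B"
proof (rule rk_le_card[OF _ assms(3)])
  fix v k assume v: "v \<in> vecs" and k: "k \<notin> B"
  have fg: "f v \<in> vecs" "g v \<in> vecs" using linD(1) f g by auto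
  then have "f v k = g v k" using eq[OF v _ k] by (cases "k < n") auto
  then show "(f \<ominus>\<^bsub>lin_ring\<^esub> g) v k = \<zero>"
    using lin_ring_minus[OF f g] fg by (simp add: a_minus_def r_neg)
qed

lemma pseudo_rank_ring_lin_ring:
  assumes n: "0 < n" shows "pseudo_rank_ring lin_ring (\<lambda>f. real (rk f) / real n)"
proof -
  interpret L: ring lin_ring by (rule ring_lin_ring)
  show ?thesis
  proof
    fix f g assume fg: "f \<in> carrier lin_ring" "g \<in> carrier lin_ring"
    obtain h where h: "h \<in> lin" "min (rk f) (rk g) \<le> rk (f \<circ> h \<circ> g)" using lin_prime fg by auto
    then have "min (real (rk f) / real n) (real (rk g) / real n) \<le> real (rk (f \<circ> h \<circ> g)) / real n"
      using n by (auto simp: min_def divide_le_cancel split: if_splits)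
    then show "\<exists>h\<in>carrier lin_ring. min (real (rk f) / real n) (real (rk g) / real n)
        \<le> real (rk (f \<otimes>\<^bsub>lin_ring\<^esub> h \<otimes>\<^bsub>lin_ring\<^esub> g)) / real n"
      using h(1) by (intro bexI[of _ h]) simp_all
    have "real (rk (ladd f g)) \<le> real (rk f) + real (rk g)" using rk_ladd[of f g] fg by simp
    then show "real (rk (f \<oplus>\<^bsub>lin_ring\<^esub> g)) / real n \<le> real (rk f) / real n + real (rk g) / real n"
      using n by (simp add: field_simps)
  next
    fix f g h assume "f \<in> carrier lin_ring" "g \<in> carrier lin_ring" "h \<in> carrier lin_ring"
    then have "real (rk (f \<circ> g)) + real (rk (g \<circ> h)) \<le> real (rk g) + real (rk (f \<circ> g \<circ> h))"
      using rk_frobenius[of f g h] by simp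
    then show "real (rk (f \<otimes>\<^bsub>lin_ring\<^esub> g)) / real n + real (rk (g \<otimes>\<^bsub>lin_ring\<^esub> h)) / real n
        \<le> real (rk g) / real n + real (rk (f \<otimes>\<^bsub>lin_ring\<^esub> g \<otimes>\<^bsub>lin_ring\<^esub> h)) / real n"
      by (simp add: add_divide_distrib[symmetric] divide_right_mono)
  next
    fix u assume u: "\<And>k. u k \<in> carrier lin_ring"
      and d: "\<And>k. real (rk (u (Suc k) \<ominus>\<^bsub>lin_ring\<^esub> u k)) / real n \<le> (1/2) ^ k"
    \<comment> \<open>Normalised ranks are multiples of \<open>1 / n\<close>, so from
      \<open>K\<close> on the increments have rank zero and the sequence is constant.\<close>
    obtain K where K: "(1/2) ^ K < 1 / real n" using real_arch_pow_inv[of "1 / real n" "1/2"] n by auto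
    have step: "u (Suc k) = u k" if "K \<le> k" for k
    proof -
      have "(1/2::real) ^ k \<le> (1/2) ^ K" using that by (intro power_decreasing) auto
      then have "real (rk (u (Suc k) \<ominus>\<^bsub>lin_ring\<^esub> u k)) / real n < 1 / real n" using d[of k] K by linarith
      then have "rk (u (Suc k) \<ominus>\<^bsub>lin_ring\<^esub> u k) = 0" using n by (simp add: divide_less_cancel)
      then have "u (Suc k) \<ominus>\<^bsub>lin_ring\<^esub> u k = \<zero>\<^bsub>lin_ring\<^esub>"
        using rk_eq_zeroD[of "u (Suc k) \<ominus>\<^bsub>lin_ring\<^esub> u k"] L.minus_closed[OF u u] by simp
      then show ?thesis using u L.r_right_minus_eq by blast
    qed
    have const: "u k = u K" if "K \<le> k" for k
      using that by (induct rule: dec_induct) (auto simp: step)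
    have "eventually (\<lambda>k. real (rk (u k \<ominus>\<^bsub>lin_ring\<^esub> u K)) / real n = 0) sequentially"
      unfolding eventually_sequentially
    proof (intro exI allI impI)
      fix k assume "K \<le> k"
      then have "u k \<ominus>\<^bsub>lin_ring\<^esub> u K = \<zero>\<^bsub>lin_ring\<^esub>" using const u L.r_right_minus_eq by metis
      then show "real (rk (u k \<ominus>\<^bsub>lin_ring\<^esub> u K)) / real n = 0" by (simp add: rk_lzero)
    qed
    then show "\<exists>y\<in>carrier lin_ring. (\<lambda>k. real (rk (u k \<ominus>\<^bsub>lin_ring\<^esub> y)) / real n) \<longlonglongrightarrow> 0"
      using u by (intro bexI[of _ "u K"] tendsto_eventually) auto
  qed (use n in \<open>auto simp: rk_lzero rk_lone lin_regular divide_right_mono rk_comp_le_left rk_comp_le_right\<close>)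
qed

end

section \<open>Ultraproducts of rank rings\<close>

text \<open>Zorn's lemma for proper filters refining \<open>F\<close>. If the negation of
  \<open>P\<close> is not eventually true, adding \<open>P\<close> to a maximally fine filter keeps
  it proper and so changes nothing.\<close>

lemma ultrafilter_ex:
  fixes F :: "'i filter"
  assumes "F \<noteq> bot"
  obtains U where "U \<le> F" "U \<noteq> bot" "\<And>P. eventually P U \<or> eventually (\<lambda>x. \<not> P x) U"
proof -
  define A where "A = {G. G \<le> F \<and> G \<noteq> bot}"
  \<comment> \<open>The order is reversed because finer filters are smaller; a chain is bounded by
    its infimum, which stays proper since eventual truth for it is already decided by a
    member.\<close>
  define r where "r = {(G, H). G \<in> A \<and> H \<in> A \<and> H \<le> G}"
  have Fr: "Field r = A" by (auto simp: Field_def r_def)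
  have po: "Partial_order r"
    by (auto simp: partial_order_on_def preorder_on_def refl_on_def Fr trans_def antisym_def) (auto simp: r_def)
  have "\<exists>u\<in>Field r. \<forall>a\<in>C. (a, u) \<in> r" if C: "C \<in> Chains r" for C
  proof (cases "C = {}")
    case True
    then show ?thesis using assms Fr by (auto simp: A_def)
  next
    case False
    have CA: "G \<in> A" if "G \<in> C" for G using C that by (auto simp: Chains_def r_def)
    have chain: "G \<le> H \<or> H \<le> G" if "G \<in> C" "H \<in> C" for G H
      using C that by (auto simp: Chains_def r_def)
    have "eventually P (Inf C) \<longleftrightarrow> (\<exists>G\<in>C. eventually P G)" for P
    proof (rule eventually_Inf_base[OF False])
      fix G H assume "G \<in> C" "H \<in> C"
      then show "\<exists>x\<in>C. x \<le> inf G H" using chain[of G H] by (auto simp: inf_absorb1 inf_absorb2)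
    qed
    then have "Inf C \<noteq> bot" using CA by (auto simp: trivial_limit_def A_def)
    moreover have "Inf C \<le> F" using False CA by (auto simp: A_def intro: Inf_lower2)
    ultimately have "Inf C \<in> A" by (simp add: A_def)
    then show ?thesis using CA Fr by (auto simp: r_def intro!: bexI[of _ "Inf C"] Inf_lower)
  qed
  then obtain U where U: "U \<in> Field r" "\<forall>a\<in>Field r. (U, a) \<in> r \<longrightarrow> a = U"
    using Zorns_po_lemma[OF po] by blast
  then have UA: "U \<in> A" and max: "\<And>G. \<lbrakk>G \<in> A; G \<le> U\<rbrakk> \<Longrightarrow> G = U" using Fr by (auto simp: r_def)
  show ?thesis
  proof (rule that[of U])
    show "U \<le> F" "U \<noteq> bot" using UA by (auto simp: A_def)
    fix P
    show "eventually P U \<or> eventually (\<lambda>x. \<not> P x) U"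
    proof (rule disjCI)
      assume n: "\<not> eventually (\<lambda>x. \<not> P x) U"
      let ?G = "inf U (principal {x. P x})"
      have "?G \<noteq> bot" using n by (simp add: trivial_limit_def eventually_inf_principal)
      moreover have "?G \<le> F" using UA by (auto simp: A_def intro: le_infI1)
      ultimately have "?G = U" by (intro max) (auto simp: A_def)
      moreover have "eventually P ?G" by (simp add: eventually_inf_principal)
      ultimately show "eventually P U" by simp
    qed
  qed
qed

text \<open>Each threshold is either eventually a lower bound of \<open>f\<close> or eventually
  exceeds it, so the supremum of the eventual lower bounds is the limit.\<close>

lemma ultrafilter_tendsto:
  fixes f :: "'i \<Rightarrow> real"
  assumes U: "U \<noteq> bot" "\<And>P. eventually P U \<or> eventually (\<lambda>x. \<not> P x) U"
    and f: "\<And>i. f i \<in> {a..b}"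
  shows "(f \<longlongrightarrow> Lim U f) U"
proof -
  define S where "S = {c. eventually (\<lambda>i. c \<le> f i) U}"
  have "a \<in> S" using f by (simp add: S_def)
  moreover have "bdd_above S"
  proof (rule bdd_aboveI[of _ b])
    fix c assume "c \<in> S"
    then obtain i where "c \<le> f i" using eventually_happens'[OF U(1)] by (auto simp: S_def)
    then show "c \<le> b" using f[of i] by simp
  qed
  ultimately have S: "S \<noteq> {}" "bdd_above S" by auto
  have "(f \<longlongrightarrow> Sup S) U"
  proof (rule order_tendstoI)
    fix y assume "y < Sup S"
    then obtain c where "c \<in> S" "y < c" using less_cSup_iff[OF S] by auto
    then show "eventually (\<lambda>i. y < f i) U"
      unfolding S_def by (auto elim: eventually_mono)
  next
    fix y assume y: "Sup S < y"
    have "y \<notin> S" using cSup_upper[OF _ S(2), of y] y by auto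
    then have "eventually (\<lambda>i. \<not> y \<le> f i) U" using U(2)[of "\<lambda>i. y \<le> f i"] by (auto simp: S_def)
    then show "eventually (\<lambda>i. f i < y) U" by (simp add: not_le)
  qed
  then show ?thesis using tendsto_Lim[OF U(1)] by metis
qed

section \<open>Product rings and ultralimits of ranks\<close>

definition prod_ring :: "('i \<Rightarrow> ('a, 'b) ring_scheme) \<Rightarrow> ('i \<Rightarrow> 'a) ring" where
  "prod_ring R = \<lparr>carrier = {f. \<forall>i. f i \<in> carrier (R i)},
     monoid.mult = (\<lambda>f g i. f i \<otimes>\<^bsub>R i\<^esub> g i), one = (\<lambda>i. \<one>\<^bsub>R i\<^esub>),
     ring.zero = (\<lambda>i. \<zero>\<^bsub>R i\<^esub>), ring.add = (\<lambda>f g i. f i \<oplus>\<^bsub>R i\<^esub> g i)\<rparr>"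

lemma prod_ring_simps [simp]:
  "f \<in> carrier (prod_ring R) \<longleftrightarrow> (\<forall>i. f i \<in> carrier (R i))"
  "(f \<otimes>\<^bsub>prod_ring R\<^esub> g) = (\<lambda>i. f i \<otimes>\<^bsub>R i\<^esub> g i)"
  "\<one>\<^bsub>prod_ring R\<^esub> = (\<lambda>i. \<one>\<^bsub>R i\<^esub>)" "\<zero>\<^bsub>prod_ring R\<^esub> = (\<lambda>i. \<zero>\<^bsub>R i\<^esub>)"
  "(f \<oplus>\<^bsub>prod_ring R\<^esub> g) = (\<lambda>i. f i \<oplus>\<^bsub>R i\<^esub> g i)"
  by (simp_all add: prod_ring_def)

lemma ring_prod_ring:
  assumes "\<And>i. ring (R i)" shows "ring (prod_ring R)"
proof -
  interpret R: ring "R i" for i by (rule assms)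
  show ?thesis
  proof (rule ringI)
    show "abelian_group (prod_ring R)"
    proof (rule abelian_groupI)
      fix f assume f: "f \<in> carrier (prod_ring R)"
      then show "\<exists>g\<in>carrier (prod_ring R). g \<oplus>\<^bsub>prod_ring R\<^esub> f = \<zero>\<^bsub>prod_ring R\<^esub>"
        by (intro bexI[of _ "\<lambda>i. \<ominus>\<^bsub>R i\<^esub> f i"]) (auto simp: R.l_neg)
    qed (auto simp: R.a_ac)
    show "monoid (prod_ring R)" by (rule monoidI) (auto simp: R.m_assoc)
  qed (auto simp: R.l_distr R.r_distr)
qed

lemma a_minus_prod_ring:
  assumes "\<And>i. ring (R i)" "f \<in> carrier (prod_ring R)" "g \<in> carrier (prod_ring R)"
  shows "f \<ominus>\<^bsub>prod_ring R\<^esub> g = (\<lambda>i. f i \<ominus>\<^bsub>R i\<^esub> g i)"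
proof -
  interpret R: ring "R i" for i by (rule assms)
  interpret P: ring "prod_ring R" by (rule ring_prod_ring) (rule assms)
  have "\<ominus>\<^bsub>prod_ring R\<^esub> g = (\<lambda>i. \<ominus>\<^bsub>R i\<^esub> g i)"
    using assms(3) by (intro P.minus_equality) (auto simp: R.l_neg)
  then show ?thesis by (simp add: a_minus_def)
qed

locale rank_ultraproduct =
  fixes R :: "'i \<Rightarrow> ('a, 'b) ring_scheme" and rk :: "'i \<Rightarrow> 'a \<Rightarrow> real" and U :: "'i filter"
  assumes rank: "\<And>i. pseudo_rank_ring (R i) (rk i)"
    and rk_one: "\<And>i. rk i \<one>\<^bsub>R i\<^esub> = 1"
    and U_nonbot: "U \<noteq> bot"
    and U_ultra: "\<And>P. eventually P U \<or> eventually (\<lambda>x. \<not> P x) U"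
begin

sublocale R: pseudo_rank_ring "R i" "rk i" for i
  by (rule rank)

abbreviation P where "P \<equiv> prod_ring R"

definition ulim :: "('i \<Rightarrow> 'a) \<Rightarrow> real" where
  "ulim f = Lim U (\<lambda>i. rk i (f i))"

sublocale P: ring P
  by (rule ring_prod_ring) unfold_locales

lemma P_minus: "\<lbrakk>f \<in> carrier P; g \<in> carrier P\<rbrakk> \<Longrightarrow> f \<ominus>\<^bsub>P\<^esub> g = (\<lambda>i. f i \<ominus>\<^bsub>R i\<^esub> g i)"
  by (rule a_minus_prod_ring) (auto intro: R.ring_axioms)

lemma rk_bounds: "f \<in> carrier (R i) \<Longrightarrow> rk i f \<in> {0..1}"
  using R.N_nonneg[of f i] R.N_le_one[of f i] rk_one by auto

lemma tendsto_ulim: "f \<in> carrier P \<Longrightarrow> ((\<lambda>i. rk i (f i)) \<longlongrightarrow> ulim f) U"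
  unfolding ulim_def using rk_bounds by (intro ultrafilter_tendsto[OF U_nonbot U_ultra, of _ 0 1]) auto

lemma ulim_le:
  assumes "f \<in> carrier P" "(g \<longlongrightarrow> c) U" "\<And>i. rk i (f i) \<le> g i"
  shows "ulim f \<le> c"
  using tendsto_le[OF U_nonbot assms(2) tendsto_ulim[OF assms(1)]] assms(3) by simp

lemma ulim_ge:
  assumes "f \<in> carrier P" "(g \<longlongrightarrow> c) U" "\<And>i. g i \<le> rk i (f i)"
  shows "c \<le> ulim f"
  using tendsto_le[OF U_nonbot tendsto_ulim[OF assms(1)] assms(2)] assms(3) by simp

text \<open>At a given index the sequence may satisfy the Cauchy bounds only up to some finite
  stage. If they never fail, the limit in that component is taken; otherwise the component is frozen
  at the last good stage. Each fixed stage is good for almost all indices, which suffices for the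
  ultralimit.\<close>

lemma ulim_complete:
  assumes u: "\<And>k. u k \<in> carrier P" and d: "\<And>k. ulim (u (Suc k) \<ominus>\<^bsub>P\<^esub> u k) \<le> (1/2) ^ k"
  shows "\<exists>y\<in>carrier P. (\<lambda>k. ulim (u k \<ominus>\<^bsub>P\<^esub> y)) \<longlonglongrightarrow> 0"
proof -
  have uc [simp]: "u k i \<in> carrier (R i)" for k i using u by simp
  \<comment> \<open>The factor 2 makes the bound strict relative to the ultralimit, so that each
    increment satisfies it at almost all indices.\<close>
  define A where "A k i \<longleftrightarrow> (\<forall>j<k. rk i (u (Suc j) i \<ominus>\<^bsub>R i\<^esub> u j i) < 2 * (1/2) ^ j)" for k i
  have ev: "eventually (A k) U" for k
  proof -
    have "eventually (\<lambda>i. rk i (u (Suc j) i \<ominus>\<^bsub>R i\<^esub> u j i) < 2 * (1/2) ^ j) U" for j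
    proof -
      have "((\<lambda>i. rk i ((u (Suc j) \<ominus>\<^bsub>P\<^esub> u j) i)) \<longlongrightarrow> ulim (u (Suc j) \<ominus>\<^bsub>P\<^esub> u j)) U"
        using u P.minus_closed by (intro tendsto_ulim) blast
      moreover have "ulim (u (Suc j) \<ominus>\<^bsub>P\<^esub> u j) < 2 * (1/2)^j" using d[of j]
        by (rule order.strict_trans1) simp
      ultimately show ?thesis using order_tendstoD(2) P_minus[OF u u] by fastforce
    qed
    then have "eventually (\<lambda>i. \<forall>j\<in>{..<k}. rk i (u (Suc j) i \<ominus>\<^bsub>R i\<^esub> u j i) < 2 * (1/2) ^ j) U"
      by (intro eventually_ball_finite) auto
    then show ?thesis by (rule eventually_mono) (simp add: A_def)
  qed
  \<comment> \<open>The increments sum to \<open>\<Sum>2 * (1/2)^j\<close> over \<open>j\<close>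
    from \<open>k\<close> to \<open>k + m - 1\<close>, which is exactly this difference; its first
    term bounds all tails.\<close>
  have telescope: "rk i (u k i \<ominus>\<^bsub>R i\<^esub> u (k + m) i) \<le> 4 * (1/2)^k - 4 * (1/2)^(k+m)" if "A (k + m) i" for i k m
    using that
  proof (induct m)
    case 0 then show ?case by (simp add: R.diff_self)
  next
    case (Suc m)
    have "rk i (u (k + m) i \<ominus>\<^bsub>R i\<^esub> u (Suc (k + m)) i) < 2 * (1/2)^(k+m)"
      using Suc.prems R.N_diff_commute[of "u (k+m) i" i "u (Suc (k+m)) i"] by (simp add: A_def)
    moreover have "A (k + m) i" using Suc.prems by (simp add: A_def)
    ultimately show ?case
      using Suc.hyps R.N_triangle[of "u k i" i "u (k + m) i" "u (Suc (k + m)) i"] by simp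
  qed
  have "\<exists>y\<in>carrier (R i). \<forall>k. A k i \<longrightarrow> rk i (u k i \<ominus>\<^bsub>R i\<^esub> y) \<le> 4 * (1/2)^k" for i
  proof (cases "\<forall>k. A k i")
    case True
    \<comment> \<open>Dropping the first term absorbs the factor 2, since
      \<open>2 * (1/2) ^ Suc k = (1/2) ^ k\<close>.\<close>
    have "\<exists>y\<in>carrier (R i). (\<lambda>k. rk i (u (Suc k) i \<ominus>\<^bsub>R i\<^esub> y)) \<longlonglongrightarrow> 0"
    proof (rule R.N_complete)
      fix k
      have "A (Suc (Suc k)) i" using True by simp
      then have "rk i (u (Suc (Suc k)) i \<ominus>\<^bsub>R i\<^esub> u (Suc k) i) < 2 * (1/2) ^ Suc k"
        unfolding A_def by blast
      then show "rk i (u (Suc (Suc k)) i \<ominus>\<^bsub>R i\<^esub> u (Suc k) i) \<le> (1/2) ^ k" by simp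
    qed simp
    then obtain y where y: "y \<in> carrier (R i)" "(\<lambda>k. rk i (u (Suc k) i \<ominus>\<^bsub>R i\<^esub> y)) \<longlonglongrightarrow> 0" by blast
    then have lim: "(\<lambda>k. rk i (u k i \<ominus>\<^bsub>R i\<^esub> y)) \<longlonglongrightarrow> 0" using filterlim_sequentially_Suc by blast
    have "rk i (u k i \<ominus>\<^bsub>R i\<^esub> y) \<le> 4 * (1/2)^k" for k
    proof -
      have "(\<lambda>m. 4 * (1/2)^k + rk i (u (m + k) i \<ominus>\<^bsub>R i\<^esub> y)) \<longlonglongrightarrow> 4 * (1/2)^k + 0"
        by (intro tendsto_intros LIMSEQ_ignore_initial_segment[OF lim])
      moreover have "rk i (u k i \<ominus>\<^bsub>R i\<^esub> y) \<le> 4 * (1/2)^k + rk i (u (m + k) i \<ominus>\<^bsub>R i\<^esub> y)" for m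
      proof -
        have "rk i (u k i \<ominus>\<^bsub>R i\<^esub> u (k + m) i) \<le> 4 * (1/2)^k"
          using telescope[of k m i] True by (smt (verit) zero_le_power zero_le_divide_1_iff)
        then show ?thesis using R.N_triangle[of "u k i" i "u (k + m) i" y] y(1) by (simp add: add.commute)
      qed
      ultimately show ?thesis using LIMSEQ_le_const by fastforce
    qed
    then show ?thesis using y(1) by blast
  next
    case False
    have A0: "A 0 i" by (simp add: A_def)
    \<comment> \<open>The last good stage: \<open>A\<close> is downward closed in its first
      argument, so no later stage is good.\<close>
    obtain K where K: "A K i" "\<not> A (Suc K) i" using False nat_induct[of "\<lambda>k. A k i", OF A0] by blast
    have kK: "k \<le> K" if "A k i" for k
    proof (rule ccontr)
      assume "\<not> k \<le> K"
      then have "A (Suc K) i" using that by (simp add: A_def)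
      then show False using K(2) by simp
    qed
    have "rk i (u k i \<ominus>\<^bsub>R i\<^esub> u K i) \<le> 4 * (1/2)^k" if "A k i" for k
    proof -
      have "rk i (u k i \<ominus>\<^bsub>R i\<^esub> u K i) \<le> 4 * (1/2)^k - 4 * (1/2)^K"
        using telescope[of k "K - k" i] kK[OF that] K(1) by simp
      also have "\<dots> \<le> 4 * (1/2)^k" by simp
      finally show ?thesis .
    qed
    then show ?thesis by (intro bexI[of _ "u K i"]) auto
  qed
  then obtain y where y: "\<And>i. y i \<in> carrier (R i)"
    "\<And>i k. A k i \<Longrightarrow> rk i (u k i \<ominus>\<^bsub>R i\<^esub> y i) \<le> 4 * (1/2)^k" by metis
  have yP: "y \<in> carrier P" using y by simp
  have le: "ulim (u k \<ominus>\<^bsub>P\<^esub> y) \<le> 4 * (1/2)^k" for k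
  proof (rule tendsto_le[OF U_nonbot tendsto_const])
    show "((\<lambda>i. rk i ((u k \<ominus>\<^bsub>P\<^esub> y) i)) \<longlongrightarrow> ulim (u k \<ominus>\<^bsub>P\<^esub> y)) U"
      by (intro tendsto_ulim P.minus_closed u yP)
    show "eventually (\<lambda>i. rk i ((u k \<ominus>\<^bsub>P\<^esub> y) i) \<le> 4 * (1/2)^k) U"
      using ev[of k] by (rule eventually_mono) (simp add: P_minus[OF u yP] y)
  qed
  have "(\<lambda>k. ulim (u k \<ominus>\<^bsub>P\<^esub> y)) \<longlonglongrightarrow> 0"
  proof (rule tendsto_sandwich[OF _ _ tendsto_const])
    show "eventually (\<lambda>k. ulim (u k \<ominus>\<^bsub>P\<^esub> y) \<le> 4 * (1/2)^k) sequentially" using le by simp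
    show "(\<lambda>k. 4 * (1/2)^k :: real) \<longlonglongrightarrow> 0" by (intro tendsto_mult_right_zero LIMSEQ_power_zero) simp
    have "0 \<le> ulim (u k \<ominus>\<^bsub>P\<^esub> y)" for k
    proof (rule ulim_ge[OF _ tendsto_const])
      show "u k \<ominus>\<^bsub>P\<^esub> y \<in> carrier P" by (intro P.minus_closed u yP)
      fix i show "0 \<le> rk i ((u k \<ominus>\<^bsub>P\<^esub> y) i)"
        using u yP by (simp add: P_minus R.N_nonneg)
    qed
    then show "eventually (\<lambda>k. 0 \<le> ulim (u k \<ominus>\<^bsub>P\<^esub> y)) sequentially" by simp
  qed
  then show ?thesis using yP by blast
qed

text \<open>The existential axioms survive because their witnesses are chosen simultaneously in all
  components, with the inequality or equation holding at every index.\<close>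

lemma pseudo_rank_ring_P: "pseudo_rank_ring P ulim"
proof
  show "ulim \<zero>\<^bsub>P\<^esub> = 0" using tendsto_Lim[OF U_nonbot tendsto_const, of "0::real"] by (simp add: ulim_def)
  show "ulim \<one>\<^bsub>P\<^esub> \<noteq> 0" using tendsto_Lim[OF U_nonbot tendsto_const, of "1::real"] by (simp add: ulim_def rk_one)
next
  fix f g assume fg: "f \<in> carrier P" "g \<in> carrier P"
  show "ulim (f \<oplus>\<^bsub>P\<^esub> g) \<le> ulim f + ulim g"
    by (rule ulim_le[OF _ tendsto_add[OF tendsto_ulim tendsto_ulim]]) (use fg R.N_add in auto)
  show "ulim (f \<otimes>\<^bsub>P\<^esub> g) \<le> ulim f"
    by (rule ulim_le[OF _ tendsto_ulim]) (use fg R.N_mult_le_left in auto)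
  show "ulim (f \<otimes>\<^bsub>P\<^esub> g) \<le> ulim g"
    by (rule ulim_le[OF _ tendsto_ulim]) (use fg R.N_mult_le_right in auto)
  have "\<forall>i. \<exists>x\<in>carrier (R i). min (rk i (f i)) (rk i (g i)) \<le> rk i (f i \<otimes>\<^bsub>R i\<^esub> x \<otimes>\<^bsub>R i\<^esub> g i)"
    using fg R.N_prime by simp
  then obtain x where x: "\<And>i. x i \<in> carrier (R i)"
    "\<And>i. min (rk i (f i)) (rk i (g i)) \<le> rk i (f i \<otimes>\<^bsub>R i\<^esub> x i \<otimes>\<^bsub>R i\<^esub> g i)" by metis
  show "\<exists>x\<in>carrier P. min (ulim f) (ulim g) \<le> ulim (f \<otimes>\<^bsub>P\<^esub> x \<otimes>\<^bsub>P\<^esub> g)"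
  proof (rule bexI[of _ x])
    show "min (ulim f) (ulim g) \<le> ulim (f \<otimes>\<^bsub>P\<^esub> x \<otimes>\<^bsub>P\<^esub> g)"
      by (rule ulim_ge[OF _ tendsto_min[OF tendsto_ulim tendsto_ulim]]) (use fg x in auto)
  qed (use x in simp)
next
  fix f g h assume fgh: "f \<in> carrier P" "g \<in> carrier P" "h \<in> carrier P"
  have "((\<lambda>i. rk i ((f \<otimes>\<^bsub>P\<^esub> g) i) + rk i ((g \<otimes>\<^bsub>P\<^esub> h) i)) \<longlongrightarrow> ulim (f \<otimes>\<^bsub>P\<^esub> g) + ulim (g \<otimes>\<^bsub>P\<^esub> h)) U"
    "((\<lambda>i. rk i (g i) + rk i ((f \<otimes>\<^bsub>P\<^esub> g \<otimes>\<^bsub>P\<^esub> h) i)) \<longlongrightarrow> ulim g + ulim (f \<otimes>\<^bsub>P\<^esub> g \<otimes>\<^bsub>P\<^esub> h)) U"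
    by (intro tendsto_add tendsto_ulim P.m_closed fgh)+
  then show "ulim (f \<otimes>\<^bsub>P\<^esub> g) + ulim (g \<otimes>\<^bsub>P\<^esub> h) \<le> ulim g + ulim (f \<otimes>\<^bsub>P\<^esub> g \<otimes>\<^bsub>P\<^esub> h)"
    using fgh R.N_frobenius by (intro tendsto_le[OF U_nonbot]) auto
next
  fix f assume f: "f \<in> carrier P"
  then have "\<forall>i. \<exists>x\<in>carrier (R i). f i \<otimes>\<^bsub>R i\<^esub> x \<otimes>\<^bsub>R i\<^esub> f i = f i" using R.regular by simp
  then obtain x where "\<And>i. x i \<in> carrier (R i)" "\<And>i. f i \<otimes>\<^bsub>R i\<^esub> x i \<otimes>\<^bsub>R i\<^esub> f i = f i" by metis
  then show "\<exists>x\<in>carrier P. f \<otimes>\<^bsub>P\<^esub> x \<otimes>\<^bsub>P\<^esub> f = f" by (intro bexI[of _ x]) auto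
qed (rule ulim_complete)

end

section \<open>The quotient by the ideal of rank zero\<close>

context pseudo_rank_ring
begin

lemma ideal_N_zero: "ideal {x \<in> carrier R. N x = 0} R"
proof (rule idealI)
  show "ring R" by (rule ring_axioms)
  show "subgroup {x \<in> carrier R. N x = 0} (add_monoid R)"
  proof (rule group.subgroupI)
    show "Group.group (add_monoid R)" using a_group by simp
    show "{x \<in> carrier R. N x = 0} \<noteq> {}" using N_zero by blast
  next
    fix x assume "x \<in> {x \<in> carrier R. N x = 0}"
    then show "inv\<^bsub>add_monoid R\<^esub> x \<in> {x \<in> carrier R. N x = 0}" using N_uminus by (simp add: a_inv_def[symmetric])
  next
    fix x y assume "x \<in> {x \<in> carrier R. N x = 0}" "y \<in> {x \<in> carrier R. N x = 0}"
    then show "x \<otimes>\<^bsub>add_monoid R\<^esub> y \<in> {x \<in> carrier R. N x = 0}"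
      using N_add[of x y] N_nonneg[of "x \<oplus> y"] by auto
  qed auto
next
  fix a x assume "a \<in> {x \<in> carrier R. N x = 0}" "x \<in> carrier R"
  then show "x \<otimes> a \<in> {x \<in> carrier R. N x = 0}" "a \<otimes> x \<in> {x \<in> carrier R. N x = 0}"
    using N_mult_le_right[of x a] N_nonneg[of "x \<otimes> a"] N_mult_le_left[of a x] N_nonneg[of "a \<otimes> x"] by auto
qed

lemma N_eq_if_N_diff_zero:
  assumes "x \<in> carrier R" "y \<in> carrier R" "N (x \<ominus> y) = 0" shows "N x = N y"
proof -
  have "N x \<le> N y" using N_add[of y "x \<ominus> y"] assms by (simp add: add_diff_cancel)
  moreover have "N y \<le> N x" using N_add[of x "y \<ominus> x"] N_diff_commute[of x y] assms by (simp add: add_diff_cancel)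
  ultimately show ?thesis by simp
qed

text \<open>Elements with the same image differ by rank zero and so have equal rank, which makes
  \<open>N'\<close> well defined. An arbitrary surjection is allowed so that \<open>Q\<close> may be
  a copy of the coset ring on another type.\<close>

lemma rank_ring_quotient:
  assumes Q: "ring Q" and \<pi>: "\<pi> \<in> ring_hom R Q" and surj: "\<pi> ` carrier R = carrier Q"
    and ker: "\<And>x. x \<in> carrier R \<Longrightarrow> \<pi> x = \<zero>\<^bsub>Q\<^esub> \<longleftrightarrow> N x = 0"
  obtains N' where "rank_ring Q N'" "\<And>x. x \<in> carrier R \<Longrightarrow> N' (\<pi> x) = N x"
proof -
  interpret Q: ring Q by (rule Q)
  interpret \<pi>: ring_hom_ring R Q \<pi> using \<pi> Q ring_axioms by (intro ring_hom_ringI2)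
  have \<pi>_minus: "\<pi> (x \<ominus> y) = \<pi> x \<ominus>\<^bsub>Q\<^esub> \<pi> y" if "x \<in> carrier R" "y \<in> carrier R" for x y
    using that by (simp add: a_minus_def)
  define N' where "N' q = N (SOME x. x \<in> carrier R \<and> \<pi> x = q)" for q
  have N': "N' (\<pi> x) = N x" if x: "x \<in> carrier R" for x
  proof -
    define y where "y = (SOME y. y \<in> carrier R \<and> \<pi> y = \<pi> x)"
    have y: "y \<in> carrier R \<and> \<pi> y = \<pi> x" unfolding y_def by (rule someI[of _ x]) (use x in simp)
    have "\<pi> (y \<ominus> x) = \<zero>\<^bsub>Q\<^esub>" using x y by (simp add: \<pi>_minus Q.minus_eq Q.r_neg)
    then have "N y = N x" using x y ker[of "y \<ominus> x"] N_eq_if_N_diff_zero by simp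
    then show ?thesis by (simp add: N'_def y_def)
  qed
  have lift: "\<exists>x\<in>carrier R. \<pi> x = q" if "q \<in> carrier Q" for q using that surj by (metis imageE)
  have "rank_ring Q N'"
  proof
    show "N' \<zero>\<^bsub>Q\<^esub> = 0" using N'[of \<zero>] by simp
    show "N' \<one>\<^bsub>Q\<^esub> \<noteq> 0" using N'[of \<one>] N_one by simp
  next
    fix p q assume "p \<in> carrier Q" "q \<in> carrier Q"
    then obtain x y where x: "x \<in> carrier R" "p = \<pi> x" and y: "y \<in> carrier R" "q = \<pi> y" using lift by metis
    show "N' (p \<oplus>\<^bsub>Q\<^esub> q) \<le> N' p + N' q" using x y N_add N'[of "x \<oplus> y"] by (simp add: N')
    show "N' (p \<otimes>\<^bsub>Q\<^esub> q) \<le> N' p" using x y N_mult_le_left N'[of "x \<otimes> y"] by (simp add: N')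
    show "N' (p \<otimes>\<^bsub>Q\<^esub> q) \<le> N' q" using x y N_mult_le_right N'[of "x \<otimes> y"] by (simp add: N')
    obtain z where z: "z \<in> carrier R" "min (N x) (N y) \<le> N (x \<otimes> z \<otimes> y)" using N_prime x y by blast
    then show "\<exists>z\<in>carrier Q. min (N' p) (N' q) \<le> N' (p \<otimes>\<^bsub>Q\<^esub> z \<otimes>\<^bsub>Q\<^esub> q)"
      using x y N'[of "x \<otimes> z \<otimes> y"] by (intro bexI[of _ "\<pi> z"]) (simp_all add: N')
  next
    fix p q r assume "p \<in> carrier Q" "q \<in> carrier Q" "r \<in> carrier Q"
    then obtain x y z where "x \<in> carrier R" "p = \<pi> x" "y \<in> carrier R" "q = \<pi> y" "z \<in> carrier R" "r = \<pi> z"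
      using lift by metis
    then show "N' (p \<otimes>\<^bsub>Q\<^esub> q) + N' (q \<otimes>\<^bsub>Q\<^esub> r) \<le> N' q + N' (p \<otimes>\<^bsub>Q\<^esub> q \<otimes>\<^bsub>Q\<^esub> r)"
      using N_frobenius[of x y z] N'[of "x \<otimes> y"] N'[of "y \<otimes> z"] N'[of "x \<otimes> y \<otimes> z"] by (simp add: N')
  next
    fix p assume "p \<in> carrier Q"
    then obtain x where x: "x \<in> carrier R" "p = \<pi> x" using lift by metis
    obtain y where y: "y \<in> carrier R" "x \<otimes> y \<otimes> x = x" using regular x by blast
    have "\<pi> x \<otimes>\<^bsub>Q\<^esub> \<pi> y \<otimes>\<^bsub>Q\<^esub> \<pi> x = \<pi> (x \<otimes> y \<otimes> x)" using x(1) y(1) by simp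
    then show "\<exists>z\<in>carrier Q. p \<otimes>\<^bsub>Q\<^esub> z \<otimes>\<^bsub>Q\<^esub> p = p" using x y by (intro bexI[of _ "\<pi> y"]) simp_all
  next
    fix p assume "p \<in> carrier Q" "N' p = 0"
    then show "p = \<zero>\<^bsub>Q\<^esub>" using lift ker N' by metis
  next
    fix u assume u: "\<And>k::nat. u k \<in> carrier Q" and d: "\<And>k. N' (u (Suc k) \<ominus>\<^bsub>Q\<^esub> u k) \<le> (1/2)^k"
    obtain x where x: "\<And>k. x k \<in> carrier R" "\<And>k. u k = \<pi> (x k)" using lift[OF u] by metis
    have "\<exists>y\<in>carrier R. (\<lambda>k. N (x k \<ominus> y)) \<longlonglongrightarrow> 0"
    proof (rule N_complete)
      fix k show "N (x (Suc k) \<ominus> x k) \<le> (1/2)^k"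
        using d[of k] x N'[of "x (Suc k) \<ominus> x k"] by (simp add: \<pi>_minus)
    qed (rule x)
    then obtain y where y: "y \<in> carrier R" "(\<lambda>k. N (x k \<ominus> y)) \<longlonglongrightarrow> 0" by blast
    have "N' (u k \<ominus>\<^bsub>Q\<^esub> \<pi> y) = N (x k \<ominus> y)" for k using x y N'[of "x k \<ominus> y"] by (simp add: \<pi>_minus)
    then show "\<exists>z\<in>carrier Q. (\<lambda>k. N' (u k \<ominus>\<^bsub>Q\<^esub> z)) \<longlonglongrightarrow> 0" using y by (intro bexI[of _ "\<pi> y"]) simp_all
  qed
  then show ?thesis using that N' by blast
qed

text \<open>Cosets are subsets of the carrier, so an injective code for elements gives one for
  cosets by taking images. Transporting the coset ring along it produces the quotient on a
  prescribed type.\<close>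

lemma rank_ring_quotient_ex:
  fixes enc :: "'a \<Rightarrow> 'c"
  assumes enc: "inj_on enc (carrier R)"
  obtains Q :: "'c set ring" and N' \<pi> where "rank_ring Q N'" "\<pi> \<in> ring_hom R Q"
    "\<And>x. x \<in> carrier R \<Longrightarrow> N' (\<pi> x) = N x"
proof -
  define J where "J = {x \<in> carrier R. N x = 0}"
  interpret J: ideal J R unfolding J_def by (rule ideal_N_zero)
  interpret RJ: ring "R Quot J" by (rule J.quotient_is_ring)
  have sub: "C \<subseteq> carrier R" if "C \<in> carrier (R Quot J)" for C
    using that J.a_rcosets_carrier by (simp add: FactRing_def)
  have inj: "inj_on ((`) enc) (carrier (R Quot J))"
    using sub by (intro inj_onI) (meson enc inj_on_image_eq_iff)
  define Q where "Q = image_ring ((`) enc) (R Quot J)"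
  have iso: "(`) enc \<in> ring_iso (R Quot J) Q" unfolding Q_def by (rule inj_imp_image_ring_iso[OF inj])
  have Q: "ring Q" unfolding Q_def by (rule RJ.inj_imp_image_ring_is_ring[OF inj])
  define \<pi> where "\<pi> = (`) enc \<circ> (+>) J"
  have \<pi>: "\<pi> \<in> ring_hom R Q"
    unfolding \<pi>_def using J.rcos_ring_hom iso by (intro ring_hom_trans) (auto simp: ring_iso_def)
  have cosets: "carrier (R Quot J) = (\<lambda>x. J +> x) ` carrier R"
    by (auto simp: FactRing_def A_RCOSETS_def')
  have surj: "\<pi> ` carrier R = carrier Q"
    by (simp add: \<pi>_def Q_def image_ring_carrier cosets image_comp)
  have ker: "\<pi> x = \<zero>\<^bsub>Q\<^esub> \<longleftrightarrow> N x = 0" if x: "x \<in> carrier R" for x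
  proof -
    have "\<pi> x = \<zero>\<^bsub>Q\<^esub> \<longleftrightarrow> enc ` (J +> x) = enc ` J"
      by (simp add: \<pi>_def Q_def image_ring_zero FactRing_def)
    also have "\<dots> \<longleftrightarrow> J +> x = J"
    proof -
      have "J +> x \<in> carrier (R Quot J)" using x cosets by blast
      then have "J +> x \<subseteq> carrier R" by (rule sub)
      moreover have "J \<subseteq> carrier R" unfolding J_def by blast
      ultimately show ?thesis using inj_on_image_eq_iff[OF enc] by simp
    qed
    also have "\<dots> \<longleftrightarrow> x \<in> J"
    proof
      assume "J +> x = J" then show "x \<in> J" using J.a_rcos_self[OF x] by simp
    next
      assume "x \<in> J" then show "J +> x = J" by (rule J.a_rcos_const)
    qed
    also have "\<dots> \<longleftrightarrow> N x = 0" using x unfolding J_def by blast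
    finally show ?thesis .
  qed
  obtain N' where "rank_ring Q N'" "\<And>x. x \<in> carrier R \<Longrightarrow> N' (\<pi> x) = N x"
    using rank_ring_quotient[OF Q \<pi> surj ker] by blast
  then show ?thesis using that \<pi> by blast
qed

end

section \<open>Permutation models of the group ring\<close>

text \<open>An infinite type contains an injective copy of its own square, so iterated pairing codes
  lists of a fixed length. The length is stored as well, because the iterated code alone can confuse
  lists of different lengths.\<close>

lemma inj_list_ex:
  assumes "infinite (UNIV :: 'a set)"
  obtains e :: "'a list \<Rightarrow> 'a" where "inj e"
proof -
  obtain p :: "'a \<times> 'a \<Rightarrow> 'a" where p: "inj p"
    using card_of_Times_same_infinite[OF assms] unfolding card_of_ordIso[symmetric]
    by (auto simp: bij_betw_def)
  obtain z :: "nat \<Rightarrow> 'a" where z: "inj z" using assms infinite_iff_countable_subset[of "UNIV :: 'a set"] by auto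
  define q where "q = rec_list (z 0) (\<lambda>x xs y. p (x, y))"
  have "xs = ys" if "length xs = length ys" "q xs = q ys" for xs ys
    using that by (induct xs ys rule: list_induct2) (auto simp: q_def dest: injD[OF p])
  then have "inj (\<lambda>xs. p (z (length xs), q xs))"
    by (intro injI) (auto dest!: injD[OF p] dest: injD[OF z])
  then show ?thesis using that by blast
qed

text \<open>The set \<open>Y\<close> has maximal size among the admissible ones. Every other point
  is excluded by a coincidence at that point or by a collision with \<open>Y\<close>; injectivity
  allows at most \<open>2 * card Y\<close> collisions for each \<open>g\<close>, so \<open>Y\<close>
  has size proportional to \<open>n\<close> once coincidences are rare.\<close>

lemma disjoint_translates_ex:
  fixes \<sigma> :: "'g \<Rightarrow> nat \<Rightarrow> nat"
  assumes A: "finite A" "g0 \<in> A" and inj: "\<And>g. g \<in> A \<Longrightarrow> inj_on (\<sigma> g) {..<n}"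
  obtains Y where "Y \<subseteq> {..<n}"
    "\<And>g i k. \<lbrakk>g \<in> A; i \<in> Y; k \<in> Y; \<sigma> g i = \<sigma> g0 k\<rbrakk> \<Longrightarrow> g = g0 \<and> i = k"
    "n \<le> card Y * (1 + 2 * card A) + (\<Sum>g\<in>A - {g0}. card {k\<in>{..<n}. \<sigma> g k = \<sigma> g0 k})"
proof -
  define Q where "Q Y \<longleftrightarrow> Y \<subseteq> {..<n} \<and>
    (\<forall>g\<in>A. \<forall>i\<in>Y. \<forall>k\<in>Y. \<sigma> g i = \<sigma> g0 k \<longrightarrow> g = g0 \<and> i = k)" for Y
  have "Q {}" by (simp add: Q_def)
  moreover have "\<forall>Y. Q Y \<longrightarrow> card Y < Suc n"
    using card_mono[of "{..<n}"] by (fastforce simp: Q_def less_Suc_eq_le)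
  ultimately obtain Y where Y: "Q Y" and max: "\<And>Z. Q Z \<Longrightarrow> card Z \<le> card Y"
    using ex_has_greatest_nat[of Q "{}" card "Suc n"] by blast
  have Yn: "Y \<subseteq> {..<n}" and finY: "finite Y" using Y finite_subset by (auto simp: Q_def)
  \<comment> \<open>The three ways in which \<open>g\<close> prevents adding \<open>k\<close>: a
    clash of \<open>k\<close> with itself, with a member of \<open>Y\<close> in the role of
    \<open>k\<close>, or with a member of \<open>Y\<close> in the role of \<open>i\<close>.\<close>
  define bad where "bad g = {k\<in>{..<n}. \<sigma> g k = \<sigma> g0 k}" for g
  define hit where "hit g = {k\<in>{..<n}. \<sigma> g k \<in> \<sigma> g0 ` Y}" for g
  define hit0 where "hit0 g = {k\<in>{..<n}. \<sigma> g0 k \<in> \<sigma> g ` Y}" for g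
  have "{..<n} \<subseteq> Y \<union> (\<Union>g\<in>A - {g0}. bad g \<union> (hit g \<union> hit0 g))"
  proof (rule subsetI, rule ccontr)
    fix k assume k: "k \<in> {..<n}" and "k \<notin> Y \<union> (\<Union>g\<in>A - {g0}. bad g \<union> (hit g \<union> hit0 g))"
    then have kY: "k \<notin> Y" and no: "\<And>g. \<lbrakk>g \<in> A; g \<noteq> g0\<rbrakk> \<Longrightarrow> k \<notin> bad g \<and> k \<notin> hit g \<and> k \<notin> hit0 g" by auto
    have "card (insert k Y) > card Y" using kY finY by simp
    then have "\<not> Q (insert k Y)" using max[of "insert k Y"] by auto
    then obtain g i j where v: "g \<in> A" "i \<in> insert k Y" "j \<in> insert k Y" "\<sigma> g i = \<sigma> g0 j" "\<not> (g = g0 \<and> i = j)"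
      using k Yn by (auto simp: Q_def)
    \<comment> \<open>For \<open>g = g0\<close> injectivity would give \<open>i = j\<close>, so
      every violation comes from another element of \<open>A\<close>.\<close>
    have "g \<noteq> g0" using v k Yn inj[OF A(2)] by (auto dest: inj_onD)
    then have "i \<noteq> k \<or> j \<noteq> k" "j \<in> Y \<longrightarrow> i \<noteq> k" "i \<in> Y \<longrightarrow> j \<noteq> k"
      using no[OF v(1)] v(4) k imageI[of i Y "\<sigma> g"] imageI[of j Y "\<sigma> g0"]
      by (auto simp: bad_def hit_def hit0_def)
    then have "i \<in> Y" "j \<in> Y" using v(2,3) by auto
    then show False using Y v by (auto simp: Q_def)
  qed
  then have "n \<le> card (Y \<union> (\<Union>g\<in>A - {g0}. bad g \<union> (hit g \<union> hit0 g)))"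
    using card_mono[of "Y \<union> (\<Union>g\<in>A - {g0}. bad g \<union> (hit g \<union> hit0 g))" "{..<n}"] A(1) finY
    by (simp add: bad_def hit_def hit0_def)
  also have "\<dots> \<le> card Y + card (\<Union>g\<in>A - {g0}. bad g \<union> (hit g \<union> hit0 g))" by (rule card_Un_le)
  also have "\<dots> \<le> card Y + (\<Sum>g\<in>A - {g0}. card (bad g \<union> (hit g \<union> hit0 g)))"
    using A(1) by (simp add: card_UN_le)
  also have "\<dots> \<le> card Y + (\<Sum>g\<in>A - {g0}. card (bad g) + 2 * card Y)"
  proof -
    have "card (hit g) \<le> card Y" "card (hit0 g) \<le> card Y" if g: "g \<in> A" for g
    proof -
      have "card (hit g) \<le> card (\<sigma> g0 ` Y)"
        using inj_on_subset[OF inj[OF g], of "hit g"] finY by (intro card_inj_on_le[of "\<sigma> g"]) (auto simp: hit_def)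
      then show "card (hit g) \<le> card Y" using card_image_le[OF finY, of "\<sigma> g0"] by linarith
      have "card (hit0 g) \<le> card (\<sigma> g ` Y)"
        using inj_on_subset[OF inj[OF A(2)], of "hit0 g"] finY
        by (intro card_inj_on_le[of "\<sigma> g0"]) (auto simp: hit0_def)
      then show "card (hit0 g) \<le> card Y" using card_image_le[OF finY, of "\<sigma> g"] by linarith
    qed
    then have "card (bad g \<union> (hit g \<union> hit0 g)) \<le> card (bad g) + 2 * card Y" if "g \<in> A" for g
      using card_Un_le[of "bad g" "hit g \<union> hit0 g"] card_Un_le[of "hit g" "hit0 g"] that by fastforce
    then show ?thesis by (intro add_left_mono sum_mono) auto
  qed
  \<comment> \<open>There are \<open>card A - 1\<close> summands; the bound is rounded up to
    \<open>card A\<close>.\<close>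
  also have "\<dots> \<le> card Y * (1 + 2 * card A) + (\<Sum>g\<in>A - {g0}. card (bad g))"
    using A by (simp add: sum.distrib card_Diff_singleton algebra_simps)
  finally show ?thesis using that[of Y] Y Yn by (auto simp: Q_def bad_def)
qed

lemma (in abelian_monoid) finsum_swap:
  assumes "finite A" "finite B" "\<And>x y. \<lbrakk>x \<in> A; y \<in> B\<rbrakk> \<Longrightarrow> f x y \<in> carrier G"
  shows "(\<Oplus>x\<in>A. \<Oplus>y\<in>B. f x y) = (\<Oplus>y\<in>B. \<Oplus>x\<in>A. f x y)"
  using assms(1,3)
proof (induct A rule: finite_induct)
  case empty
  then show ?case by simp
next
  case (insert a A)
  have "(\<Oplus>x\<in>insert a A. \<Oplus>y\<in>B. f x y) = (\<Oplus>y\<in>B. f a y) \<oplus> (\<Oplus>y\<in>B. \<Oplus>x\<in>A. f x y)"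
    using insert by (subst finsum_insert) (auto intro!: finsum_closed)
  also have "\<dots> = (\<Oplus>y\<in>B. f a y \<oplus> (\<Oplus>x\<in>A. f x y))"
    using insert by (intro finsum_addf[symmetric]) (auto intro!: finsum_closed)
  also have "\<dots> = (\<Oplus>y\<in>B. \<Oplus>x\<in>insert a A. f x y)"
    using insert by (intro finsum_cong') (auto intro!: finsum_closed)
  finally show ?case .
qed

section \<open>Group ring elements as matrices\<close>

locale perm_model = vec_space D n + G: group G
  for D :: "'d ring" (structure) and n :: nat and G :: "'g monoid" +
  fixes \<sigma> :: "'g \<Rightarrow> nat \<Rightarrow> nat"
  assumes \<sigma>_permutes: "g \<in> carrier G \<Longrightarrow> \<sigma> g permutes {..<n}"
begin

definition supp :: "('g \<Rightarrow> 'd) \<Rightarrow> 'g set" where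
  "supp \<alpha> = {g \<in> carrier G. \<alpha> g \<noteq> \<zero>}"

text \<open>The matrix of a group ring element: \<open>g\<close> acts on functions by precomposition with \<open>\<sigma> g\<close>,
  so \<open>\<sigma>\<close> is approximately an anti-homomorphism.\<close>
definition rep :: "('g \<Rightarrow> 'd) \<Rightarrow> (nat \<Rightarrow> 'd) \<Rightarrow> nat \<Rightarrow> 'd" where
  "rep \<alpha> v = (if v \<in> vecs then (\<lambda>k. if k < n then \<Oplus>g\<in>supp \<alpha>. \<alpha> g \<otimes> v (\<sigma> g k) else \<zero>) else vzero)"

lemma \<sigma>_less: "\<lbrakk>g \<in> carrier G; k < n\<rbrakk> \<Longrightarrow> \<sigma> g k < n"
  using permutes_in_image[OF \<sigma>_permutes] by (metis lessThan_iff)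

lemma \<sigma>_inj: "g \<in> carrier G \<Longrightarrow> inj_on (\<sigma> g) S"
  using permutes_inj_on[OF \<sigma>_permutes] .

lemma group_ringD:
  assumes "\<alpha> \<in> carrier (group_ring D G)"
  shows "\<alpha> g \<in> carrier D" "finite (supp \<alpha>)" "supp \<alpha> \<subseteq> carrier G" "g \<notin> supp \<alpha> \<Longrightarrow> \<alpha> g = \<zero>"
  using assms by (cases "g \<in> carrier G"; auto simp: group_ring_def supp_def)+

text \<open>Different group ring elements have different supports; extending their sums to a common
  finite set makes them comparable term by term.\<close>

lemma rep_eq_sum:
  assumes \<alpha>: "\<alpha> \<in> carrier (group_ring D G)" and T: "finite T" "supp \<alpha> \<subseteq> T"
    and v: "v \<in> vecs" and k: "k < n"
  shows "rep \<alpha> v k = (\<Oplus>g\<in>T. \<alpha> g \<otimes> v (\<sigma> g k))"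
proof -
  have "(\<Oplus>g\<in>supp \<alpha>. \<alpha> g \<otimes> v (\<sigma> g k)) = (\<Oplus>g\<in>T. \<alpha> g \<otimes> v (\<sigma> g k))"
    using T v group_ringD[OF \<alpha>] by (intro add.finprod_mono_neutral_cong_left) auto
  then show ?thesis using v k by (simp add: rep_def)
qed

lemma rep_lin: assumes \<alpha>: "\<alpha> \<in> carrier (group_ring D G)" shows "rep \<alpha> \<in> lin"
proof -
  note [simp] = group_ringD[OF \<alpha>]
  have closed: "rep \<alpha> v \<in> vecs" for v
    by (cases "v \<in> vecs") (auto simp: rep_def intro!: vecsI finsum_closed)
  have add: "rep \<alpha> (vadd v w) = vadd (rep \<alpha> v) (rep \<alpha> w)" if "v \<in> vecs" "w \<in> vecs" for v w
  proof (rule ext)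
    fix k
    show "rep \<alpha> (vadd v w) k = vadd (rep \<alpha> v) (rep \<alpha> w) k"
    proof (cases "k < n")
      case True
      have "(\<Oplus>g\<in>supp \<alpha>. \<alpha> g \<otimes> (v (\<sigma> g k) \<oplus> w (\<sigma> g k))) =
          (\<Oplus>g\<in>supp \<alpha>. \<alpha> g \<otimes> v (\<sigma> g k) \<oplus> \<alpha> g \<otimes> w (\<sigma> g k))"
        using that by (intro finsum_cong') (auto simp: r_distr)
      also have "\<dots> = (\<Oplus>g\<in>supp \<alpha>. \<alpha> g \<otimes> v (\<sigma> g k)) \<oplus> (\<Oplus>g\<in>supp \<alpha>. \<alpha> g \<otimes> w (\<sigma> g k))"
        using that by (intro finsum_addf) auto
      finally show ?thesis using True that by (simp add: rep_def vec_apply)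
    qed (use that in \<open>simp add: rep_def vec_apply\<close>)
  qed
  have scale: "rep \<alpha> (vscale v d) = vscale (rep \<alpha> v) d" if "v \<in> vecs" "d \<in> carrier D" for v d
  proof (rule ext)
    fix k
    show "rep \<alpha> (vscale v d) k = vscale (rep \<alpha> v) d k"
    proof (cases "k < n")
      case True
      have "(\<Oplus>g\<in>supp \<alpha>. \<alpha> g \<otimes> (v (\<sigma> g k) \<otimes> d)) = (\<Oplus>g\<in>supp \<alpha>. \<alpha> g \<otimes> v (\<sigma> g k) \<otimes> d)"
        using that by (intro finsum_cong') (auto simp: m_assoc)
      also have "\<dots> = (\<Oplus>g\<in>supp \<alpha>. \<alpha> g \<otimes> v (\<sigma> g k)) \<otimes> d"
        using that by (intro finsum_ldistr[symmetric]) auto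
      finally show ?thesis using True that by (simp add: rep_def vec_apply)
    qed (use that in \<open>simp add: rep_def vec_apply\<close>)
  qed
  show ?thesis using closed add scale by (auto simp: lin_def rep_def)
qed

text \<open>The sum is given by its values rather than by the group ring operation, so that the
  lemma also applies when one summand is a pointwise difference.\<close>

lemma rep_add:
  assumes \<alpha>: "\<alpha> \<in> carrier (group_ring D G)" and \<beta>: "\<beta> \<in> carrier (group_ring D G)"
    and \<gamma>: "\<gamma> \<in> carrier (group_ring D G)" "\<And>g. g \<in> carrier G \<Longrightarrow> \<gamma> g = \<alpha> g \<oplus> \<beta> g"
  shows "rep \<gamma> = ladd (rep \<alpha>) (rep \<beta>)"
proof (intro ext)
  fix v k
  let ?T = "supp \<alpha> \<union> supp \<beta> \<union> supp \<gamma>"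
  have T: "finite ?T" "?T \<subseteq> carrier G" using group_ringD \<alpha> \<beta> \<gamma> by auto
  show "rep \<gamma> v k = ladd (rep \<alpha>) (rep \<beta>) v k"
  proof (cases "v \<in> vecs \<and> k < n")
    case True
    have "(\<Oplus>g\<in>?T. \<gamma> g \<otimes> v (\<sigma> g k)) = (\<Oplus>g\<in>?T. \<alpha> g \<otimes> v (\<sigma> g k) \<oplus> \<beta> g \<otimes> v (\<sigma> g k))"
      using True T(2) group_ringD(1)[OF \<alpha>] group_ringD(1)[OF \<beta>] \<gamma>(2)
      by (intro finsum_cong') (auto simp: l_distr)
    also have "\<dots> = (\<Oplus>g\<in>?T. \<alpha> g \<otimes> v (\<sigma> g k)) \<oplus> (\<Oplus>g\<in>?T. \<beta> g \<otimes> v (\<sigma> g k))"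
      using True group_ringD(1)[OF \<alpha>] group_ringD(1)[OF \<beta>] by (intro finsum_addf) auto
    moreover have "rep \<alpha> v k = (\<Oplus>g\<in>?T. \<alpha> g \<otimes> v (\<sigma> g k))" "rep \<beta> v k = (\<Oplus>g\<in>?T. \<beta> g \<otimes> v (\<sigma> g k))"
      "rep \<gamma> v k = (\<Oplus>g\<in>?T. \<gamma> g \<otimes> v (\<sigma> g k))"
      by (rule rep_eq_sum; use \<alpha> \<beta> \<gamma>(1) T(1) True in blast)+
    ultimately show ?thesis by (simp only: ladd_def vec_apply)
  qed (auto simp: rep_def ladd_def vec_apply)
qed

lemma rep_one:
  assumes v: "v \<in> vecs" and k: "k < n" and one: "\<sigma> \<one>\<^bsub>G\<^esub> k = k"
  shows "rep \<one>\<^bsub>group_ring D G\<^esub> v k = v k"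
proof -
  have "supp \<one>\<^bsub>group_ring D G\<^esub> = {\<one>\<^bsub>G\<^esub>}" using nontrivial by (auto simp: supp_def group_ring_def)
  then show ?thesis using v k one by (simp add: rep_def group_ring_def)
qed

lemma group_ring_mult_apply:
  assumes "x \<in> carrier G"
  shows "(\<alpha> \<otimes>\<^bsub>group_ring D G\<^esub> \<beta>) x = (\<Oplus>g\<in>supp \<alpha>. \<alpha> g \<otimes> \<beta> (inv\<^bsub>G\<^esub> g \<otimes>\<^bsub>G\<^esub> x))"
  using assms by (simp add: group_ring_def supp_def)

lemma supp_mult:
  assumes \<alpha>: "\<alpha> \<in> carrier (group_ring D G)" and \<beta>: "\<beta> \<in> carrier (group_ring D G)"
  shows "supp (\<alpha> \<otimes>\<^bsub>group_ring D G\<^esub> \<beta>) \<subseteq> (\<lambda>(g, h). g \<otimes>\<^bsub>G\<^esub> h) ` (supp \<alpha> \<times> supp \<beta>)"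
proof
  fix x assume "x \<in> supp (\<alpha> \<otimes>\<^bsub>group_ring D G\<^esub> \<beta>)"
  then have x: "x \<in> carrier G" "(\<Oplus>g\<in>supp \<alpha>. \<alpha> g \<otimes> \<beta> (inv\<^bsub>G\<^esub> g \<otimes>\<^bsub>G\<^esub> x)) \<noteq> \<zero>"
    by (auto simp: supp_def[of "_ \<otimes>\<^bsub>_\<^esub> _"] group_ring_mult_apply)
  have "\<exists>g\<in>supp \<alpha>. inv\<^bsub>G\<^esub> g \<otimes>\<^bsub>G\<^esub> x \<in> supp \<beta>"
  proof (rule ccontr)
    assume "\<not> ?thesis"
    then have "(\<Oplus>g\<in>supp \<alpha>. \<alpha> g \<otimes> \<beta> (inv\<^bsub>G\<^esub> g \<otimes>\<^bsub>G\<^esub> x)) = (\<Oplus>g\<in>supp \<alpha>. \<zero>)"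
      using group_ringD[OF \<alpha>] group_ringD[OF \<beta>] by (intro finsum_cong') auto
    then show False using x(2) by simp
  qed
  then obtain g where g: "g \<in> supp \<alpha>" "inv\<^bsub>G\<^esub> g \<otimes>\<^bsub>G\<^esub> x \<in> supp \<beta>" by blast
  have "x = g \<otimes>\<^bsub>G\<^esub> (inv\<^bsub>G\<^esub> g \<otimes>\<^bsub>G\<^esub> x)"
    using g(1) x(1) group_ringD(3)[OF \<alpha>] G.m_assoc[of g "inv\<^bsub>G\<^esub> g" x] by auto
  then show "x \<in> (\<lambda>(g, h). g \<otimes>\<^bsub>G\<^esub> h) ` (supp \<alpha> \<times> supp \<beta>)" using g by force
qed

lemma group_ring_mult_closed:
  assumes \<alpha>: "\<alpha> \<in> carrier (group_ring D G)" and \<beta>: "\<beta> \<in> carrier (group_ring D G)"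
  shows "\<alpha> \<otimes>\<^bsub>group_ring D G\<^esub> \<beta> \<in> carrier (group_ring D G)"
proof -
  let ?\<gamma> = "\<alpha> \<otimes>\<^bsub>group_ring D G\<^esub> \<beta>"
  have "finite (supp ?\<gamma>)"
    using supp_mult[OF \<alpha> \<beta>] group_ringD(2)[OF \<alpha>] group_ringD(2)[OF \<beta>] finite_subset by blast
  moreover have "?\<gamma> x \<in> carrier D" if "x \<in> carrier G" for x
    using that group_ringD(1)[OF \<alpha>] group_ringD(1)[OF \<beta>]
    by (auto simp: group_ring_mult_apply intro!: finsum_closed)
  moreover have "?\<gamma> x = \<zero>" if "x \<notin> carrier G" for x using that by (simp add: group_ring_def)
  ultimately show ?thesis by (simp add: group_ring_def supp_def)
qed

text \<open>Multiplicativity is proved row by row: expanding the right side at row \<open>k\<close>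
  gives the terms \<open>v (\<sigma> h (\<sigma> g k))\<close>, so only the behaviour of
  \<open>\<sigma>\<close> at \<open>k\<close> on the finitely many products of support elements
  matters. These products may coincide, whence the interchange of sums and the reindexing for each
  fixed \<open>g\<close>.\<close>

lemma rep_mult:
  assumes \<alpha>: "\<alpha> \<in> carrier (group_ring D G)" and \<beta>: "\<beta> \<in> carrier (group_ring D G)"
    and v: "v \<in> vecs" and k: "k < n"
    and good: "\<And>g h. \<lbrakk>g \<in> supp \<alpha>; h \<in> supp \<beta>\<rbrakk> \<Longrightarrow> \<sigma> (g \<otimes>\<^bsub>G\<^esub> h) k = \<sigma> h (\<sigma> g k)"
  shows "rep (\<alpha> \<otimes>\<^bsub>group_ring D G\<^esub> \<beta>) v k = rep \<alpha> (rep \<beta> v) k"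
proof -
  note D = group_ringD[OF \<alpha>] group_ringD[OF \<beta>]
  let ?T = "(\<lambda>(g, h). g \<otimes>\<^bsub>G\<^esub> h) ` (supp \<alpha> \<times> supp \<beta>)"
  have T: "finite ?T" "?T \<subseteq> carrier G" using D by auto
  have inner: "(\<Oplus>x\<in>?T. \<alpha> g \<otimes> \<beta> (inv\<^bsub>G\<^esub> g \<otimes>\<^bsub>G\<^esub> x) \<otimes> v (\<sigma> x k)) = \<alpha> g \<otimes> rep \<beta> v (\<sigma> g k)"
    if g: "g \<in> supp \<alpha>" for g
  proof -
    have gG: "g \<in> carrier G" using g D by auto
    let ?f = "\<lambda>x. \<alpha> g \<otimes> \<beta> (inv\<^bsub>G\<^esub> g \<otimes>\<^bsub>G\<^esub> x) \<otimes> v (\<sigma> x k)"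
    let ?m = "\<lambda>h. g \<otimes>\<^bsub>G\<^esub> h"
    have cancel: "inv\<^bsub>G\<^esub> g \<otimes>\<^bsub>G\<^esub> (g \<otimes>\<^bsub>G\<^esub> h) = h" if "h \<in> carrier G" for h
      using that gG G.m_assoc[of "inv\<^bsub>G\<^esub> g" g h] by simp
    have "(\<Oplus>x\<in>?T. ?f x) = (\<Oplus>x\<in>?m ` supp \<beta>. ?f x)"
    proof (rule add.finprod_mono_neutral_cong_right)
      show "finite ?T" by (rule T)
      show "?m ` supp \<beta> \<subseteq> ?T" using g by auto
      fix x assume x: "x \<in> ?T - ?m ` supp \<beta>"
      then have xG: "x \<in> carrier G" using T by auto
      have "inv\<^bsub>G\<^esub> g \<otimes>\<^bsub>G\<^esub> x \<notin> supp \<beta>"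
      proof
        assume "inv\<^bsub>G\<^esub> g \<otimes>\<^bsub>G\<^esub> x \<in> supp \<beta>"
        then have "?m (inv\<^bsub>G\<^esub> g \<otimes>\<^bsub>G\<^esub> x) \<in> ?m ` supp \<beta>" by blast
        moreover have "?m (inv\<^bsub>G\<^esub> g \<otimes>\<^bsub>G\<^esub> x) = x" using gG xG G.m_assoc[of g "inv\<^bsub>G\<^esub> g" x] by simp
        ultimately show False using x by simp
      qed
      then show "?f x = \<zero>" using D v by simp
    qed (use D v in auto)
    also have "\<dots> = (\<Oplus>h\<in>supp \<beta>. ?f (?m h))"
    proof (rule finsum_reindex)
      show "inj_on ?m (supp \<beta>)" using cancel D(7) by (intro inj_onI) (metis subsetD)
    qed (use D v in auto)
    also have "\<dots> = (\<Oplus>h\<in>supp \<beta>. \<alpha> g \<otimes> (\<beta> h \<otimes> v (\<sigma> h (\<sigma> g k))))"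
    proof (rule finsum_cong')
      fix h assume h: "h \<in> supp \<beta>"
      then have "h \<in> carrier G" using D by auto
      then show "?f (?m h) = \<alpha> g \<otimes> (\<beta> h \<otimes> v (\<sigma> h (\<sigma> g k)))"
        using cancel good[OF g h] D v by (simp add: m_assoc)
    qed (use D v in auto)
    also have "\<dots> = \<alpha> g \<otimes> (\<Oplus>h\<in>supp \<beta>. \<beta> h \<otimes> v (\<sigma> h (\<sigma> g k)))"
      using D v by (intro finsum_rdistr[symmetric]) auto
    also have "(\<Oplus>h\<in>supp \<beta>. \<beta> h \<otimes> v (\<sigma> h (\<sigma> g k))) = rep \<beta> v (\<sigma> g k)"
      using v k gG by (simp add: rep_def \<sigma>_less)
    finally show ?thesis .
  qed
  have "rep (\<alpha> \<otimes>\<^bsub>group_ring D G\<^esub> \<beta>) v k = (\<Oplus>x\<in>?T. (\<alpha> \<otimes>\<^bsub>group_ring D G\<^esub> \<beta>) x \<otimes> v (\<sigma> x k))"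
    by (rule rep_eq_sum[OF group_ring_mult_closed[OF \<alpha> \<beta>] T(1) supp_mult[OF \<alpha> \<beta>] v k])
  also have "\<dots> = (\<Oplus>x\<in>?T. \<Oplus>g\<in>supp \<alpha>. \<alpha> g \<otimes> \<beta> (inv\<^bsub>G\<^esub> g \<otimes>\<^bsub>G\<^esub> x) \<otimes> v (\<sigma> x k))"
  proof (rule finsum_cong')
    fix x assume "x \<in> ?T"
    then have "x \<in> carrier G" using T by auto
    then show "(\<alpha> \<otimes>\<^bsub>group_ring D G\<^esub> \<beta>) x \<otimes> v (\<sigma> x k) =
        (\<Oplus>g\<in>supp \<alpha>. \<alpha> g \<otimes> \<beta> (inv\<^bsub>G\<^esub> g \<otimes>\<^bsub>G\<^esub> x) \<otimes> v (\<sigma> x k))"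
      using D v by (subst group_ring_mult_apply, simp, subst finsum_ldistr) auto
  qed (use D v in \<open>auto intro!: finsum_closed\<close>)
  also have "\<dots> = (\<Oplus>g\<in>supp \<alpha>. \<Oplus>x\<in>?T. \<alpha> g \<otimes> \<beta> (inv\<^bsub>G\<^esub> g \<otimes>\<^bsub>G\<^esub> x) \<otimes> v (\<sigma> x k))"
    using D v T(1) by (intro finsum_swap) auto
  also have "\<dots> = (\<Oplus>g\<in>supp \<alpha>. \<alpha> g \<otimes> rep \<beta> v (\<sigma> g k))"
    using inner D linD(1)[OF rep_lin[OF \<beta>]] by (intro finsum_cong') auto
  also have "\<dots> = rep \<alpha> (rep \<beta> v) k"
    using k linD(1)[OF rep_lin[OF \<beta>]] by (simp add: rep_def[of \<alpha>])
  finally show ?thesis .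
qed

text \<open>Rows \<open>Y\<close> and columns \<open>\<sigma> g0\<close> applied to \<open>Y\<close>
  cut out a diagonal block all of whose diagonal entries equal \<open>\<alpha> g0\<close>: no other
  support element can send a row of \<open>Y\<close> to one of these columns.\<close>

lemma rep_rank_lower:
  assumes \<alpha>: "\<alpha> \<in> carrier (group_ring D G)" and g0: "g0 \<in> supp \<alpha>"
  shows "n \<le> rk (rep \<alpha>) * (1 + 2 * card (supp \<alpha>)) +
    (\<Sum>g\<in>supp \<alpha> - {g0}. card {k\<in>{..<n}. \<sigma> g k = \<sigma> g0 k})"
proof -
  note D = group_ringD[OF \<alpha>]
  have inj: "inj_on (\<sigma> g) {..<n}" if "g \<in> supp \<alpha>" for g using \<sigma>_inj D(3) that by blast
  obtain Y where Y: "Y \<subseteq> {..<n}"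
    "\<And>g i k. \<lbrakk>g \<in> supp \<alpha>; i \<in> Y; k \<in> Y; \<sigma> g i = \<sigma> g0 k\<rbrakk> \<Longrightarrow> g = g0 \<and> i = k"
    "n \<le> card Y * (1 + 2 * card (supp \<alpha>)) + (\<Sum>g\<in>supp \<alpha> - {g0}. card {k\<in>{..<n}. \<sigma> g k = \<sigma> g0 k})"
    by (rule disjoint_translates_ex[where \<sigma>=\<sigma> and n=n, OF D(2) g0 inj]) (assumption | rule that)+
  have "card Y \<le> rk (rep \<alpha>)"
  proof (rule card_le_rk[OF rep_lin[OF \<alpha>] Y(1)])
    fix k assume k: "k \<in> Y"
    have "\<alpha> g0 \<noteq> \<zero>" using g0 by (simp add: supp_def)
    then obtain c where c: "c \<in> carrier D" "\<alpha> g0 \<otimes> c = \<one>" using inverse_ex D(1) by metis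
    have g0G: "g0 \<in> carrier G" using g0 D by auto
    \<comment> \<open>The column of \<open>k\<close> carrying the inverse of the diagonal entry;
      within the rows of \<open>Y\<close> its image is the unit vector at \<open>k\<close>.\<close>
    define v where "v = (\<lambda>m. if m = \<sigma> g0 k then c else \<zero>)"
    have v: "v \<in> vecs" using c \<sigma>_less[OF g0G, of k] k Y(1) by (auto simp: v_def intro!: vecsI)
    have "rep \<alpha> v i = vunit k i" if i: "i \<in> Y" for i
    proof -
      have "rep \<alpha> v i = (\<Oplus>g\<in>supp \<alpha>. \<alpha> g \<otimes> v (\<sigma> g i))"
        using v i Y(1) by (auto simp: rep_def)
      also have "\<dots> = (\<Oplus>g\<in>supp \<alpha>. if g0 = g then vunit k i else \<zero>)"
      proof (rule finsum_cong')
        fix g assume g: "g \<in> supp \<alpha>"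
        show "\<alpha> g \<otimes> v (\<sigma> g i) = (if g0 = g then vunit k i else \<zero>)"
        proof (cases "\<sigma> g i = \<sigma> g0 k")
          case True
          then have "g = g0" "i = k" using Y(2)[OF g i k] by auto
          then show ?thesis using c(2) by (simp add: v_def vunit_def)
        next
          case False
          then have "\<not> (g0 = g \<and> i = k)" by auto
          then show ?thesis using False D(1) by (auto simp: v_def vunit_def)
        qed
      qed (auto simp: vunit_def)
      also have "\<dots> = vunit k i"
        using g0 D(2) by (intro add.finprod_singleton[where f="\<lambda>_. vunit k i"]) (auto simp: vunit_def)
      finally show ?thesis .
    qed
    then show "\<exists>v\<in>vecs. \<forall>i\<in>Y. rep \<alpha> v i = vunit k i" using v by blast
  qed
  then have "card Y * (1 + 2 * card (supp \<alpha>)) \<le> rk (rep \<alpha>) * (1 + 2 * card (supp \<alpha>))"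
    by (rule mult_le_mono1)
  then show ?thesis using Y(3) by linarith
qed

end

section \<open>The sofic ultraproduct\<close>

text \<open>A list supplies both a finite set, through its members, and a tolerance, through its
  length. Repetitions let the length grow even when the group is finite, so one filter makes the
  sets exhaust the group and the tolerances tend to zero.\<close>

lemma sofic_approximation_ex:
  fixes G :: "'g monoid"
  assumes G: "group G" and sofic: "sofic_group G"
  obtains n :: "'g list \<Rightarrow> nat" and \<sigma> and U :: "'g list filter" where
    "U \<noteq> bot" "\<And>P. eventually P U \<or> eventually (\<lambda>x. \<not> P x) U" "\<And>i. 0 < n i"
    "\<And>i g. g \<in> carrier G \<Longrightarrow> \<sigma> i g permutes {..<n i}"
    "\<And>g h. \<lbrakk>g \<in> carrier G; h \<in> carrier G\<rbrakk> \<Longrightarrow>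
      ((\<lambda>i. real (card {k\<in>{..<n i}. \<sigma> i (g \<otimes>\<^bsub>G\<^esub> h) k \<noteq> \<sigma> i h (\<sigma> i g k)}) / real (n i)) \<longlongrightarrow> 0) U"
    "\<And>g. \<lbrakk>g \<in> carrier G; g \<noteq> \<one>\<^bsub>G\<^esub>\<rbrakk> \<Longrightarrow>
      ((\<lambda>i. real (card {k\<in>{..<n i}. \<sigma> i g k = k}) / real (n i)) \<longlongrightarrow> 0) U"
proof -
  interpret G: group G by (rule G)
  define \<epsilon> where "\<epsilon> i = inverse (real (Suc (length i)))" for i :: "'g list"
  define F where "F i = set i \<inter> carrier G" for i
  have "\<forall>i. \<exists>m \<phi>. 0 < m \<and> (\<forall>g\<in>carrier G. \<phi> g permutes {..<m}) \<and>
      (\<forall>g\<in>F i. \<forall>h\<in>F i. hamming_dist m (\<phi> (g \<otimes>\<^bsub>G\<^esub> h)) (\<phi> g \<circ> \<phi> h) < \<epsilon> i) \<and>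
      (\<forall>g\<in>F i. g \<noteq> \<one>\<^bsub>G\<^esub> \<longrightarrow> hamming_dist m (\<phi> g) id > 1 - \<epsilon> i)"
  proof
    fix i
    have "F i \<subseteq> carrier G \<and> finite (F i) \<and> 0 < \<epsilon> i" by (auto simp: F_def \<epsilon>_def)
    from sofic[unfolded sofic_group_def, rule_format, OF this]
    show "\<exists>m \<phi>. 0 < m \<and> (\<forall>g\<in>carrier G. \<phi> g permutes {..<m}) \<and>
      (\<forall>g\<in>F i. \<forall>h\<in>F i. hamming_dist m (\<phi> (g \<otimes>\<^bsub>G\<^esub> h)) (\<phi> g \<circ> \<phi> h) < \<epsilon> i) \<and>
      (\<forall>g\<in>F i. g \<noteq> \<one>\<^bsub>G\<^esub> \<longrightarrow> hamming_dist m (\<phi> g) id > 1 - \<epsilon> i)" by blast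
  qed
  then obtain n \<phi> where n: "\<And>i. 0 < n i" and perm: "\<And>i g. g \<in> carrier G \<Longrightarrow> \<phi> i g permutes {..<n i}"
    and hom: "\<And>i g h. \<lbrakk>g \<in> F i; h \<in> F i\<rbrakk> \<Longrightarrow> hamming_dist (n i) (\<phi> i (g \<otimes>\<^bsub>G\<^esub> h)) (\<phi> i g \<circ> \<phi> i h) < \<epsilon> i"
    and free: "\<And>i g. \<lbrakk>g \<in> F i; g \<noteq> \<one>\<^bsub>G\<^esub>\<rbrakk> \<Longrightarrow> hamming_dist (n i) (\<phi> i g) id > 1 - \<epsilon> i"
    by metis
  \<comment> \<open>The lists demanding at least as much as \<open>j\<close>, in set and in
    tolerance. Appending two lists gives a common refinement, so these sets generate a proper
    filter.\<close>
  define B where "B j = {i. set j \<subseteq> set i \<and> length j \<le> length i}" for j :: "'g list"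
  define F0 where "F0 = (INF j. principal (B j))"
  have ev: "eventually P F0 \<longleftrightarrow> (\<exists>j\<in>UNIV. eventually P (principal (B j)))" for P
    unfolding F0_def
  proof (rule eventually_INF_base)
    fix a b :: "'g list"
    have "B (a @ b) \<subseteq> B a \<inter> B b" by (auto simp: B_def)
    then show "\<exists>x\<in>UNIV. principal (B x) \<le> inf (principal (B a)) (principal (B b))" by auto
  qed simp
  have "j \<in> B j" for j by (simp add: B_def)
  then have "F0 \<noteq> bot" by (auto simp: trivial_limit_def ev eventually_principal)
  then obtain U where U: "U \<le> F0" "U \<noteq> bot" "\<And>P. eventually P U \<or> eventually (\<lambda>x. \<not> P x) U"
    using ultrafilter_ex by blast
  have evB: "eventually (\<lambda>i. i \<in> B j) U" for j
    using ev U(1) by (auto intro!: filter_leD[OF U(1)] exI[of _ j] simp: eventually_principal)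
  have evF: "eventually (\<lambda>i. g \<in> F i) U" if "g \<in> carrier G" for g
    using evB[of "[g]"] by (rule eventually_mono) (use that in \<open>auto simp: B_def F_def\<close>)
  have "filterlim length at_top U"
    unfolding filterlim_at_top
  proof
    fix k
    show "eventually (\<lambda>i. k \<le> length i) U"
      \<comment> \<open>Any list of length \<open>k\<close> serves here.\<close>
      using evB[of "replicate k undefined"] by (rule eventually_mono) (simp add: B_def)
  qed
  then have \<epsilon>0: "(\<epsilon> \<longlongrightarrow> 0) U"
    unfolding \<epsilon>_def by (rule filterlim_compose[OF LIMSEQ_inverse_real_of_nat])
  have squeeze: "(f \<longlongrightarrow> 0) U" if "\<And>i. 0 \<le> f i" "eventually (\<lambda>i. f i \<le> \<epsilon> i) U" for f
    using that by (intro tendsto_sandwich[OF _ that(2) tendsto_const \<epsilon>0]) simp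
  \<comment> \<open>Inversion reverses the order of products: the image of
    \<open>(g h)\<inverse> = h\<inverse> g\<inverse>\<close> is almost
    \<open>\<sigma> i h \<circ> \<sigma> i g\<close>, the order required by precomposition on
    vectors.\<close>
  define \<sigma> where "\<sigma> i g = \<phi> i (inv\<^bsub>G\<^esub> g)" for i g
  show ?thesis
  proof (rule that[OF U(2,3) n, where \<sigma>=\<sigma>])
    fix i g assume "g \<in> carrier G"
    then show "\<sigma> i g permutes {..<n i}" by (simp add: \<sigma>_def perm)
  next
    fix g h assume g: "g \<in> carrier G" and h: "h \<in> carrier G"
    have "eventually (\<lambda>i. inv\<^bsub>G\<^esub> g \<in> F i \<and> inv\<^bsub>G\<^esub> h \<in> F i) U"
      using evF[of "inv\<^bsub>G\<^esub> g"] evF[of "inv\<^bsub>G\<^esub> h"] g h by (simp add: eventually_conj_iff)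
    then have "eventually (\<lambda>i. real (card {k\<in>{..<n i}. \<sigma> i (g \<otimes>\<^bsub>G\<^esub> h) k \<noteq> \<sigma> i h (\<sigma> i g k)}) / real (n i) \<le> \<epsilon> i) U"
    proof (rule eventually_mono)
      fix i assume i: "inv\<^bsub>G\<^esub> g \<in> F i \<and> inv\<^bsub>G\<^esub> h \<in> F i"
      then show "real (card {k\<in>{..<n i}. \<sigma> i (g \<otimes>\<^bsub>G\<^esub> h) k \<noteq> \<sigma> i h (\<sigma> i g k)}) / real (n i) \<le> \<epsilon> i"
        using hom[of "inv\<^bsub>G\<^esub> h" i "inv\<^bsub>G\<^esub> g"] g h by (simp add: hamming_dist_def \<sigma>_def G.inv_mult_group)
    qed
    then show "((\<lambda>i. real (card {k\<in>{..<n i}. \<sigma> i (g \<otimes>\<^bsub>G\<^esub> h) k \<noteq> \<sigma> i h (\<sigma> i g k)}) / real (n i)) \<longlongrightarrow> 0) U"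
      by (intro squeeze) auto
  next
    fix g assume g: "g \<in> carrier G" "g \<noteq> \<one>\<^bsub>G\<^esub>"
    then have g': "inv\<^bsub>G\<^esub> g \<in> carrier G" "inv\<^bsub>G\<^esub> g \<noteq> \<one>\<^bsub>G\<^esub>" using G.inv_eq_1_iff by auto
    have "eventually (\<lambda>i. real (card {k\<in>{..<n i}. \<sigma> i g k = k}) / real (n i) \<le> \<epsilon> i) U"
      using evF[OF g'(1)]
    proof (rule eventually_mono)
      fix i assume "inv\<^bsub>G\<^esub> g \<in> F i"
      then have *: "1 - \<epsilon> i < real (card {k\<in>{..<n i}. \<sigma> i g k \<noteq> k}) / real (n i)"
        using free[of "inv\<^bsub>G\<^esub> g" i] g' by (simp add: hamming_dist_def \<sigma>_def)
      have split: "{k\<in>{..<n i}. \<sigma> i g k = k} \<union> {k\<in>{..<n i}. \<sigma> i g k \<noteq> k} = {..<n i}" by blast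
      have "card {k\<in>{..<n i}. \<sigma> i g k = k} + card {k\<in>{..<n i}. \<sigma> i g k \<noteq> k} = card {..<n i}"
        using card_Un_disjoint[of "{k\<in>{..<n i}. \<sigma> i g k = k}" "{k\<in>{..<n i}. \<sigma> i g k \<noteq> k}"]
        unfolding split by fastforce
      then have "real (card {k\<in>{..<n i}. \<sigma> i g k = k}) + real (card {k\<in>{..<n i}. \<sigma> i g k \<noteq> k}) = real (n i)"
        by (simp flip: of_nat_add)
      then have "real (card {k\<in>{..<n i}. \<sigma> i g k = k}) / real (n i) +
          real (card {k\<in>{..<n i}. \<sigma> i g k \<noteq> k}) / real (n i) = 1"
        using n[of i] by (simp add: add_divide_distrib[symmetric])
      then show "real (card {k\<in>{..<n i}. \<sigma> i g k = k}) / real (n i) \<le> \<epsilon> i" using * by linarith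
    qed
    then show "((\<lambda>i. real (card {k\<in>{..<n i}. \<sigma> i g k = k}) / real (n i)) \<longlongrightarrow> 0) U"
      by (intro squeeze) auto
  qed
qed

section \<open>The matrix families in the ultraproduct\<close>

locale sofic_model = G: group G for G :: "'g monoid" +
  fixes D :: "'d ring" and n :: "'i \<Rightarrow> nat" and \<sigma> :: "'i \<Rightarrow> 'g \<Rightarrow> nat \<Rightarrow> nat" and U :: "'i filter"
  assumes D: "division_ring D"
    and U_nonbot: "U \<noteq> bot" and U_ultra: "\<And>P. eventually P U \<or> eventually (\<lambda>x. \<not> P x) U"
    and n_pos: "\<And>i. 0 < n i"
    and permutes: "\<And>i g. g \<in> carrier G \<Longrightarrow> \<sigma> i g permutes {..<n i}"
    and almost_hom: "\<And>g h. \<lbrakk>g \<in> carrier G; h \<in> carrier G\<rbrakk> \<Longrightarrow>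
      ((\<lambda>i. real (card {k\<in>{..<n i}. \<sigma> i (g \<otimes>\<^bsub>G\<^esub> h) k \<noteq> \<sigma> i h (\<sigma> i g k)}) / real (n i)) \<longlongrightarrow> 0) U"
    and almost_free: "\<And>g. \<lbrakk>g \<in> carrier G; g \<noteq> \<one>\<^bsub>G\<^esub>\<rbrakk> \<Longrightarrow>
      ((\<lambda>i. real (card {k\<in>{..<n i}. \<sigma> i g k = k}) / real (n i)) \<longlongrightarrow> 0) U"
begin

sublocale M: perm_model D "n i" G "\<sigma> i" for i
proof -
  interpret ring D using D by (simp add: division_ring_def)
  show "perm_model D (n i) G (\<sigma> i)"
    using D permutes by unfold_locales (auto simp: division_ring_def)
qed

sublocale UP: rank_ultraproduct "\<lambda>i. vec_space.lin_ring D (n i)"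
  "\<lambda>i f. real (vec_space.rk D (n i) f) / real (n i)" U
  using M.pseudo_rank_ring_lin_ring[OF n_pos] U_nonbot U_ultra n_pos
  by (intro rank_ultraproduct.intro) (simp_all add: M.rk_lone)

abbreviation P where "P \<equiv> prod_ring (\<lambda>i. vec_space.lin_ring D (n i))"

abbreviation DG where "DG \<equiv> group_ring D G"

abbreviation supp where "supp \<equiv> perm_model.supp D G"

definition Rep :: "('g \<Rightarrow> 'd) \<Rightarrow> 'i \<Rightarrow> (nat \<Rightarrow> 'd) \<Rightarrow> nat \<Rightarrow> 'd" where
  "Rep \<alpha> i = perm_model.rep D (n i) G (\<sigma> i) \<alpha>"

lemma Rep_closed: "\<alpha> \<in> carrier DG \<Longrightarrow> Rep \<alpha> \<in> carrier P"
  by (simp add: Rep_def M.rep_lin)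

text \<open>Two families agreeing outside rows of vanishing density become equal in the quotient,
  since the number of disagreeing rows bounds the rank of the difference.\<close>

lemma ulim_diff_eq_zero:
  assumes f: "f \<in> carrier P" and g: "g \<in> carrier P"
    and B: "((\<lambda>i. real (card (B i)) / real (n i)) \<longlongrightarrow> 0) U" "\<And>i. finite (B i)"
    and eq: "\<And>i v k. \<lbrakk>v \<in> vec_space.vecs D (n i); k < n i; k \<notin> B i\<rbrakk> \<Longrightarrow> f i v k = g i v k"
  shows "UP.ulim (f \<ominus>\<^bsub>P\<^esub> g) = 0"
proof (rule antisym)
  have fg: "f \<ominus>\<^bsub>P\<^esub> g \<in> carrier P" by (intro UP.P.minus_closed f g)
  show "UP.ulim (f \<ominus>\<^bsub>P\<^esub> g) \<le> 0"
  proof (rule UP.ulim_le[OF fg B(1)])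
    fix i
    have "vec_space.rk D (n i) (f i \<ominus>\<^bsub>vec_space.lin_ring D (n i)\<^esub> g i) \<le> card (B i)"
      using f g B(2) eq by (intro M.rk_diff_le_card) auto
    then show "real (vec_space.rk D (n i) ((f \<ominus>\<^bsub>P\<^esub> g) i)) / real (n i) \<le> real (card (B i)) / real (n i)"
      by (simp add: UP.P_minus[OF f g] divide_right_mono)
  qed
  show "0 \<le> UP.ulim (f \<ominus>\<^bsub>P\<^esub> g)" by (rule UP.ulim_ge[OF fg tendsto_const]) simp
qed

text \<open>Approximate multiplicativity at the pair of identities says that
  \<open>\<sigma> i \<one>\<close> almost equals its own square. As it is injective, it therefore
  fixes almost all points.\<close>

lemma Rep_one: "UP.ulim (Rep \<one>\<^bsub>DG\<^esub> \<ominus>\<^bsub>P\<^esub> \<one>\<^bsub>P\<^esub>) = 0"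
proof (rule ulim_diff_eq_zero)
  have one: "\<one>\<^bsub>DG\<^esub> \<in> carrier DG"
    by (auto simp: group_ring_def intro: finite_subset[of _ "{\<one>\<^bsub>G\<^esub>}"])
  show "Rep \<one>\<^bsub>DG\<^esub> \<in> carrier P" using Rep_closed[OF one] .
  show "\<one>\<^bsub>P\<^esub> \<in> carrier P" by (rule UP.P.one_closed)
  have inj: "inj (\<sigma> i \<one>\<^bsub>G\<^esub>)" for i using permutes_inj[OF permutes] by simp
  show "((\<lambda>i. real (card {k\<in>{..<n i}. \<sigma> i \<one>\<^bsub>G\<^esub> k \<noteq> k}) / real (n i)) \<longlongrightarrow> 0) U"
    using almost_hom[of "\<one>\<^bsub>G\<^esub>" "\<one>\<^bsub>G\<^esub>"] by (simp add: inj_eq[OF inj] eq_commute)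
  show "finite {k\<in>{..<n i}. \<sigma> i \<one>\<^bsub>G\<^esub> k \<noteq> k}" for i by simp
  fix i v k assume "v \<in> vec_space.vecs D (n i)" "k < n i" "k \<notin> {k\<in>{..<n i}. \<sigma> i \<one>\<^bsub>G\<^esub> k \<noteq> k}"
  then show "Rep \<one>\<^bsub>DG\<^esub> i v k = \<one>\<^bsub>P\<^esub> i v k"
    by (simp add: Rep_def M.rep_one M.lone_def)
qed

text \<open>By \<open>rep_mult\<close> the exceptional rows are those where some pair of support
  elements violates the product rule; they form a finite union of sets of vanishing density.\<close>

lemma Rep_mult:
  assumes \<alpha>: "\<alpha> \<in> carrier DG" and \<beta>: "\<beta> \<in> carrier DG"
  shows "UP.ulim (Rep (\<alpha> \<otimes>\<^bsub>DG\<^esub> \<beta>) \<ominus>\<^bsub>P\<^esub> Rep \<alpha> \<otimes>\<^bsub>P\<^esub> Rep \<beta>) = 0"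
proof -
  define bad where "bad i = (\<lambda>(g, h). {k\<in>{..<n i}. \<sigma> i (g \<otimes>\<^bsub>G\<^esub> h) k \<noteq> \<sigma> i h (\<sigma> i g k)})" for i
  let ?S = "supp \<alpha> \<times> supp \<beta>"
  have S: "finite ?S" "?S \<subseteq> carrier G \<times> carrier G" using M.group_ringD[OF \<alpha>] M.group_ringD[OF \<beta>] by auto
  show ?thesis
  proof (rule ulim_diff_eq_zero)
    show "Rep (\<alpha> \<otimes>\<^bsub>DG\<^esub> \<beta>) \<in> carrier P" by (intro Rep_closed M.group_ring_mult_closed \<alpha> \<beta>)
    show "Rep \<alpha> \<otimes>\<^bsub>P\<^esub> Rep \<beta> \<in> carrier P" by (intro UP.P.m_closed Rep_closed \<alpha> \<beta>)
    have "((\<lambda>i. \<Sum>x\<in>?S. real (card (bad i x)) / real (n i)) \<longlongrightarrow> (\<Sum>x\<in>?S. 0)) U"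
      using almost_hom S(2) by (intro tendsto_sum) (auto simp: bad_def)
    then have lim: "((\<lambda>i. \<Sum>x\<in>?S. real (card (bad i x)) / real (n i)) \<longlongrightarrow> 0) U" by simp
    show "((\<lambda>i. real (card (\<Union>x\<in>?S. bad i x)) / real (n i)) \<longlongrightarrow> 0) U"
    proof (rule tendsto_sandwich[OF _ _ tendsto_const lim])
      have "card (\<Union>x\<in>?S. bad i x) \<le> (\<Sum>x\<in>?S. card (bad i x))" for i by (rule card_UN_le[OF S(1)])
      then have "real (card (\<Union>x\<in>?S. bad i x)) \<le> (\<Sum>x\<in>?S. real (card (bad i x)))" for i
        by (metis of_nat_le_iff of_nat_sum)
      then have "real (card (\<Union>x\<in>?S. bad i x)) / real (n i) \<le> (\<Sum>x\<in>?S. real (card (bad i x)) / real (n i))" for i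
        by (simp add: sum_divide_distrib[symmetric] divide_right_mono)
      then show "eventually (\<lambda>i. real (card (\<Union>x\<in>?S. bad i x)) / real (n i) \<le>
          (\<Sum>x\<in>?S. real (card (bad i x)) / real (n i))) U" by simp
    qed simp
    show "finite (\<Union>x\<in>?S. bad i x)" for i using S(1) by (auto simp: bad_def)
    fix i v k assume v: "v \<in> vec_space.vecs D (n i)" and k: "k < n i" "k \<notin> (\<Union>x\<in>?S. bad i x)"
    then show "Rep (\<alpha> \<otimes>\<^bsub>DG\<^esub> \<beta>) i v k = (Rep \<alpha> \<otimes>\<^bsub>P\<^esub> Rep \<beta>) i v k"
      using M.rep_mult[OF \<alpha> \<beta> v k(1)] by (force simp: Rep_def bad_def)
  qed
qed

lemma group_ring_pointwise_closed:
  assumes \<alpha>: "\<alpha> \<in> carrier DG" and \<beta>: "\<beta> \<in> carrier DG"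
    and f: "f \<zero>\<^bsub>D\<^esub> \<zero>\<^bsub>D\<^esub> = \<zero>\<^bsub>D\<^esub>" "\<And>x y. \<lbrakk>x \<in> carrier D; y \<in> carrier D\<rbrakk> \<Longrightarrow> f x y \<in> carrier D"
  shows "(\<lambda>g. f (\<alpha> g) (\<beta> g)) \<in> carrier DG"
proof -
  have "finite {x \<in> carrier G. f (\<alpha> x) (\<beta> x) \<noteq> \<zero>\<^bsub>D\<^esub>}"
  proof (rule finite_subset)
    show "finite (supp \<alpha> \<union> supp \<beta>)" using M.group_ringD(2)[OF \<alpha>] M.group_ringD(2)[OF \<beta>] by blast
    show "{x \<in> carrier G. f (\<alpha> x) (\<beta> x) \<noteq> \<zero>\<^bsub>D\<^esub>} \<subseteq> supp \<alpha> \<union> supp \<beta>"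
      using f(1) unfolding M.supp_def by fastforce
  qed
  then show ?thesis using \<alpha> \<beta> f by (simp add: group_ring_def)
qed

lemma group_ring_add_closed:
  "\<lbrakk>\<alpha> \<in> carrier DG; \<beta> \<in> carrier DG\<rbrakk> \<Longrightarrow> \<alpha> \<oplus>\<^bsub>DG\<^esub> \<beta> \<in> carrier DG"
  using group_ring_pointwise_closed[of \<alpha> \<beta> "(\<oplus>\<^bsub>D\<^esub>)"] M.l_zero[OF M.zero_closed] M.a_closed
  by (simp add: group_ring_def)

lemma Rep_add:
  assumes "\<alpha> \<in> carrier DG" "\<beta> \<in> carrier DG" "\<gamma> \<in> carrier DG" "\<And>g. g \<in> carrier G \<Longrightarrow> \<gamma> g = \<alpha> g \<oplus>\<^bsub>D\<^esub> \<beta> g"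
  shows "Rep \<gamma> = Rep \<alpha> \<oplus>\<^bsub>P\<^esub> Rep \<beta>"
  using M.rep_add[OF assms] by (simp add: Rep_def fun_eq_iff)

text \<open>Write \<open>h = g x\<close> with \<open>x\<close> not the identity. Wherever the
  product rule holds, a coincidence of \<open>\<sigma> i h\<close> and \<open>\<sigma> i g\<close>
  at \<open>k\<close> makes \<open>\<sigma> i g k\<close> a fixed point of
  \<open>\<sigma> i x\<close>, and such fixed points are rare.\<close>

lemma almost_distinct:
  assumes g: "g \<in> carrier G" and h: "h \<in> carrier G" and "g \<noteq> h"
  shows "((\<lambda>i. real (card {k\<in>{..<n i}. \<sigma> i h k = \<sigma> i g k}) / real (n i)) \<longlongrightarrow> 0) U"
proof -
  define x where "x = inv\<^bsub>G\<^esub> g \<otimes>\<^bsub>G\<^esub> h"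
  have x: "x \<in> carrier G" using g h by (simp add: x_def)
  have gx: "g \<otimes>\<^bsub>G\<^esub> x = h" using g h G.m_assoc[of g "inv\<^bsub>G\<^esub> g" h] by (simp add: x_def)
  have x1: "x \<noteq> \<one>\<^bsub>G\<^esub>" using gx g \<open>g \<noteq> h\<close> by auto
  let ?a = "\<lambda>i. {k\<in>{..<n i}. \<sigma> i (g \<otimes>\<^bsub>G\<^esub> x) k \<noteq> \<sigma> i x (\<sigma> i g k)}"
  let ?b = "\<lambda>i. {k\<in>{..<n i}. \<sigma> i x k = k}"
  have lim: "((\<lambda>i. real (card (?a i)) / real (n i) + real (card (?b i)) / real (n i)) \<longlongrightarrow> 0) U"
    using tendsto_add[OF almost_hom[OF g x] almost_free[OF x x1]] by simp
  show ?thesis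
  proof (rule tendsto_sandwich[OF _ _ tendsto_const lim])
    have le: "card {k\<in>{..<n i}. \<sigma> i h k = \<sigma> i g k} \<le> card (?a i) + card (?b i)" for i
    proof -
      let ?c = "{k\<in>{..<n i}. \<sigma> i g k \<in> ?b i}"
      have "card {k\<in>{..<n i}. \<sigma> i h k = \<sigma> i g k} \<le> card (?a i \<union> ?c)"
        using M.\<sigma>_less[OF g] by (intro card_mono) (auto simp: gx)
      also have "\<dots> \<le> card (?a i) + card ?c" by (rule card_Un_le)
      also have "card ?c \<le> card (?b i)"
        using M.\<sigma>_inj[OF g, of i ?c] by (intro card_inj_on_le[of "\<sigma> i g"]) auto
      finally show ?thesis by simp
    qed
    have "real (card {k\<in>{..<n i}. \<sigma> i h k = \<sigma> i g k}) \<le> real (card (?a i)) + real (card (?b i))" for i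
      using of_nat_mono[OF le[of i], where 'a=real] by simp
    then show "eventually (\<lambda>i. real (card {k\<in>{..<n i}. \<sigma> i h k = \<sigma> i g k}) / real (n i) \<le>
        real (card (?a i)) / real (n i) + real (card (?b i)) / real (n i)) U"
      by (simp add: add_divide_distrib[symmetric] divide_right_mono)
  qed simp
qed

lemma Rep_nonzero:
  assumes \<alpha>: "\<alpha> \<in> carrier DG" and g0: "g0 \<in> supp \<alpha>"
  shows "UP.ulim (Rep \<alpha>) \<noteq> 0"
proof
  assume 0: "UP.ulim (Rep \<alpha>) = 0"
  let ?c = "real (1 + 2 * card (supp \<alpha>))"
  let ?r = "\<lambda>i. real (vec_space.rk D (n i) (Rep \<alpha> i)) / real (n i)"
  let ?s = "\<lambda>i. \<Sum>g\<in>supp \<alpha> - {g0}. real (card {k\<in>{..<n i}. \<sigma> i g k = \<sigma> i g0 k}) / real (n i)"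
  have sG: "supp \<alpha> \<subseteq> carrier G" using M.group_ringD[OF \<alpha>] by blast
  have "(?s \<longlongrightarrow> (\<Sum>g\<in>supp \<alpha> - {g0}. 0)) U"
    using sG g0 by (intro tendsto_sum almost_distinct) auto
  then have "((\<lambda>i. ?r i * ?c + ?s i) \<longlongrightarrow> 0 * ?c + 0) U"
    using UP.tendsto_ulim[OF Rep_closed[OF \<alpha>]] 0 by (intro tendsto_intros) simp_all
  \<comment> \<open>\<open>rep_rank_lower\<close> divided by \<open>n i\<close>. The constant
    \<open>?c\<close> depends only on the support, so rank zero in the limit would give
    \<open>1 \<le> 0\<close>.\<close>
  moreover have "1 \<le> ?r i * ?c + ?s i" for i
  proof -
    have "real (n i) \<le> real (vec_space.rk D (n i) (Rep \<alpha> i) * (1 + 2 * card (supp \<alpha>)) +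
        (\<Sum>g\<in>supp \<alpha> - {g0}. card {k\<in>{..<n i}. \<sigma> i g k = \<sigma> i g0 k}))"
      using M.rep_rank_lower[OF \<alpha> g0, of i] unfolding Rep_def of_nat_le_iff .
    also have "\<dots> = real (vec_space.rk D (n i) (Rep \<alpha> i)) * ?c +
        (\<Sum>g\<in>supp \<alpha> - {g0}. real (card {k\<in>{..<n i}. \<sigma> i g k = \<sigma> i g0 k}))"
      by (simp add: distrib_left)
    finally have "real (n i) / real (n i) \<le> \<dots> / real (n i)" by (rule divide_right_mono) simp
    then show ?thesis using n_pos[of i] by (simp add: add_divide_distrib sum_divide_distrib)
  qed
  ultimately have "1 \<le> (0 * ?c + 0 :: real)"
    by (intro tendsto_le[OF U_nonbot _ tendsto_const]) auto
  then show False by simp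
qed

text \<open>Addition is respected exactly by \<open>Rep\<close>, whereas products and the unit agree
  only up to rank zero, which becomes zero under \<open>\<pi>\<close>. For injectivity,
  \<open>\<alpha>\<close> is written as \<open>\<gamma>\<close> plus \<open>\<beta>\<close>; equal
  images then force \<open>Rep \<gamma>\<close> to have rank zero.\<close>

lemma group_ring_embedding:
  assumes "rank_ring Q N" and \<pi>: "\<pi> \<in> ring_hom P Q"
    and N: "\<And>x. x \<in> carrier P \<Longrightarrow> N (\<pi> x) = UP.ulim x"
  shows "\<pi> \<circ> Rep \<in> ring_hom DG Q" "inj_on (\<pi> \<circ> Rep) (carrier DG)"
proof -
  interpret Q: rank_ring Q N by fact
  interpret \<pi>: ring_hom_ring P Q \<pi>
    using \<pi> Q.ring_axioms UP.P.ring_axioms by (intro ring_hom_ringI2)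
  have eqI: "\<pi> x = \<pi> y" if "x \<in> carrier P" "y \<in> carrier P" "UP.ulim (x \<ominus>\<^bsub>P\<^esub> y) = 0" for x y
  proof -
    have "\<pi> (x \<ominus>\<^bsub>P\<^esub> y) = \<pi> x \<ominus>\<^bsub>Q\<^esub> \<pi> y"
      using that(1,2) by (simp only: a_minus_def \<pi>.hom_add \<pi>.hom_a_inv UP.P.a_inv_closed)
    then have "N (\<pi> x \<ominus>\<^bsub>Q\<^esub> \<pi> y) = 0" using N[OF UP.P.minus_closed[OF that(1,2)]] that(3) by simp
    then show ?thesis
      using Q.diff_eq_zeroD Q.N_definite \<pi>.hom_closed[OF that(1)] \<pi>.hom_closed[OF that(2)]
      by (metis Q.minus_closed)
  qed
  have add: "\<pi> (Rep \<gamma>) = \<pi> (Rep \<alpha>) \<oplus>\<^bsub>Q\<^esub> \<pi> (Rep \<beta>)"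
    if "\<alpha> \<in> carrier DG" "\<beta> \<in> carrier DG" "\<gamma> \<in> carrier DG" "\<And>g. g \<in> carrier G \<Longrightarrow> \<gamma> g = \<alpha> g \<oplus>\<^bsub>D\<^esub> \<beta> g"
    for \<alpha> \<beta> \<gamma>
    using Rep_add[OF that] \<pi>.hom_add[OF Rep_closed[OF that(1)] Rep_closed[OF that(2)]] by (simp only:)
  have one: "\<one>\<^bsub>DG\<^esub> \<in> carrier DG"
    by (auto simp: group_ring_def intro: finite_subset[of _ "{\<one>\<^bsub>G\<^esub>}"])
  show "\<pi> \<circ> Rep \<in> ring_hom DG Q"
  proof (rule ring_hom_memI)
    fix \<alpha> assume "\<alpha> \<in> carrier DG"
    then show "(\<pi> \<circ> Rep) \<alpha> \<in> carrier Q" using \<pi>.hom_closed[OF Rep_closed] by simp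
  next
    fix \<alpha> \<beta> assume ab: "\<alpha> \<in> carrier DG" "\<beta> \<in> carrier DG"
    show "(\<pi> \<circ> Rep) (\<alpha> \<oplus>\<^bsub>DG\<^esub> \<beta>) = (\<pi> \<circ> Rep) \<alpha> \<oplus>\<^bsub>Q\<^esub> (\<pi> \<circ> Rep) \<beta>"
      using add[OF ab group_ring_add_closed[OF ab]] by (simp add: group_ring_def)
    have "\<pi> (Rep (\<alpha> \<otimes>\<^bsub>DG\<^esub> \<beta>)) = \<pi> (Rep \<alpha> \<otimes>\<^bsub>P\<^esub> Rep \<beta>)"
      by (intro eqI Rep_mult Rep_closed UP.P.m_closed M.group_ring_mult_closed ab)
    also have "\<dots> = \<pi> (Rep \<alpha>) \<otimes>\<^bsub>Q\<^esub> \<pi> (Rep \<beta>)" by (intro \<pi>.hom_mult Rep_closed ab)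
    finally show "(\<pi> \<circ> Rep) (\<alpha> \<otimes>\<^bsub>DG\<^esub> \<beta>) = (\<pi> \<circ> Rep) \<alpha> \<otimes>\<^bsub>Q\<^esub> (\<pi> \<circ> Rep) \<beta>" by simp
  next
    have "\<pi> (Rep \<one>\<^bsub>DG\<^esub>) = \<pi> \<one>\<^bsub>P\<^esub>" by (intro eqI Rep_one Rep_closed one UP.P.one_closed)
    then show "(\<pi> \<circ> Rep) \<one>\<^bsub>DG\<^esub> = \<one>\<^bsub>Q\<^esub>" by (simp del: prod_ring_simps)
  qed
  show "inj_on (\<pi> \<circ> Rep) (carrier DG)"
  proof (rule inj_onI, rule ccontr)
    fix \<alpha> \<beta> assume ab: "\<alpha> \<in> carrier DG" "\<beta> \<in> carrier DG" and eq: "(\<pi> \<circ> Rep) \<alpha> = (\<pi> \<circ> Rep) \<beta>"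
      and "\<alpha> \<noteq> \<beta>"
    then obtain g0 where g0: "\<alpha> g0 \<noteq> \<beta> g0" by auto
    have g0G: "g0 \<in> carrier G" using g0 ab by (cases "g0 \<in> carrier G") (simp_all add: group_ring_def)
    define \<gamma> where "\<gamma> g = \<alpha> g \<ominus>\<^bsub>D\<^esub> \<beta> g" for g
    note c = M.group_ringD(1)[OF ab(1)] M.group_ringD(1)[OF ab(2)]
    have \<gamma>: "\<gamma> \<in> carrier DG"
      unfolding \<gamma>_def by (rule group_ring_pointwise_closed[OF ab]) (simp_all add: a_minus_def)
    have "\<alpha> g = \<gamma> g \<oplus>\<^bsub>D\<^esub> \<beta> g" for g
      using c by (simp add: \<gamma>_def a_minus_def M.a_assoc M.l_neg)
    then have "\<pi> (Rep \<alpha>) = \<pi> (Rep \<gamma>) \<oplus>\<^bsub>Q\<^esub> \<pi> (Rep \<beta>)" using add[OF \<gamma> ab(2,1)] by simp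
    then have "\<pi> (Rep \<gamma>) = \<zero>\<^bsub>Q\<^esub>"
      using eq \<pi>.hom_closed[OF Rep_closed[OF \<gamma>]] \<pi>.hom_closed[OF Rep_closed[OF ab(2)]]
      by (simp del: prod_ring_simps)
    then have "UP.ulim (Rep \<gamma>) = 0" using N[OF Rep_closed[OF \<gamma>]] Q.N_zero by simp
    moreover have "\<gamma> g0 \<noteq> \<zero>\<^bsub>D\<^esub>" using g0 c by (simp add: \<gamma>_def)
    then have "g0 \<in> supp \<gamma>" using g0G by (simp add: M.supp_def)
    ultimately show False using Rep_nonzero[OF \<gamma>] by blast
  qed
qed

end

text \<open>A linear map is determined by its matrix, so a family is determined by the set of its
  entries tagged with index, column and row. Each tagged entry is first a list over the sum type and
  then, by \<open>inj_list_ex\<close>, a single element of it.\<close>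

lemma inj_on_encode_families:
  fixes D :: "'d ring" and n :: "'g list \<Rightarrow> nat"
  assumes V: "vec_space D"
  obtains enc :: "('g list \<Rightarrow> (nat \<Rightarrow> 'd) \<Rightarrow> nat \<Rightarrow> 'd) \<Rightarrow> ('g + 'd + nat) set"
    where "inj_on enc (carrier (prod_ring (\<lambda>i. vec_space.lin_ring D (n i))))"
proof -
  interpret V: vec_space D "n i" for i by (rule V)
  have "infinite (range (Inr \<circ> Inr :: nat \<Rightarrow> 'g + 'd + nat))"
    by (intro range_inj_infinite inj_compose) auto
  then have "infinite (UNIV :: ('g + 'd + nat) set)" using finite_subset subset_UNIV by blast
  then obtain e :: "('g + 'd + nat) list \<Rightarrow> 'g + 'd + nat" where e: "inj e" using inj_list_ex by blast
  \<comment> \<open>The list \<open>i\<close> has variable length and therefore comes last, after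
    three entries in fixed positions.\<close>
  define tag where "tag i j k d = e (Inr (Inr j) # Inr (Inr k) # Inr (Inl d) # map Inl i)"
    for i :: "'g list" and j k :: nat and d :: 'd
  have tag: "tag i j k d = tag i' j' k' d' \<longleftrightarrow> i = i' \<and> j = j' \<and> k = k' \<and> d = d'" for i j k d i' j' k' d'
    by (auto simp: tag_def inj_eq[OF e] inj_map_eq_map)
  define enc where "enc f = {tag i j k (f i (vec_space.vunit D j) k) | i j k. True}"
    for f :: "'g list \<Rightarrow> (nat \<Rightarrow> 'd) \<Rightarrow> nat \<Rightarrow> 'd"
  have "inj_on enc (carrier (prod_ring (\<lambda>i. vec_space.lin_ring D (n i))))"
  proof (rule inj_onI)
    fix f g assume fg: "f \<in> carrier (prod_ring (\<lambda>i. vec_space.lin_ring D (n i)))"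
      "g \<in> carrier (prod_ring (\<lambda>i. vec_space.lin_ring D (n i)))" and eq: "enc f = enc g"
    have "f i (vec_space.vunit D j) k = g i (vec_space.vunit D j) k" for i j k
    proof -
      have "tag i j k (f i (vec_space.vunit D j) k) \<in> enc f" unfolding enc_def by blast
      then have "tag i j k (f i (vec_space.vunit D j) k) \<in> enc g" by (simp only: eq)
      then show ?thesis by (auto simp: enc_def tag)
    qed
    then have "f i = g i" for i using fg by (intro V.lin_eqI) auto
    then show "f = g" by auto
  qed
  then show ?thesis using that by blast
qed

theorem theorem1p3:
  fixes G :: "'g monoid" and D :: "'d ring"
  assumes "group G" and "sofic_group G" and "division_ring D"
  shows "\<exists>(R :: (('g + 'd + nat) set set) ring) h.
           ring R \<and> vn_regular R \<and> continuous_ring R \<and> indecomposable_ring R \<and>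
           h \<in> ring_hom (group_ring D G) R \<and> inj_on h (carrier (group_ring D G))"
proof -
  obtain n \<sigma> U where "U \<noteq> bot" "\<And>P. eventually P U \<or> eventually (\<lambda>x. \<not> P x) U" "\<And>i. 0 < n i"
    "\<And>i g. g \<in> carrier G \<Longrightarrow> \<sigma> i g permutes {..<n i}"
    "\<And>g h. \<lbrakk>g \<in> carrier G; h \<in> carrier G\<rbrakk> \<Longrightarrow>
      ((\<lambda>i :: 'g list. real (card {k\<in>{..<n i}. \<sigma> i (g \<otimes>\<^bsub>G\<^esub> h) k \<noteq> \<sigma> i h (\<sigma> i g k)}) / real (n i)) \<longlongrightarrow> 0) U"
    "\<And>g. \<lbrakk>g \<in> carrier G; g \<noteq> \<one>\<^bsub>G\<^esub>\<rbrakk> \<Longrightarrow>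
      ((\<lambda>i. real (card {k\<in>{..<n i}. \<sigma> i g k = k}) / real (n i)) \<longlongrightarrow> 0) U"
    by (rule sofic_approximation_ex[OF assms(1,2)]) (assumption | rule that)+
  then interpret sofic_model G D n \<sigma> U
    using assms by (intro sofic_model.intro sofic_model_axioms.intro)
  interpret P: pseudo_rank_ring P UP.ulim by (rule UP.pseudo_rank_ring_P)
  obtain enc :: "('g list \<Rightarrow> (nat \<Rightarrow> 'd) \<Rightarrow> nat \<Rightarrow> 'd) \<Rightarrow> ('g + 'd + nat) set" where "inj_on enc (carrier P)"
    using inj_on_encode_families[OF M.vec_space_axioms] by blast
  then obtain Q :: "('g + 'd + nat) set set ring" and N \<pi> where Q: "rank_ring Q N"
    and \<pi>: "\<pi> \<in> ring_hom P Q" "\<And>x. x \<in> carrier P \<Longrightarrow> N (\<pi> x) = UP.ulim x"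
    using P.rank_ring_quotient_ex by blast
  interpret Q: rank_ring Q N by (rule Q)
  show ?thesis
    using Q.ring_axioms Q.vn_regular Q.continuous_ring Q.indecomposable_ring
      group_ring_embedding[OF Q \<pi>] by blast
qed

end
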